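(* Let $T>0$. Assume that for some $M\ge0$: $\|F(0)\|\le M$ and $\|F(x)-F(y)\|\le M\|x-y\|_{-1}$ for all $x,y\in H$; $\|G(x)-G(y)\|\le M\|x-y\|_{-1}$ for all $x,y\in H$; $\|G(x)\|\le M$ for all $x\in H$; and $\int_H\|z\|^2e^{K\|z\|}\nu(dz)<+\infty$ for every $K>0$. Then there exist a constant $C_1(T)$, constants $C_2(\|x\|,T)$ and, for every $x\in H$, a modulus $\omega_x$, such that the following holds. Let $0\le t\le T$, $x,y\in H$, and let $X_n$ and $Y_n$ be the mild solutions on $[t,T]$ of $$dX_n(s)=(-AX_n(s)+F(X_n(s)))\,ds+G(X_n(s-))\,dL_n(s)$$ with initial conditions $X_n(t)=x$ and $Y_n(t)=y$ respectively. Then for all $t\le s\le T$ $$\mathbb{E}\|X_n(s)-Y_n(s)\|_{-1}^2\le C_1(T)\|x-y\|_{-1}^2,$$ $$\mathbb{E}\|X_n(s)-x\|_{-1}^2\le C_2(\|x\|,T)(s-t),$$ $$\mathbb{E}\|X_n(s)-x\|^2\le\omega_x(s-t).$$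
   Context: $H$ is a real separable Hilbert space; $L(H)$ is the space of bounded linear operators on $H$; $F:H\to H$, $G:H\to L(H)$. $A$ is a linear, densely defined, maximal monotone operator in $H$, and $S(\cdot)$ is the contraction $C_0$-semigroup generated by $-A$. $B$ is a bounded, linear, (strictly) positive, self-adjoint operator on $H$ such that $A^*B$ is bounded on $H$ and $\langle(A^*B+c_0B)x,x\rangle\ge0$ for all $x\in H$, for some $c_0\ge0$. $\|x\|_{-1}=\|B^{1/2}x\|$. $\nu$ is a Borel measure on $H$ with $\nu(\{0\})=0$ and $\int_H\|z\|^2\nu(dz)<\infty$. On a complete probability space with a normal filtration, $L(t)=\int_0^t\int_Hz\,\hat\pi(ds,dz)$ is the square integrable pure-jump Lévy martingale with jump measure $\nu$ ($\hat\pi(ds,dz)=\pi(ds,dz)-ds\,\nu(dz)$ is the compensated Poisson random measure of jumps), and $L_n(t)=\frac1nL(nt)$, $n=1,2,\dots$. The mild solution with $X_n(t)=x$ satisfies $X_n(s)=S(s-t)x+\int_t^sS(s-\tau)F(X_n(\tau))d\tau+\int_t^sS(s-\tau)G(X_n(\tau-))dL_n(\tau)$; it exists and is unique. A modulus is a nondecreasing continuous function $\omega:[0,\infty)\to[0,\infty)$ with $\omega(0)=0$. The data $A,B,c_0,M,F,G,\nu$ are fixed and constants may depend on them in addition to the displayed arguments. *)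

theory Defs
  imports "HOL-Probability.Probability"
begin

text \<open>
  A real separable Hilbert space is a type of class
  \<open>{real_inner, banach, second_countable_topology}\<close>; bounded operators are elements of
  \<open>'a \<Rightarrow>\<^sub>L 'a\<close> with the operator norm.  An unbounded operator is a pair of its domain \<open>D\<close>
  and a total function \<open>A\<close> whose values outside \<open>D\<close> are irrelevant.
\<close>

definition op_graph :: "'a set \<Rightarrow> ('a \<Rightarrow> 'a) \<Rightarrow> ('a \<times> 'a) set" where
  "op_graph D A = {(x, A x) | x. x \<in> D}"

definition monotone_graph :: "('a::real_inner \<times> 'a) set \<Rightarrow> bool" where
  "monotone_graph \<Gamma> \<longleftrightarrow> (\<forall>(x, u)\<in>\<Gamma>. \<forall>(y, v)\<in>\<Gamma>. 0 \<le> (u - v) \<bullet> (x - y))"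

definition maximal_monotone_graph :: "('a::real_inner \<times> 'a) set \<Rightarrow> bool" where
  "maximal_monotone_graph \<Gamma> \<longleftrightarrow>
     monotone_graph \<Gamma> \<and> (\<forall>\<Gamma>'. monotone_graph \<Gamma>' \<and> \<Gamma> \<subseteq> \<Gamma>' \<longrightarrow> \<Gamma>' = \<Gamma>)"

definition densely_defined_linear :: "'a::real_normed_vector set \<Rightarrow> ('a \<Rightarrow> 'a) \<Rightarrow> bool" where
  "densely_defined_linear D A \<longleftrightarrow>
     subspace D \<and> closure D = UNIV \<and>
     (\<forall>x\<in>D. \<forall>y\<in>D. A (x + y) = A x + A y) \<and> (\<forall>c. \<forall>x\<in>D. A (c *\<^sub>R x) = c *\<^sub>R A x)"

definition adj_dom :: "'a::real_inner set \<Rightarrow> ('a \<Rightarrow> 'a) \<Rightarrow> 'a set" where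
  "adj_dom D A = {y. \<exists>w. \<forall>x\<in>D. A x \<bullet> y = x \<bullet> w}"

definition adj_op :: "'a::real_inner set \<Rightarrow> ('a \<Rightarrow> 'a) \<Rightarrow> 'a \<Rightarrow> 'a" where
  "adj_op D A y = (THE w. \<forall>x\<in>D. A x \<bullet> y = x \<bullet> w)"

definition contraction_C0_semigroup :: "(real \<Rightarrow> 'a::real_normed_vector \<Rightarrow>\<^sub>L 'a) \<Rightarrow> bool" where
  "contraction_C0_semigroup S \<longleftrightarrow>
     S 0 = id_blinfun \<and>
     (\<forall>s\<ge>0. \<forall>t\<ge>0. S (s + t) = S s o\<^sub>L S t) \<and>
     (\<forall>x. ((\<lambda>t. S t x) \<longlongrightarrow> x) (at_right 0)) \<and>
     (\<forall>t\<ge>0. norm (S t) \<le> 1)"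

definition generated_by_minus ::
  "(real \<Rightarrow> 'a::real_normed_vector \<Rightarrow>\<^sub>L 'a) \<Rightarrow> 'a set \<Rightarrow> ('a \<Rightarrow> 'a) \<Rightarrow> bool" where
  "generated_by_minus S D A \<longleftrightarrow>
     D = {x. \<exists>y. ((\<lambda>h. (1 / h) *\<^sub>R (S h x - x)) \<longlongrightarrow> y) (at_right 0)} \<and>
     (\<forall>x\<in>D. ((\<lambda>h. (1 / h) *\<^sub>R (S h x - x)) \<longlongrightarrow> - A x) (at_right 0))"

definition selfadjoint_op :: "('a::real_inner \<Rightarrow>\<^sub>L 'a) \<Rightarrow> bool" where
  "selfadjoint_op B \<longleftrightarrow> (\<forall>x y. B x \<bullet> y = x \<bullet> B y)"

definition strictly_positive_op :: "('a::real_inner \<Rightarrow>\<^sub>L 'a) \<Rightarrow> bool" where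
  "strictly_positive_op B \<longleftrightarrow> (\<forall>x. x \<noteq> 0 \<longrightarrow> 0 < B x \<bullet> x)"

text \<open>The positive square root \<open>B\<^bsup>1/2\<^esup>\<close>, which exists and is unique for positive self-adjoint \<open>B\<close>.\<close>

definition sqrt_op :: "('a::real_inner \<Rightarrow>\<^sub>L 'a) \<Rightarrow> ('a \<Rightarrow>\<^sub>L 'a)" where
  "sqrt_op B = (SOME R. selfadjoint_op R \<and> (\<forall>x. 0 \<le> R x \<bullet> x) \<and> R o\<^sub>L R = B)"

definition norm_m1 :: "('a::real_inner \<Rightarrow>\<^sub>L 'a) \<Rightarrow> 'a \<Rightarrow> real" where
  "norm_m1 B x = norm (sqrt_op B x)"

definition cadlag_on :: "real set \<Rightarrow> (real \<Rightarrow> 'a::topological_space) \<Rightarrow> bool" where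
  "cadlag_on I f \<longleftrightarrow>
     (\<forall>s\<in>I. (f \<longlongrightarrow> f s) (at s within I \<inter> {s<..}) \<and>
            (\<exists>l. (f \<longlongrightarrow> l) (at s within I \<inter> {..<s})))"

definition left_lim :: "(real \<Rightarrow> 'w \<Rightarrow> 'a::t2_space) \<Rightarrow> real \<Rightarrow> 'w \<Rightarrow> 'a" where
  "left_lim X s \<omega> = Lim (at_left s) (\<lambda>r. X r \<omega>)"

text \<open>Filtrations are indexed by \<open>[0,\<infinity>)\<close>; values at negative times are unconstrained.\<close>

definition normal_filtration :: "'w measure \<Rightarrow> (real \<Rightarrow> 'w measure) \<Rightarrow> bool" where
  "normal_filtration P \<F> \<longleftrightarrow>
     (\<forall>t\<ge>0. space (\<F> t) = space P \<and> sets (\<F> t) \<subseteq> sets P) \<and>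
     (\<forall>s\<ge>0. \<forall>t\<ge>s. sets (\<F> s) \<subseteq> sets (\<F> t)) \<and>
     (\<forall>t\<ge>0. sets (\<F> t) = (\<Inter>u\<in>{t<..}. sets (\<F> u))) \<and>
     null_sets P \<subseteq> sets (\<F> 0)"

text \<open>The jump measure: \<open>emeasure (jump_measure L \<omega>) E\<close> is the number of times \<open>s > 0\<close> with
  \<open>\<Delta>L(s) \<noteq> 0\<close> and \<open>(s, \<Delta>L(s)) \<in> E\<close>.\<close>

definition jump_measure ::
  "(real \<Rightarrow> 'w \<Rightarrow> 'a::{real_normed_vector, second_countable_topology}) \<Rightarrow> 'w \<Rightarrow> (real \<times> 'a) measure" where
  "jump_measure L \<omega> =
     distr (count_space {s. 0 < s \<and> L s \<omega> - left_lim L s \<omega> \<noteq> 0}) borel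
           (\<lambda>s. (s, L s \<omega> - left_lim L s \<omega>))"

definition levy_measure2 :: "'a::{real_normed_vector, second_countable_topology} measure \<Rightarrow> bool" where
  "levy_measure2 \<nu> \<longleftrightarrow>
     sets \<nu> = sets borel \<and> emeasure \<nu> {0} = 0 \<and> (\<integral>\<^sup>+z. ennreal ((norm z)\<^sup>2) \<partial>\<nu>) < \<infinity>"

definition intensity ::
  "'a::{real_normed_vector, second_countable_topology} measure \<Rightarrow> (real \<times> 'a) set \<Rightarrow> ennreal" where
  "intensity \<nu> E = emeasure (lborel \<Otimes>\<^sub>M \<nu>) (E \<inter> {0<..} \<times> UNIV)"

definition poisson_random_measure ::
  "'w measure \<Rightarrow> 'a::{real_normed_vector, second_countable_topology} measure
     \<Rightarrow> ('w \<Rightarrow> (real \<times> 'a) measure) \<Rightarrow> bool" where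
  "poisson_random_measure P \<nu> \<pi> \<longleftrightarrow>
     (\<forall>\<omega>\<in>space P. sets (\<pi> \<omega>) = sets borel) \<and>
     (\<forall>E\<in>sets borel. (\<lambda>\<omega>. emeasure (\<pi> \<omega>) E) \<in> borel_measurable P) \<and>
     (\<forall>E\<in>sets borel. intensity \<nu> E < \<infinity> \<longrightarrow>
        (\<forall>k::nat. measure P {\<omega> \<in> space P. emeasure (\<pi> \<omega>) E = of_nat k} =
           enn2real (intensity \<nu> E) ^ k / fact k * exp (- enn2real (intensity \<nu> E)))) \<and>
     (\<forall>E\<in>sets borel. intensity \<nu> E = \<infinity> \<longrightarrow> (AE \<omega> in P. emeasure (\<pi> \<omega>) E = \<infinity>)) \<and>
     (\<forall>E :: nat \<Rightarrow> (real \<times> 'a) set. range E \<subseteq> sets borel \<and> disjoint_family E \<longrightarrow>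
        prob_space.indep_vars P (\<lambda>_. borel) (\<lambda>i \<omega>. emeasure (\<pi> \<omega>) (E i)) UNIV)"

text \<open>
  \<open>L(t) = \<integral>\<^sub>0\<^sup>t \<integral> z (\<pi>(ds,dz) - ds \<nu>(dz))\<close> with \<open>\<pi>\<close> the jump measure of \<open>L\<close>.  The compensated
  integral is the \<open>L\<^sup>2(P)\<close>-limit, as \<open>\<epsilon> \<down> 0\<close>, of the compensated sums of the jumps of size
  greater than \<open>\<epsilon>\<close>; there are finitely many of these in \<open>(0,t]\<close>.  The last clause says that
  \<open>L\<close> has increments independent of the past of the given filtration.
\<close>

definition levy_martingale ::
  "'w measure \<Rightarrow> (real \<Rightarrow> 'w measure)
     \<Rightarrow> 'a::{real_inner, banach, second_countable_topology} measure \<Rightarrow> (real \<Rightarrow> 'w \<Rightarrow> 'a) \<Rightarrow> bool" where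
  "levy_martingale P \<F> \<nu> L \<longleftrightarrow>
     (\<forall>t\<ge>0. L t \<in> borel_measurable (\<F> t)) \<and>
     (\<forall>\<omega>\<in>space P. cadlag_on {0..} (\<lambda>t. L t \<omega>)) \<and>
     poisson_random_measure P \<nu> (jump_measure L) \<and>
     (\<forall>t\<ge>0. ((\<lambda>\<epsilon>. \<integral>\<^sup>+\<omega>. ennreal ((norm (L t \<omega> -
          ((LINT p:{0<..t} \<times> {z. \<epsilon> < norm z}|jump_measure L \<omega>. snd p)
           - t *\<^sub>R (LINT z:{z. \<epsilon> < norm z}|\<nu>. z))))\<^sup>2) \<partial>P) \<longlongrightarrow> 0) (at_right 0)) \<and>
     (\<forall>s\<ge>0. \<forall>t\<ge>s. prob_space.indep_set P (sets (\<F> s))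
          (sets (vimage_algebra (space P) (\<lambda>\<omega>. L t \<omega> - L s \<omega>) borel)))"

text \<open>\<open>L\<^sub>n(t) = L(nt)/n\<close> is a Levy martingale for the filtration \<open>\<F>\<^bsub>nt\<^esub>\<close>; its jump measure has
  intensity \<open>ds \<nu>\<^sub>n(dz)\<close> with \<open>\<nu>\<^sub>n\<close> equal to \<open>n\<close> times the image of \<open>\<nu>\<close> under \<open>z \<mapsto> z/n\<close>.\<close>

definition scaled_process :: "nat \<Rightarrow> (real \<Rightarrow> 'w \<Rightarrow> 'a::real_vector) \<Rightarrow> real \<Rightarrow> 'w \<Rightarrow> 'a" where
  "scaled_process n L t \<omega> = (1 / real n) *\<^sub>R L (real n * t) \<omega>"

definition scaled_filtration :: "nat \<Rightarrow> (real \<Rightarrow> 'w measure) \<Rightarrow> real \<Rightarrow> 'w measure" where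
  "scaled_filtration n \<F> t = \<F> (real n * t)"

definition scaled_levy_measure :: "nat \<Rightarrow> 'a::real_normed_vector measure \<Rightarrow> 'a measure" where
  "scaled_levy_measure n \<nu> = scale_measure (of_nat n) (distr \<nu> borel (\<lambda>z. (1 / real n) *\<^sub>R z))"

definition predictable_sigma :: "'w measure \<Rightarrow> (real \<Rightarrow> 'w measure) \<Rightarrow> real \<Rightarrow> real \<Rightarrow> (real \<times> 'w) measure" where
  "predictable_sigma P \<F> t s = sigma ({t<..s} \<times> space P)
     {{a<..b} \<times> E | a b E. t \<le> a \<and> a \<le> b \<and> b \<le> s \<and> E \<in> sets (\<F> a)}"

text \<open>
  The list entry \<open>(a, b, E, R)\<close> stands for the elementary integrand \<open>1\<^bsub>(a,b] \<times> E\<^esub> R\<close>; a list stands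
  for the sum of its entries.
\<close>

type_synonym ('w, 'a) elementary = "(real \<times> real \<times> 'w set \<times> ('a \<Rightarrow>\<^sub>L 'a)) list"

definition elementary_on ::
  "(real \<Rightarrow> 'w measure) \<Rightarrow> real \<Rightarrow> real \<Rightarrow> ('w, 'a::real_normed_vector) elementary \<Rightarrow> bool" where
  "elementary_on \<F> t s ps \<longleftrightarrow>
     (\<forall>(a, b, E, R)\<in>set ps. t \<le> a \<and> a \<le> b \<and> b \<le> s \<and> E \<in> sets (\<F> a))"

definition elementary_val ::
  "('w, 'a::real_normed_vector) elementary \<Rightarrow> real \<Rightarrow> 'w \<Rightarrow> 'a \<Rightarrow>\<^sub>L 'a" where
  "elementary_val ps \<tau> \<omega> =
     (\<Sum>(a, b, E, R)\<leftarrow>ps. (indicator ({a<..b} \<times> E) (\<tau>, \<omega>) :: real) *\<^sub>R R)"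

definition elementary_integral ::
  "(real \<Rightarrow> 'w \<Rightarrow> 'a::real_normed_vector) \<Rightarrow> ('w, 'a) elementary \<Rightarrow> 'w \<Rightarrow> 'a" where
  "elementary_integral N ps \<omega> =
     (\<Sum>(a, b, E, R)\<leftarrow>ps. (indicator E \<omega> :: real) *\<^sub>R blinfun_apply R (N b \<omega> - N a \<omega>))"

text \<open>
  \<open>Z = \<integral>\<^sub>t\<^sup>s \<Phi>(\<tau>) dN(\<tau>)\<close> for a square integrable Levy martingale \<open>N\<close> with Levy measure \<open>\<mu>\<close>: the
  \<open>L\<^sup>2(P)\<close>-limit of integrals of elementary integrands converging to the predictable \<open>\<Phi>\<close> in the
  norm of the isometry.  For \<open>N\<close> with covariance operator \<open>Q\<close> the squared Hilbert-Schmidt norm of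
  \<open>\<Phi> Q\<^bsup>1/2\<^esup>\<close> is \<open>\<integral> \<parallel>\<Phi> z\<parallel>\<^sup>2 \<mu>(dz)\<close>.  Measurability of \<open>\<Phi>\<close> is meant strongly, since \<open>S\<close> is
  only strongly continuous.
\<close>

definition has_stoch_integral ::
  "'w measure \<Rightarrow> (real \<Rightarrow> 'w measure)
     \<Rightarrow> 'a::{real_inner, banach, second_countable_topology} measure \<Rightarrow> (real \<Rightarrow> 'w \<Rightarrow> 'a)
     \<Rightarrow> real \<Rightarrow> real \<Rightarrow> (real \<Rightarrow> 'w \<Rightarrow> 'a \<Rightarrow>\<^sub>L 'a) \<Rightarrow> ('w \<Rightarrow> 'a) \<Rightarrow> bool" where
  "has_stoch_integral P \<F> \<mu> N t s \<Phi> Z \<longleftrightarrow>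
     (\<forall>z. (\<lambda>(\<tau>, \<omega>). blinfun_apply (\<Phi> \<tau> \<omega>) z) \<in> borel_measurable (predictable_sigma P \<F> t s)) \<and>
     Z \<in> borel_measurable P \<and>
     (\<exists>ps :: nat \<Rightarrow> ('w, 'a) elementary.
        (\<forall>k. elementary_on \<F> t s (ps k)) \<and>
        (\<lambda>k. \<integral>\<^sup>+\<omega>. (\<integral>\<^sup>+\<tau>\<in>{t<..s}. (\<integral>\<^sup>+z.
            ennreal ((norm (blinfun_apply (\<Phi> \<tau> \<omega> - elementary_val (ps k) \<tau> \<omega>) z))\<^sup>2)
          \<partial>\<mu>) \<partial>lborel) \<partial>P) \<longlonglongrightarrow> 0 \<and>
        (\<lambda>k. \<integral>\<^sup>+\<omega>. ennreal ((norm (Z \<omega> - elementary_integral N (ps k) \<omega>))\<^sup>2) \<partial>P) \<longlonglongrightarrow> 0)"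

text \<open>Mild solution on \<open>[t,T]\<close>, started from \<open>x\<close> at time \<open>t\<close>, of
  \<open>dX = (-AX + F(X)) ds + G(X(s-)) dN\<close>; \<open>A\<close> enters only through \<open>S\<close>, and \<open>\<mu>\<close> is the Levy
  measure of \<open>N\<close>.  No moment bound on \<open>X\<close> is required.\<close>

definition mild_solution ::
  "'w measure \<Rightarrow> (real \<Rightarrow> 'w measure)
     \<Rightarrow> 'a::{real_inner, banach, second_countable_topology} measure \<Rightarrow> (real \<Rightarrow> 'w \<Rightarrow> 'a)
     \<Rightarrow> (real \<Rightarrow> 'a \<Rightarrow>\<^sub>L 'a) \<Rightarrow> ('a \<Rightarrow> 'a) \<Rightarrow> ('a \<Rightarrow> 'a \<Rightarrow>\<^sub>L 'a)
     \<Rightarrow> real \<Rightarrow> real \<Rightarrow> 'a \<Rightarrow> (real \<Rightarrow> 'w \<Rightarrow> 'a) \<Rightarrow> bool" where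
  "mild_solution P \<F> \<mu> N S F G t T x X \<longleftrightarrow>
     (\<forall>s\<in>{t..T}. X s \<in> borel_measurable (\<F> s)) \<and>
     (\<forall>\<omega>\<in>space P. cadlag_on {t..T} (\<lambda>s. X s \<omega>)) \<and>
     (AE \<omega> in P. X t \<omega> = x) \<and>
     (\<forall>s\<in>{t..T}. \<exists>Z.
        has_stoch_integral P \<F> \<mu> N t s (\<lambda>\<tau> \<omega>. S (s - \<tau>) o\<^sub>L G (left_lim X \<tau> \<omega>)) Z \<and>
        (AE \<omega> in P. X s \<omega> =
           S (s - t) x + (LINT \<tau>:{t..s}|lborel. blinfun_apply (S (s - \<tau>)) (F (X \<tau> \<omega>))) + Z \<omega>))"

definition modulus :: "(real \<Rightarrow> real) \<Rightarrow> bool" where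
  "modulus w \<longleftrightarrow> continuous_on {0..} w \<and> mono_on {0..} w \<and> (\<forall>r\<ge>0. 0 \<le> w r) \<and> w 0 = 0"

end

theory Submission
  imports Defs
begin

text \<open>
  No Ito formula is needed: everything is read off the mild formula. The drift and the stochastic
  convolution are estimated by the Cauchy-Schwarz inequality and the isometry, and the only place where
  the initial datum enters in the weak norm is through the semigroup, for which
  \<open>\<parallel>S(r)x\<parallel>\<^sub>-\<^sub>1\<^sup>2 \<le> e\<^bsup>2 c0 r\<^esup> \<parallel>x\<parallel>\<^sub>-\<^sub>1\<^sup>2\<close> and \<open>\<parallel>S(r)x - x\<parallel>\<^sub>-\<^sub>1\<^sup>2 \<le> 4 \<parallel>A\<^sup>* B\<parallel> \<parallel>x\<parallel>\<^sup>2 r\<close> follow by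
  differentiating \<open>\<langle>B S(r)x, S(r)x\<rangle>\<close> and \<open>\<langle>B(S(r)x - x), S(r)x - x\<rangle>\<close> for \<open>x\<close> in the domain of \<open>A\<close>.
  Gronwall's inequality then gives the first estimate, and together with a uniform bound on
  \<open>E \<parallel>X(s)\<parallel>\<^sup>2\<close> the mild formula gives the other two. All constants are uniform in \<open>n\<close> because the second moment of the
  rescaled Levy measure is \<open>1/n\<close> times that of \<open>\<nu>\<close>.

  The isometry rests on the covariance of the increments of the driving martingale, which comes from the
  first two moments of integrals against a Poisson random measure.
\<close>

text \<open>F and G are Lipschitz from the weak norm into the strong one. Drift and noise
  differences can therefore be estimated in the strong norm by contractivity of S, and the return to
  the weak norm only costs \<open>norm (sqrt_op B)\<close>; this closes the Gronwall loop. Three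
  gaps shape the rest. A mild solution carries no moment bound, so the iteration has no finite
  starting value: paths are truncated, and boundedness of G keeps the noise estimate independent of
  the truncation. The driver is given by its jumps and an L2 limit of compensated sums, without any
  isometry; the second-order structure has to be recovered from Poisson counts and from independence
  of the past. The stochastic integral is only a relation to approximating elementary integrands, so
  it is never evaluated: a norm inequality with the constant 4 and stability under differences
  suffice. In the last estimate the orbit S(r)x is merely continuous, which gives no rate and makes
  the modulus depend on x.\<close>

section \<open>The operator square root\<close>

text \<open>A fixed point \<open>Y = (Q + Y\<^sup>2) / 2\<close> gives \<open>(1 - Y)\<^sup>2 = 1 - Q\<close>. For \<open>\<parallel>Q\<parallel> \<le> 1\<close> the norms of the iterates and of
  their differences are dominated by the scalar iteration with \<open>Q = 1\<close>, which increases to \<open>1\<close>.\<close>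

fun sqrt_majorant :: "nat \<Rightarrow> real" where
  "sqrt_majorant 0 = 0"
| "sqrt_majorant (Suc n) = (1 + (sqrt_majorant n)\<^sup>2) / 2"

fun sqrt_iter :: "('a::real_normed_vector \<Rightarrow>\<^sub>L 'a) \<Rightarrow> nat \<Rightarrow> ('a \<Rightarrow>\<^sub>L 'a)" where
  "sqrt_iter Q 0 = 0"
| "sqrt_iter Q (Suc n) = (1/2) *\<^sub>R (Q + (sqrt_iter Q n o\<^sub>L sqrt_iter Q n))"

lemma sqrt_majorant_bounds: "0 \<le> sqrt_majorant n \<and> sqrt_majorant n \<le> 1"
proof (induction n)
  case (Suc n)
  then have "(sqrt_majorant n)\<^sup>2 \<le> 1" by (simp add: power_le_one)
  then show ?case by simp
qed simp

lemma sqrt_majorant_incseq: "incseq sqrt_majorant"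
proof (rule incseq_SucI)
  fix n
  have "sqrt_majorant (Suc n) - sqrt_majorant n = (1 - sqrt_majorant n)\<^sup>2 / 2"
    by (simp add: power2_eq_square field_simps)
  moreover have "0 \<le> (1 - sqrt_majorant n)\<^sup>2" by simp
  ultimately show "sqrt_majorant n \<le> sqrt_majorant (Suc n)" by linarith
qed

lemma norm_sqrt_iter:
  assumes "norm Q \<le> 1"
  shows "norm (sqrt_iter Q n) \<le> sqrt_majorant n"
proof (induction n)
  case (Suc n)
  have "norm (sqrt_iter Q n o\<^sub>L sqrt_iter Q n) \<le> norm (sqrt_iter Q n) * norm (sqrt_iter Q n)"
    by (rule norm_blinfun_compose)
  also have "\<dots> \<le> sqrt_majorant n * sqrt_majorant n"
    by (intro mult_mono Suc) (use sqrt_majorant_bounds in auto)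
  finally have "norm (Q + (sqrt_iter Q n o\<^sub>L sqrt_iter Q n)) \<le> 1 + (sqrt_majorant n)\<^sup>2"
    using assms norm_triangle_ineq[of Q "sqrt_iter Q n o\<^sub>L sqrt_iter Q n"]
    by (simp add: power2_eq_square)
  then show ?case by simp
qed simp

lemma norm_sqrt_iter_step:
  assumes "norm Q \<le> 1"
  shows "norm (sqrt_iter Q (Suc n) - sqrt_iter Q n) \<le> sqrt_majorant (Suc n) - sqrt_majorant n"
proof (induction n)
  case 0
  then show ?case using assms by simp
next
  case (Suc n)
  let ?Y = "sqrt_iter Q (Suc n)" and ?Z = "sqrt_iter Q n"
  let ?y = "sqrt_majorant (Suc n)" and ?z = "sqrt_majorant n"
  have "sqrt_iter Q (Suc (Suc n)) - sqrt_iter Q (Suc n)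
      = (1/2) *\<^sub>R ((?Y o\<^sub>L ?Y) - (?Z o\<^sub>L ?Z))"
    by (simp add: scaleR_diff_right[symmetric])
  \<comment> \<open>Splitting without commutativity: the mixed product of \<open>?Y\<close> and
    \<open>?Z\<close> cancels. The scalar majorant factors by the same identity, so the two
    recursions match term by term.\<close>
  also have "(?Y o\<^sub>L ?Y) - (?Z o\<^sub>L ?Z) = (?Y o\<^sub>L (?Y - ?Z)) + ((?Y - ?Z) o\<^sub>L ?Z)"
    by (rule blinfun_eqI) (simp add: blinfun.diff_left blinfun.diff_right blinfun.add_left)
  finally have eq: "sqrt_iter Q (Suc (Suc n)) - sqrt_iter Q (Suc n)
      = (1/2) *\<^sub>R ((?Y o\<^sub>L (?Y - ?Z)) + ((?Y - ?Z) o\<^sub>L ?Z))" .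
  have "norm (?Y o\<^sub>L (?Y - ?Z)) \<le> ?y * (?y - ?z)"
    by (rule order_trans[OF norm_blinfun_compose], intro mult_mono Suc norm_sqrt_iter assms)
       (use sqrt_majorant_bounds in auto)
  moreover have "norm ((?Y - ?Z) o\<^sub>L ?Z) \<le> (?y - ?z) * ?z"
    by (rule order_trans[OF norm_blinfun_compose], intro mult_mono Suc norm_sqrt_iter assms)
       (use sqrt_majorant_bounds sqrt_majorant_incseq in \<open>auto simp: incseq_Suc_iff\<close>)
  ultimately have "norm ((?Y o\<^sub>L (?Y - ?Z)) + ((?Y - ?Z) o\<^sub>L ?Z)) \<le> ?y * (?y - ?z) + (?y - ?z) * ?z"
    by (rule norm_triangle_mono)
  moreover have "?y * (?y - ?z) + (?y - ?z) * ?z = 2 * (sqrt_majorant (Suc (Suc n)) - ?y)"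
    unfolding sqrt_majorant.simps(2)[of "Suc n"] sqrt_majorant.simps(2)[of n]
    by (simp add: power2_eq_square field_simps)
  ultimately show ?case unfolding eq norm_scaleR by (simp del: sqrt_iter.simps sqrt_majorant.simps)
qed

text \<open>Summed step bounds telescope, so the distance of two iterates is at most the increment
  of \<open>sqrt_majorant\<close>, which is bounded and monotone and therefore Cauchy.\<close>

lemma sqrt_iter_convergent:
  fixes Q :: "'a::banach \<Rightarrow>\<^sub>L 'a"
  assumes "norm Q \<le> 1"
  shows "convergent (sqrt_iter Q)"
proof -
  have "convergent sqrt_majorant"
    by (rule Bseq_mono_convergent)
       (auto intro!: BseqI'[where K=1] simp: sqrt_majorant_bounds sqrt_majorant_incseq[unfolded mono_def, rule_format])
  then have C: "Cauchy sqrt_majorant" by (simp add: convergent_Cauchy)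
  have le: "norm (sqrt_iter Q (n + k) - sqrt_iter Q n) \<le> sqrt_majorant (n + k) - sqrt_majorant n" for n k
  proof (induction k)
    case (Suc k)
    have "norm (sqrt_iter Q (n + Suc k) - sqrt_iter Q n)
      \<le> norm (sqrt_iter Q (Suc (n + k)) - sqrt_iter Q (n + k)) + norm (sqrt_iter Q (n + k) - sqrt_iter Q n)"
      using norm_triangle_ineq[of "sqrt_iter Q (Suc (n + k)) - sqrt_iter Q (n + k)" "sqrt_iter Q (n + k) - sqrt_iter Q n"]
      by (simp del: sqrt_iter.simps)
    then show ?case using Suc norm_sqrt_iter_step[OF assms, of "n+k"] by simp
  qed simp
  have "Cauchy (sqrt_iter Q)"
    unfolding Cauchy_altdef2
  proof (intro allI impI)
    fix e :: real assume "0 < e"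
    then obtain N where N: "\<forall>n\<ge>N. dist (sqrt_majorant n) (sqrt_majorant N) < e"
      using C unfolding Cauchy_altdef2 by blast
    show "\<exists>N. \<forall>n\<ge>N. dist (sqrt_iter Q n) (sqrt_iter Q N) < e"
    proof (intro exI allI impI)
      fix n assume "N \<le> n"
      then obtain k where k: "n = N + k" using le_Suc_ex by blast
      have "norm (sqrt_iter Q n - sqrt_iter Q N) \<le> sqrt_majorant n - sqrt_majorant N" unfolding k by (rule le)
      also have "\<dots> < e" using N \<open>N \<le> n\<close> by (auto simp: dist_real_def)
      finally show "dist (sqrt_iter Q n) (sqrt_iter Q N) < e" by (simp add: dist_norm)
    qed
  qed
  then show ?thesis by (simp add: Cauchy_convergent)
qed

text \<open>The scaled operator \<open>B'\<close> lies between 0 and 1, so Q = 1 - \<open>B'\<close>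
  is a contraction and the fixed point Y of the iteration satisfies (1 - Y)^2 = \<open>B'\<close>.
  Undoing the scaling leads to sqrt c times 1 - Y, which is positive because Y has norm at most
  1.\<close>

lemma positive_sqrt_exists:
  fixes B :: "'a::{real_inner, banach} \<Rightarrow>\<^sub>L 'a"
  assumes sa: "selfadjoint_op B" and pos: "\<And>x. 0 \<le> B x \<bullet> x"
  shows "\<exists>R. selfadjoint_op R \<and> (\<forall>x. 0 \<le> R x \<bullet> x) \<and> R o\<^sub>L R = B"
proof -
  \<comment> \<open>The summand 1 keeps c positive for B = 0.\<close>
  define c where "c = norm B + 1"
  have c: "c > 0" unfolding c_def by (smt (verit) norm_ge_zero)
  define B' where "B' = (1/c) *\<^sub>R B"
  define Q where "Q = id_blinfun - B'"
  have sa': "B' x \<bullet> y = x \<bullet> B' y" for x y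
    using sa unfolding B'_def selfadjoint_op_def by (simp add: blinfun.scaleR_left)
  have nB': "norm B' \<le> 1" using c unfolding B'_def c_def by simp
  have pos': "0 \<le> B' x \<bullet> x" for x using pos c unfolding B'_def by (simp add: blinfun.scaleR_left)
  have contr: "norm (B' x) \<le> norm x" for x
    by (rule order_trans[OF norm_blinfun]) (use mult_right_mono[OF nB'] in simp)
  \<comment> \<open>The operator inequality \<open>B'\<close>^2 <= \<open>B'\<close>, from
    positivity of the quadratic form at x - \<open>B'\<close> x, whose cubic term is at most the
    squared norm of \<open>B'\<close> x. It makes 1 - \<open>B'\<close> a contraction without
    spectral theory.\<close>
  have key: "B' x \<bullet> B' x \<le> B' x \<bullet> x" for x
  proof -
    have "0 \<le> B' (x - B' x) \<bullet> (x - B' x)" by (rule pos')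
    also have "\<dots> = B' x \<bullet> x - 2 * (B' x \<bullet> B' x) + B' (B' x) \<bullet> B' x"
      using sa'[of "B' x" x] by (simp add: blinfun.diff_right inner_diff inner_commute)
    also have "B' (B' x) \<bullet> B' x \<le> norm (B' (B' x)) * norm (B' x)" by (rule norm_cauchy_schwarz)
    also have "\<dots> \<le> norm (B' x) * norm (B' x)" by (intro mult_right_mono contr) simp
    also have "\<dots> = B' x \<bullet> B' x" by (simp add: dot_square_norm power2_eq_square)
    finally show ?thesis by simp
  qed
  have nQ: "norm Q \<le> 1"
  proof (rule norm_blinfun_bound)
    fix x
    have "(norm (Q x))\<^sup>2 = (norm x)\<^sup>2 - 2 * (B' x \<bullet> x) + B' x \<bullet> B' x"
      unfolding Q_def power2_norm_eq_inner
      by (simp add: blinfun.diff_left inner_diff inner_commute)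
    also have "\<dots> \<le> (norm x)\<^sup>2" using key[of x] pos'[of x] by simp
    finally show "norm (Q x) \<le> 1 * norm x" by (simp add: power2_le_iff_abs_le)
  qed simp
  obtain Y where lim: "sqrt_iter Q \<longlonglongrightarrow> Y"
    using sqrt_iter_convergent[OF nQ] unfolding convergent_def by blast
  have fix_eq: "Y = (1/2) *\<^sub>R (Q + (Y o\<^sub>L Y))"
  proof (rule LIMSEQ_unique)
    show "(\<lambda>n. sqrt_iter Q (Suc n)) \<longlonglongrightarrow> Y" using lim by (rule LIMSEQ_Suc)
    show "(\<lambda>n. sqrt_iter Q (Suc n)) \<longlonglongrightarrow> (1/2) *\<^sub>R (Q + (Y o\<^sub>L Y))"
      unfolding sqrt_iter.simps by (intro tendsto_intros lim bounded_bilinear.tendsto[OF bounded_bilinear_blinfun_compose])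
  qed
  have nY: "norm Y \<le> 1"
    by (rule LIMSEQ_le_const2[OF tendsto_norm[OF lim]])
       (use norm_sqrt_iter[OF nQ] sqrt_majorant_bounds order_trans in blast)
  have saQ: "Q x \<bullet> y = x \<bullet> Q y" for x y
    unfolding Q_def using sa' by (simp add: blinfun.diff_left inner_diff)
  have sai: "sqrt_iter Q n x \<bullet> y = x \<bullet> sqrt_iter Q n y" for n x y
    by (induction n arbitrary: x y) (auto simp: blinfun.add_left blinfun.scaleR_left inner_add saQ)
  have saY: "Y x \<bullet> y = x \<bullet> Y y" for x y
  proof (rule LIMSEQ_unique)
    show "(\<lambda>n. sqrt_iter Q n x \<bullet> y) \<longlonglongrightarrow> Y x \<bullet> y" by (intro tendsto_intros lim)
    show "(\<lambda>n. sqrt_iter Q n x \<bullet> y) \<longlonglongrightarrow> x \<bullet> Y y" unfolding sai by (intro tendsto_intros lim)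
  qed
  define R where "R = sqrt c *\<^sub>R (id_blinfun - Y)"
  have "selfadjoint_op R"
    unfolding selfadjoint_op_def R_def by (simp add: blinfun.diff_left blinfun.scaleR_left inner_diff saY)
  moreover have "0 \<le> R x \<bullet> x" for x
  proof -
    have "Y x \<bullet> x \<le> norm (Y x) * norm x" by (rule norm_cauchy_schwarz)
    also have "\<dots> \<le> (1 * norm x) * norm x"
      by (intro mult_right_mono order_trans[OF norm_blinfun] nY) simp_all
    also have "\<dots> = x \<bullet> x" by (simp add: dot_square_norm power2_eq_square)
    finally show ?thesis using c unfolding R_def
      by (simp add: blinfun.diff_left blinfun.scaleR_left inner_diff)
  qed
  moreover have "R o\<^sub>L R = B"
  proof (rule blinfun_eqI)
    fix x
    have "2 *\<^sub>R Y x = Q x + Y (Y x)"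
      using arg_cong[OF fix_eq, of "\<lambda>f. 2 *\<^sub>R blinfun_apply f x"]
      by (simp add: blinfun.add_left blinfun.scaleR_left)
    then have "x - 2 *\<^sub>R Y x + Y (Y x) = B' x" unfolding Q_def by (simp add: blinfun.diff_left)
    moreover have "(R o\<^sub>L R) x = c *\<^sub>R (x - 2 *\<^sub>R Y x + Y (Y x))"
      using c unfolding R_def
      by (simp add: blinfun.diff_left blinfun.diff_right blinfun.scaleR_left blinfun.scaleR_right
          scaleR_2 algebra_simps)
    ultimately show "(R o\<^sub>L R) x = B x" using c unfolding B'_def by (simp add: blinfun.scaleR_left)
  qed
  ultimately show ?thesis by blast
qed

text \<open>\<open>sqrt_op\<close> is a choice, so only its defining properties may be used. The
  identity trades the weak norm for the quadratic form of B, which can be differentiated along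
  semigroup orbits.\<close>

lemma norm_m1_sq:
  fixes B :: "'a::{real_inner, banach} \<Rightarrow>\<^sub>L 'a"
  assumes sa: "selfadjoint_op B" and pos: "\<And>x. 0 \<le> B x \<bullet> x"
  shows "(norm_m1 B x)\<^sup>2 = B x \<bullet> x"
proof -
  have R: "selfadjoint_op (sqrt_op B) \<and> (\<forall>x. 0 \<le> sqrt_op B x \<bullet> x) \<and> sqrt_op B o\<^sub>L sqrt_op B = B"
    unfolding sqrt_op_def by (rule someI_ex[OF positive_sqrt_exists[OF assms]])
  have "(norm_m1 B x)\<^sup>2 = sqrt_op B x \<bullet> sqrt_op B x"
    unfolding norm_m1_def power2_norm_eq_inner ..
  also have "\<dots> = sqrt_op B (sqrt_op B x) \<bullet> x"
    using R unfolding selfadjoint_op_def by (metis inner_commute)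
  also have "\<dots> = (sqrt_op B o\<^sub>L sqrt_op B) x \<bullet> x" by simp
  finally show ?thesis using R by simp
qed

section \<open>Semigroup estimates in the weak norm\<close>

lemma semigroup_norm_le:
  assumes "contraction_C0_semigroup S" "0 \<le> r"
  shows "norm (blinfun_apply (S r) x) \<le> norm x"
proof -
  have "norm (S r) \<le> 1" using assms unfolding contraction_C0_semigroup_def by auto
  then show ?thesis
    by (intro order_trans[OF norm_blinfun]) (use mult_right_mono[of "norm (S r)" 1 "norm x"] in simp)
qed

lemma semigroup_diff:
  assumes S: "contraction_C0_semigroup S" and pq: "0 \<le> p" "p \<le> q"
  shows "blinfun_apply (S q) x - S p x = S p (S (q - p) x - x)"
proof -
  have "S (p + (q - p)) = S p o\<^sub>L S (q - p)"
    using S pq unfolding contraction_C0_semigroup_def by (metis diff_ge_0_iff_ge)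
  then show ?thesis by (simp add: blinfun.diff_right)
qed

text \<open>The definition only gives right continuity at 0. By contractivity the difference at two
  times is at most the one at time 0 with the same gap, whichever of the two is the earlier, so left
  continuity follows as well.\<close>

lemma semigroup_continuous:
  assumes S: "contraction_C0_semigroup S"
  shows "continuous_on {0..} (\<lambda>r. blinfun_apply (S r) x)"
  unfolding continuous_on_iff
proof (intro ballI allI impI)
  fix p :: real and e :: real assume p: "p \<in> {0..}" and e: "0 < e"
  have "((\<lambda>t. S t x) \<longlongrightarrow> x) (at_right 0)" using S unfolding contraction_C0_semigroup_def by auto
  then have "\<forall>\<^sub>F t in at_right 0. dist (S t x) x < e" using e by (simp add: tendsto_iff)
  then obtain d where d: "d > 0" "\<And>t. 0 < t \<Longrightarrow> t < d \<Longrightarrow> dist (S t x) x < e"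
    unfolding eventually_at_right_field by (metis field_sum_of_halves)
  have S0: "S 0 x = x" using S unfolding contraction_C0_semigroup_def by auto
  have small: "norm (S t x - x) < e" if "0 \<le> t" "t < d" for t
    using d(2)[of t] that e S0 by (cases "t = 0") (auto simp: dist_norm)
  show "\<exists>d>0. \<forall>q\<in>{0..}. dist q p < d \<longrightarrow> dist (S q x) (S p x) < e"
  proof (intro exI[of _ d] conjI ballI impI d(1))
    fix q assume q: "q \<in> {0..}" "dist q p < d"
    show "dist (S q x) (S p x) < e"
    proof (cases "p \<le> q")
      case True
      have "norm (S q x - S p x) \<le> norm (S (q - p) x - x)"
        unfolding semigroup_diff[OF S _ True, of x] using p semigroup_norm_le[OF S, of p] p
        by (simp add: semigroup_diff[OF S _ True])
      also have "\<dots> < e" using True q by (intro small) (auto simp: dist_real_def)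
      finally show ?thesis by (simp add: dist_norm)
    next
      case False
      have "norm (S p x - S q x) \<le> norm (S (p - q) x - x)"
        using q False semigroup_norm_le[OF S, of q] by (simp add: semigroup_diff[OF S])
      also have "\<dots> < e" using False q by (intro small) (auto simp: dist_real_def)
      finally show ?thesis by (simp add: dist_norm norm_minus_commute)
    qed
  qed
qed

text \<open>S(r)w is split into S(r)v and S(r)(w - v), and contractivity bounds the second term by
  the distance of w to v. Joint continuity is what makes the drift integrand Borel measurable, as S
  need not be continuous in operator norm.\<close>

lemma semigroup_joint_continuous:
  fixes S :: "real \<Rightarrow> 'a::real_normed_vector \<Rightarrow>\<^sub>L 'a"
  assumes S: "contraction_C0_semigroup S"
  shows "continuous_on ({0..} \<times> UNIV) (\<lambda>(r, v). blinfun_apply (S r) v)"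
  unfolding continuous_on_def
proof (clarify)
  fix p :: real and v :: 'a assume p: "0 \<le> p"
  let ?F = "at (p, v) within {0..} \<times> UNIV"
  have a: "((\<lambda>z. S (fst z) v) \<longlongrightarrow> S p v) ?F"
  proof -
    have "continuous_on ({0..} \<times> UNIV) (\<lambda>z. S (fst z) v)"
      by (rule continuous_on_compose2[OF semigroup_continuous[OF S]]) (auto intro!: continuous_intros)
    then show ?thesis using p unfolding continuous_on_def by force
  qed
  have "((\<lambda>z. snd z - v) \<longlongrightarrow> v - v) ?F"
    by (intro tendsto_diff tendsto_const) (auto intro!: tendsto_eq_intros)
  then have "((\<lambda>z. norm (snd z - v)) \<longlongrightarrow> 0) ?F" by (simp add: tendsto_norm_zero)
  then have b: "((\<lambda>z. S (fst z) (snd z - v)) \<longlongrightarrow> 0) ?F"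
    by (rule Lim_null_comparison[rotated])
       (auto simp: eventually_at_filter intro!: always_eventually semigroup_norm_le[OF S])
  from tendsto_add[OF a b] show "((\<lambda>(r, v). S r v) \<longlongrightarrow> S p v) ?F"
    by (simp add: blinfun.diff_right case_prod_unfold)
qed

section \<open>Differentiability of semigroup orbits that start in the domain of the
  generator\<close>

lemma generator_difference_quotient:
  assumes "generated_by_minus S D A" "x \<in> D"
  shows "((\<lambda>h. (1 / h) *\<^sub>R (blinfun_apply (S h) x - x)) \<longlongrightarrow> - A x) (at_right 0)"
  using assms unfolding generated_by_minus_def by auto

lemma semigroup_preserves_domain:
  assumes S: "contraction_C0_semigroup S" and gen: "generated_by_minus S D A"
    and x: "x \<in> D" and r: "0 \<le> r"
  shows "S r x \<in> D" "A (S r x) = S r (A x)"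
proof -
  have comm: "S h (S r x) = S r (S h x)" if "h > 0" for h
  proof -
    have "S (h + r) = S h o\<^sub>L S r" "S (r + h) = S r o\<^sub>L S h"
      using S r that unfolding contraction_C0_semigroup_def by auto
    then show ?thesis by (metis add.commute blinfun_apply_blinfun_compose)
  qed
  have "((\<lambda>h. S r ((1 / h) *\<^sub>R (S h x - x))) \<longlongrightarrow> S r (- A x)) (at_right 0)"
    by (intro tendsto_intros generator_difference_quotient[OF gen x])
  moreover have "\<forall>\<^sub>F h in at_right 0. S r ((1 / h) *\<^sub>R (S h x - x)) = (1 / h) *\<^sub>R (S h (S r x) - S r x)"
    unfolding eventually_at_filter
    by (intro always_eventually) (simp add: comm blinfun.diff_right blinfun.scaleR_right)
  ultimately have lim: "((\<lambda>h. (1 / h) *\<^sub>R (S h (S r x) - S r x)) \<longlongrightarrow> - S r (A x)) (at_right 0)"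
    by (simp add: tendsto_cong blinfun.minus_right)
  then show D: "S r x \<in> D" using gen unfolding generated_by_minus_def by blast
  have "- A (S r x) = - S r (A x)"
    by (rule tendsto_unique[OF _ generator_difference_quotient[OF gen D] lim]) simp
  then show "A (S r x) = S r (A x)" by simp
qed

text \<open>The generator is defined by a right derivative at 0. The quotients at r from either side
  are S at the earlier time applied to the quotient at 0 with step \<open>h\<close>. Contractivity
  absorbs this factor, and strong continuity at the vector A x replaces the earlier time by
  r.\<close>

lemma semigroup_has_vector_derivative:
  assumes S: "contraction_C0_semigroup S" and gen: "generated_by_minus S D A"
    and x: "x \<in> D" and r: "0 < r"
  shows "((\<lambda>r. S r x) has_vector_derivative - A (S r x)) (at r)"
proof -
  have q: "\<exists>d>0. \<forall>h. 0 < h \<and> h < d \<longrightarrow> norm ((1 / h) *\<^sub>R (S h x - x) + A x) < e" if "e > 0" for e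
  proof -
    have "\<forall>\<^sub>F h in at_right 0. dist ((1 / h) *\<^sub>R (S h x - x)) (- A x) < e"
      using generator_difference_quotient[OF gen x] that by (simp add: tendsto_iff)
    then show ?thesis unfolding eventually_at_right_field by (auto simp: dist_norm)
  qed
  have "((\<lambda>p. (1 / (p - r)) *\<^sub>R (S p x - S r x)) \<longlongrightarrow> - S r (A x)) (at r)"
    unfolding LIM_eq
  proof (intro allI impI)
    fix e :: real assume e: "0 < e"
    obtain d1 where d1: "d1 > 0" "\<And>h. 0 < h \<and> h < d1 \<Longrightarrow> norm ((1 / h) *\<^sub>R (S h x - x) + A x) < e/2"
      using q[of "e/2"] e by auto
    obtain d2 where d2: "d2 > 0" "\<And>p. p \<ge> 0 \<Longrightarrow> dist p r < d2 \<Longrightarrow> dist (S p (A x)) (S r (A x)) < e/2"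
      using semigroup_continuous[OF S, of "A x"] r e unfolding continuous_on_iff
      by (metis atLeast_iff half_gt_zero less_imp_le)
    \<comment> \<open>The bound by r keeps the comparison time nonnegative, where the semigroup law
      is available.\<close>
    let ?d = "min r (min d1 d2)"
    show "\<exists>s>0. \<forall>p. p \<noteq> r \<and> norm (p - r) < s \<longrightarrow>
        norm ((1 / (p - r)) *\<^sub>R (S p x - S r x) - - S r (A x)) < e"
    proof (intro exI[of _ ?d] conjI allI impI)
      show "?d > 0" using r d1 d2 by simp
      fix p assume p: "p \<noteq> r \<and> norm (p - r) < ?d"
      define m where "m = min p r"
      define h where "h = \<bar>p - r\<bar>"
      have h: "0 < h" "h < d1" "m \<ge> 0" "dist m r < d2"
        using p r d1 d2 unfolding h_def m_def by (auto simp: dist_real_def)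
      have eq: "(1 / (p - r)) *\<^sub>R (S p x - S r x) = S m ((1 / h) *\<^sub>R (S h x - x))"
      proof (cases "r < p")
        case True
        then show ?thesis using r unfolding m_def h_def
          by (simp add: semigroup_diff[OF S] blinfun.scaleR_right)
      next
        case False
        then have pr: "p < r" "p \<ge> 0" using p by auto
        have e: "1 / (p - r) = - (1 / (r - p))" using pr by (simp add: field_simps)
        have "(1 / (p - r)) *\<^sub>R (S p x - S r x) = (1 / (r - p)) *\<^sub>R (S r x - S p x)"
          unfolding e by (simp add: scaleR_diff_right)
        then show ?thesis using pr unfolding m_def h_def
          by (simp add: semigroup_diff[OF S] blinfun.scaleR_right)
      qed
      have "(1 / (p - r)) *\<^sub>R (S p x - S r x) - - S r (A x)
          = S m ((1 / h) *\<^sub>R (S h x - x) + A x) + (S r (A x) - S m (A x))"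
        unfolding eq by (simp add: blinfun.add_right)
      also have "norm \<dots> \<le> norm ((1 / h) *\<^sub>R (S h x - x) + A x) + norm (S r (A x) - S m (A x))"
        by (intro norm_triangle_mono semigroup_norm_le[OF S] h order_refl)
      also have "\<dots> < e/2 + e/2"
        using d1(2)[of h] d2(2)[of m] h
        by (intro add_strict_mono) (auto simp: dist_norm norm_minus_commute)
      finally show "norm ((1 / (p - r)) *\<^sub>R (S p x - S r x) - - S r (A x)) < e" by simp
    qed
  qed
  then have "((\<lambda>p. norm ((1 / (p - r)) *\<^sub>R (S p x - S r x) - - S r (A x))) \<longlongrightarrow> 0) (at r)"
    by (intro tendsto_norm_zero LIM_zero)
  then have "((\<lambda>p. norm (S p x - S r x - (p - r) *\<^sub>R - S r (A x)) / norm (p - r)) \<longlongrightarrow> 0) (at r)"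
  proof (rule Lim_transform_eventually)
    have "norm ((1 / (p - r)) *\<^sub>R (S p x - S r x) - - S r (A x))
        = norm (S p x - S r x - (p - r) *\<^sub>R - S r (A x)) / norm (p - r)" if "p \<noteq> r" for p
    proof -
      have "(1 / (p - r)) *\<^sub>R (S p x - S r x) - - S r (A x)
          = (1 / (p - r)) *\<^sub>R (S p x - S r x - (p - r) *\<^sub>R - S r (A x))"
        using that by (simp add: scaleR_add_right)
      then show ?thesis by (simp only: norm_scaleR) simp
    qed
    then show "\<forall>\<^sub>F p in at r. norm ((1 / (p - r)) *\<^sub>R (S p x - S r x) - - S r (A x))
        = norm (S p x - S r x - (p - r) *\<^sub>R - S r (A x)) / norm (p - r)"
      by (simp add: eventually_at_filter)
  qed
  then show ?thesis
    unfolding semigroup_preserves_domain(2)[OF S gen x less_imp_le[OF r]] has_vector_derivative_def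
      has_derivative_iff_norm
    by (intro conjI bounded_linear_scaleR_left) simp_all
qed

text \<open>The definite description is legitimate because D is dense: two representing vectors
  differ by a vector that is orthogonal to D, hence to itself.\<close>

lemma adj_op_eq:
  fixes D :: "'a::real_inner set"
  assumes dd: "densely_defined_linear D A" and y: "y \<in> adj_dom D A" and x: "x \<in> D"
  shows "A x \<bullet> y = x \<bullet> adj_op D A y"
proof -
  obtain w where w: "\<forall>x\<in>D. A x \<bullet> y = x \<bullet> w" using y unfolding adj_dom_def by blast
  have "adj_op D A y = w"
    unfolding adj_op_def
  proof (rule the_equality[where P="\<lambda>w. \<forall>x\<in>D. A x \<bullet> y = x \<bullet> w", OF w])
    fix v assume v: "\<forall>x\<in>D. A x \<bullet> y = x \<bullet> v"
    have "closed {x. x \<bullet> (v - w) = 0}"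
      by (intro closed_Collect_eq continuous_intros)
    moreover have "D \<subseteq> {x. x \<bullet> (v - w) = 0}" using v w by (auto simp: inner_diff)
    ultimately have "closure D \<subseteq> {x. x \<bullet> (v - w) = 0}" by (simp add: closure_minimal)
    then have "v - w \<in> {x. x \<bullet> (v - w) = 0}"
      using dd[unfolded densely_defined_linear_def, THEN conjunct2, THEN conjunct1] by (simp add: subset_iff)
    then have "(v - w) \<bullet> (v - w) = 0" by (rule CollectD)
    then show "v = w" by simp
  qed
  then show ?thesis using w x by simp
qed

text \<open>With u the orbit, the exponentially weighted form has derivative -2 exp(-2 c0 r) (<A u,
  B u> + c0 <B u, u>). Passing A to the other side as its adjoint turns the bracket into the form
  assumed to be nonnegative. Both sides are continuous in x, so the inequality extends from D by
  density.\<close>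

lemma semigroup_weak_norm_growth:
  fixes D :: "'a::{real_inner, banach} set" and B :: "'a \<Rightarrow>\<^sub>L 'a"
  assumes dd: "densely_defined_linear D A" and S: "contraction_C0_semigroup S"
    and gen: "generated_by_minus S D A" and sa: "selfadjoint_op B"
    and dom: "\<And>x. B x \<in> adj_dom D A"
    and mono: "\<And>x. 0 \<le> (adj_op D A (B x) + c0 *\<^sub>R B x) \<bullet> x"
    and r: "0 \<le> r"
  shows "B (S r x) \<bullet> S r x \<le> exp (2 * c0 * r) * (B x \<bullet> x)"
proof -
  have cont: "continuous_on {0..r} (\<lambda>r. exp (- 2 * c0 * r) * (B (S r x) \<bullet> S r x))" for x
    by (intro continuous_intros continuous_on_subset[OF semigroup_continuous[OF S]]) auto
  have "B (S r x) \<bullet> S r x \<le> exp (2 * c0 * r) * (B x \<bullet> x)" if x: "x \<in> D" for x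
  proof -
    define f where "f r = exp (- 2 * c0 * r) * (B (S r x) \<bullet> S r x)" for r
    have der: "(f has_real_derivative exp (- 2 * c0 * p) * (- 2 * (A (S p x) \<bullet> B (S p x)) - 2 * c0 * (B (S p x) \<bullet> S p x))) (at p)"
      if p: "0 < p" for p
    proof -
      note d = semigroup_has_vector_derivative[OF S gen x p]
      have dB: "((\<lambda>r. B (S r x)) has_vector_derivative B (- A (S p x))) (at p)"
        by (rule bounded_linear.has_vector_derivative[OF blinfun.bounded_linear_right d])
      have "((\<lambda>r. B (S r x) \<bullet> S r x) has_vector_derivative
          (B (S p x) \<bullet> (- A (S p x)) + B (- A (S p x)) \<bullet> S p x)) (at p)"
        by (rule bounded_bilinear.has_vector_derivative[OF bounded_bilinear_inner dB d])
      moreover have "B (S p x) \<bullet> (- A (S p x)) + B (- A (S p x)) \<bullet> S p x = - 2 * (A (S p x) \<bullet> B (S p x))"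
        using sa[unfolded selfadjoint_op_def, rule_format, of "A (S p x)"]
        by (simp add: blinfun.minus_right) (simp add: inner_commute)
      ultimately have "((\<lambda>r. B (S r x) \<bullet> S r x) has_real_derivative - 2 * (A (S p x) \<bullet> B (S p x))) (at p)"
        by (simp add: has_real_derivative_iff_has_vector_derivative)
      then show ?thesis unfolding f_def
        by (auto intro!: derivative_eq_intros simp: algebra_simps)
    qed
    have "f r \<le> f 0"
    \<comment> \<open>The derivative is known at positive times only; this monotonicity criterion
      asks for it in the open interval and for mere continuity at the end points.\<close>
    proof (rule DERIV_nonpos_imp_decreasing_open[OF r])
      fix p assume p: "0 < p" "p < r"
      have D: "S p x \<in> D" using semigroup_preserves_domain(1)[OF S gen x] p by simp
      have "0 \<le> A (S p x) \<bullet> B (S p x) + c0 * (B (S p x) \<bullet> S p x)"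
        using mono[of "S p x"] adj_op_eq[OF dd dom D, of "S p x"] by (simp add: inner_add inner_commute)
      then have "exp (- 2 * c0 * p) * (- 2 * (A (S p x) \<bullet> B (S p x)) - 2 * c0 * (B (S p x) \<bullet> S p x)) \<le> 0"
        by (simp add: mult_le_0_iff)
      then show "\<exists>y. (f has_real_derivative y) (at p) \<and> y \<le> 0" using der[OF p(1)] by blast
    qed (use cont[of x] in \<open>simp add: f_def[abs_def]\<close>)
    moreover have "S 0 x = x" using S unfolding contraction_C0_semigroup_def by simp
    ultimately show ?thesis unfolding f_def by (simp add: exp_minus field_simps)
  qed
  then have "D \<subseteq> {x. B (S r x) \<bullet> S r x \<le> exp (2 * c0 * r) * (B x \<bullet> x)}" by blast
  moreover have "closed {x. B (S r x) \<bullet> S r x \<le> exp (2 * c0 * r) * (B x \<bullet> x)}"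
    by (intro closed_Collect_le continuous_intros)
  ultimately have "closure D \<subseteq> {x. B (S r x) \<bullet> S r x \<le> exp (2 * c0 * r) * (B x \<bullet> x)}"
    by (rule closure_minimal)
  then show ?thesis using dd unfolding densely_defined_linear_def by auto
qed

text \<open>The derivative of the form is -2 <S(p)x, A*B (S(p)x - x)>, at most 2 |x| K (2 |x|),
  which is the constant 4 K |x|^2. Since A has been moved onto B, the bound involves |x| and not |A
  x|; this is why it survives the passage from D to all x.\<close>

lemma semigroup_weak_norm_increment:
  fixes D :: "'a::{real_inner, banach} set" and B :: "'a \<Rightarrow>\<^sub>L 'a"
  assumes dd: "densely_defined_linear D A" and S: "contraction_C0_semigroup S"
    and gen: "generated_by_minus S D A" and sa: "selfadjoint_op B"
    and dom: "\<And>x. B x \<in> adj_dom D A"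
    and K: "\<And>x. norm (adj_op D A (B x)) \<le> K * norm x" "0 \<le> K"
    and r: "0 \<le> r"
  shows "B (S r x - x) \<bullet> (S r x - x) \<le> 4 * K * (norm x)\<^sup>2 * r"
proof -
  have cont: "continuous_on {0..r} (\<lambda>r. B (S r x - x) \<bullet> (S r x - x) - 4 * K * (norm x)\<^sup>2 * r)" for x
    by (intro continuous_intros continuous_on_subset[OF semigroup_continuous[OF S]]) auto
  have "B (S r x - x) \<bullet> (S r x - x) \<le> 4 * K * (norm x)\<^sup>2 * r" if x: "x \<in> D" for x
  proof -
    define f where "f r = B (S r x - x) \<bullet> (S r x - x) - 4 * K * (norm x)\<^sup>2 * r" for r
    have der: "(f has_real_derivative (- 2 * (A (S p x) \<bullet> B (S p x - x)) - 4 * K * (norm x)\<^sup>2)) (at p)"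
      if p: "0 < p" for p
    proof -
      have d: "((\<lambda>r. S r x - x) has_vector_derivative - A (S p x)) (at p)"
        using has_vector_derivative_diff[OF semigroup_has_vector_derivative[OF S gen x p] has_vector_derivative_const[of x]]
        by simp
      have dB: "((\<lambda>r. B (S r x - x)) has_vector_derivative B (- A (S p x))) (at p)"
        by (rule bounded_linear.has_vector_derivative[OF blinfun.bounded_linear_right d])
      have "((\<lambda>r. B (S r x - x) \<bullet> (S r x - x)) has_vector_derivative
          (B (S p x - x) \<bullet> (- A (S p x)) + B (- A (S p x)) \<bullet> (S p x - x))) (at p)"
        by (rule bounded_bilinear.has_vector_derivative[OF bounded_bilinear_inner dB d])
      moreover have "B (S p x - x) \<bullet> (- A (S p x)) + B (- A (S p x)) \<bullet> (S p x - x) = - 2 * (A (S p x) \<bullet> B (S p x - x))"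
        using sa[unfolded selfadjoint_op_def, rule_format, of "A (S p x)"]
        by (simp add: blinfun.minus_right) (simp add: inner_commute)
      ultimately have "((\<lambda>r. B (S r x - x) \<bullet> (S r x - x)) has_real_derivative - 2 * (A (S p x) \<bullet> B (S p x - x))) (at p)"
        by (simp add: has_real_derivative_iff_has_vector_derivative)
      then show ?thesis unfolding f_def
        by (auto intro!: derivative_eq_intros)
    qed
    have "f r \<le> f 0"
    proof (rule DERIV_nonpos_imp_decreasing_open[OF r])
      fix p assume p: "0 < p" "p < r"
      have D: "S p x \<in> D" using semigroup_preserves_domain(1)[OF S gen x] p by simp
      have n: "norm (S p x) \<le> norm x" using semigroup_norm_le[OF S] p by simp
      have "- (A (S p x) \<bullet> B (S p x - x)) \<le> \<bar>S p x \<bullet> adj_op D A (B (S p x - x))\<bar>"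
        unfolding adj_op_eq[OF dd dom D] by simp
      also have "\<dots> \<le> norm (S p x) * norm (adj_op D A (B (S p x - x)))" by (rule Cauchy_Schwarz_ineq2)
      also have "\<dots> \<le> norm x * (K * (norm x + norm x))"
        by (intro mult_mono n order_trans[OF K(1)] K(2) order_trans[OF norm_triangle_ineq4] add_mono)
           (auto simp: K(2))
      also have "\<dots> = 2 * K * (norm x)\<^sup>2" by (simp add: power2_eq_square)
      finally have "- 2 * (A (S p x) \<bullet> B (S p x - x)) - 4 * K * (norm x)\<^sup>2 \<le> 0" by linarith
      then show "\<exists>y. (f has_real_derivative y) (at p) \<and> y \<le> 0" using der[OF p(1)] by blast
    qed (use cont[of x] in \<open>simp add: f_def[abs_def]\<close>)
    moreover have "S 0 x = x" using S unfolding contraction_C0_semigroup_def by simp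
    ultimately show ?thesis unfolding f_def by simp
  qed
  then have "D \<subseteq> {x. B (S r x - x) \<bullet> (S r x - x) \<le> 4 * K * (norm x)\<^sup>2 * r}" by blast
  moreover have "closed {x. B (S r x - x) \<bullet> (S r x - x) \<le> 4 * K * (norm x)\<^sup>2 * r}"
    by (intro closed_Collect_le continuous_intros)
  ultimately have "closure D \<subseteq> {x. B (S r x - x) \<bullet> (S r x - x) \<le> 4 * K * (norm x)\<^sup>2 * r}"
    by (rule closure_minimal)
  then show ?thesis using dd unfolding densely_defined_linear_def by auto
qed

section \<open>Moments of Poisson random measures\<close>

text \<open>The set function \<open>intensity\<close> as a genuine measure, so that integrals
  against it make sense; the density removes the times up to 0.\<close>

definition intensity_measure ::
  "'a::{real_normed_vector, second_countable_topology} measure \<Rightarrow> (real \<times> 'a) measure" where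
  "intensity_measure \<nu> = density (lborel \<Otimes>\<^sub>M \<nu>) (indicator ({0<..} \<times> UNIV))"

text \<open>Chebyshev: the second moment bounds the mass of the jumps larger than 1/(k+1), and the
  remaining point 0 is a null set. This gives access to Fubini with \<nu>.\<close>

lemma levy_measure2_sigma_finite:
  assumes "levy_measure2 \<nu>"
  shows "sigma_finite_measure \<nu>"
proof
  from assms have sets: "sets \<nu> = sets borel" and zero: "emeasure \<nu> {0} = 0"
    and fin: "(\<integral>\<^sup>+z. ennreal ((norm z)\<^sup>2) \<partial>\<nu>) < \<infinity>"
    unfolding levy_measure2_def by auto
  note [measurable_cong] = sets
  have sp: "space \<nu> = UNIV" using sets_eq_imp_space_eq[OF sets] by simp
  define A where "A k = {z::'a. 1 / real (Suc k) < norm z}" for k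
  have A: "A k \<in> sets \<nu>" for k unfolding A_def sets by measurable
  have "emeasure \<nu> (A k) < \<infinity>" for k
  proof -
    have "emeasure \<nu> (A k) = (\<integral>\<^sup>+z. indicator (A k) z \<partial>\<nu>)" using A by simp
    also have "\<dots> \<le> (\<integral>\<^sup>+z. ennreal ((real (Suc k))\<^sup>2) * ennreal ((norm z)\<^sup>2) \<partial>\<nu>)"
    proof (rule nn_integral_mono)
      fix z
      have "1 \<le> (real (Suc k))\<^sup>2 * (norm z)\<^sup>2" if "z \<in> A k"
        unfolding power_mult_distrib[symmetric]
        using that by (intro one_le_power) (simp add: A_def field_simps del: of_nat_Suc)
      then show "indicator (A k) z \<le> ennreal ((real (Suc k))\<^sup>2) * ennreal ((norm z)\<^sup>2)"
        by (auto simp: indicator_def ennreal_mult[symmetric] simp del: of_nat_Suc)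
    qed
    also have "\<dots> = ennreal ((real (Suc k))\<^sup>2) * (\<integral>\<^sup>+z. ennreal ((norm z)\<^sup>2) \<partial>\<nu>)"
      by (rule nn_integral_cmult) simp
    also have "\<dots> < \<infinity>" using fin by (simp add: ennreal_mult_less_top)
    finally show ?thesis .
  qed
  then have fA: "emeasure \<nu> a \<noteq> \<infinity>" if "a \<in> insert {0} (range A)" for a
    using that zero by (auto simp: less_top)
  have "\<Union> (insert {0} (range A)) = space \<nu>"
  proof -
    have "z \<in> {0} \<union> (\<Union>k. A k)" for z
      using reals_Archimedean[of "norm z"] by (auto simp: A_def inverse_eq_divide)
    then show ?thesis unfolding sp by auto
  qed
  then show "\<exists>\<A>. countable \<A> \<and> \<A> \<subseteq> sets \<nu> \<and> \<Union> \<A> = space \<nu> \<and> (\<forall>a\<in>\<A>. emeasure \<nu> a \<noteq> \<infinity>)"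
    by (intro exI[of _ "insert {0} (range A)"]) (use A fA sets in auto)
qed

lemma sets_intensity_measure:
  assumes "levy_measure2 \<nu>"
  shows "sets (intensity_measure \<nu>) = sets borel"
proof -
  have "sets \<nu> = sets borel" using assms unfolding levy_measure2_def by auto
  then have "sets ((lborel :: real measure) \<Otimes>\<^sub>M \<nu>) = sets (borel \<Otimes>\<^sub>M borel)" by (intro sets_pair_measure_cong) auto
  then show ?thesis unfolding intensity_measure_def borel_prod[symmetric] by simp
qed

lemma emeasure_intensity_measure:
  assumes "levy_measure2 \<nu>" "E \<in> sets borel"
  shows "emeasure (intensity_measure \<nu>) E = intensity \<nu> E"
proof -
  have s: "sets ((lborel :: real measure) \<Otimes>\<^sub>M \<nu>) = sets borel"
    using sets_intensity_measure[OF assms(1)] unfolding intensity_measure_def by simp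
  have m: "{0<..} \<times> UNIV \<in> sets ((lborel :: real measure) \<Otimes>\<^sub>M \<nu>)" unfolding s
    by (intro borel_open open_Times) auto
  then have ind: "indicator ({0<..} \<times> UNIV) \<in> borel_measurable ((lborel :: real measure) \<Otimes>\<^sub>M \<nu>)"
    by (rule borel_measurable_indicator)
  have "emeasure (intensity_measure \<nu>) E = (\<integral>\<^sup>+p. indicator (E \<inter> {0<..} \<times> UNIV) p \<partial>(lborel \<Otimes>\<^sub>M \<nu>))"
    unfolding intensity_measure_def using assms(2) s
    by (subst emeasure_density[OF ind]) (auto intro!: nn_integral_cong split: split_indicator)
  also have "\<dots> = intensity \<nu> E"
    unfolding intensity_def using assms(2) s m by (intro nn_integral_indicator sets.Int) simp_all
  finally show ?thesis .
qed

text \<open>The recursion (k+1) p(k+1) = r p(k) reduces each moment series to the preceding ones by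
  an index shift.\<close>

lemma poisson_series:
  fixes r :: real
  defines "p \<equiv> \<lambda>k::nat. r ^ k / fact k * exp (- r)"
  shows "p sums 1" "(\<lambda>k. real k * p k) sums r" "(\<lambda>k. real k * real k * p k) sums (r * r + r)"
proof -
  have "(\<lambda>k. r ^ k / fact k) sums exp r"
    using exp_converges[of r] by (simp add: divide_inverse mult.commute)
  then show p: "p sums 1" unfolding p_def
    using sums_mult2[of _ "exp r" "exp (-r)"] by (fastforce simp: exp_minus)
  have Suc: "real (Suc k) * p (Suc k) = r * p k" for k
    unfolding p_def fact_Suc power_Suc by (simp add: field_simps del: of_nat_Suc)
  have "(\<lambda>k. real (Suc k) * p (Suc k)) sums (r * 1)"
    unfolding Suc by (intro sums_mult p)
  from sums_Suc[OF this] show 1: "(\<lambda>k. real k * p k) sums r" by simp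
  have "real (Suc k) * real (Suc k) * p (Suc k) = r * (real k * p k + p k)" for k
    unfolding mult.assoc Suc by (simp add: algebra_simps)
  then have "(\<lambda>k. real (Suc k) * real (Suc k) * p (Suc k)) sums (r * (r + 1))"
    using sums_mult[OF sums_add[OF 1 p], of r] by simp
  from sums_Suc[OF this] show "(\<lambda>k. real k * real k * p k) sums (r * r + r)" by (simp add: algebra_simps)
qed

section \<open>Integer-valued counts and the first two moments of a Poisson random measure\<close>

context prob_space
begin

text \<open>The count is an extended real a priori, but its atoms at the naturals already carry
  total mass one.\<close>

lemma AE_range_of_nat:
  fixes N :: "'a \<Rightarrow> ennreal"
  assumes N[measurable]: "N \<in> borel_measurable M"
    and p: "\<And>k::nat. prob {\<omega>\<in>space M. N \<omega> = of_nat k} = p k" and "p sums 1"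
  shows "AE \<omega> in M. N \<omega> \<in> range of_nat"
proof -
  have "(\<lambda>k. prob {\<omega>\<in>space M. N \<omega> = of_nat k}) sums prob (\<Union>k. {\<omega>\<in>space M. N \<omega> = of_nat k})"
    by (rule finite_measure_UNION) (auto simp: disjoint_family_on_def)
  then have "prob (\<Union>k. {\<omega>\<in>space M. N \<omega> = of_nat k}) = 1"
    unfolding p using assms(3) by (rule sums_unique2)
  then have "AE \<omega> in M. \<omega> \<in> (\<Union>k. {\<omega>\<in>space M. N \<omega> = of_nat k})"
    by (rule AE_prob_1)
  then show ?thesis by eventually_elim auto
qed

lemma nn_integral_of_nat_valued:
  fixes N :: "'a \<Rightarrow> ennreal"
  assumes N[measurable]: "N \<in> borel_measurable M"
    and p: "\<And>k::nat. prob {\<omega>\<in>space M. N \<omega> = of_nat k} = p k" and p1: "p sums 1"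
  shows "(\<integral>\<^sup>+\<omega>. g (N \<omega>) \<partial>M) = (\<Sum>k. g (of_nat k) * ennreal (p k))"
proof -
  have "(\<integral>\<^sup>+\<omega>. g (N \<omega>) \<partial>M)
      = (\<integral>\<^sup>+\<omega>. (\<Sum>k. g (of_nat k) * indicator {\<omega>\<in>space M. N \<omega> = of_nat k} \<omega>) \<partial>M)"
  proof (rule nn_integral_cong_AE)
    show "AE \<omega> in M. g (N \<omega>) = (\<Sum>k. g (of_nat k) * indicator {\<omega>\<in>space M. N \<omega> = of_nat k} \<omega>)"
      using AE_range_of_nat[OF assms] AE_space
    proof eventually_elim
      case (elim \<omega>)
      then obtain j where j: "N \<omega> = of_nat j" by blast
      have "(\<Sum>k. g (of_nat k) * indicator {\<omega>\<in>space M. N \<omega> = of_nat k} \<omega>)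
          = (\<Sum>k\<in>{j}. g (of_nat k) * indicator {\<omega>\<in>space M. N \<omega> = of_nat k} \<omega>)"
        by (rule suminf_finite) (auto simp: j)
      then show ?case using j elim by simp
    qed
  qed
  also have "\<dots> = (\<Sum>k. \<integral>\<^sup>+\<omega>. g (of_nat k) * indicator {\<omega>\<in>space M. N \<omega> = of_nat k} \<omega> \<partial>M)"
    by (rule nn_integral_suminf) measurable
  also have "\<dots> = (\<Sum>k. g (of_nat k) * ennreal (p k))"
    by (subst nn_integral_cmult_indicator) (auto simp: emeasure_eq_measure p)
  finally show ?thesis .
qed

end

locale poisson_rm = prob_space P for P :: "'w measure" +
  fixes \<nu> :: "'a::{real_inner, banach, second_countable_topology} measure"
    and \<pi> :: "'w \<Rightarrow> (real \<times> 'a) measure"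
  assumes levy: "levy_measure2 \<nu>" and prm: "poisson_random_measure P \<nu> \<pi>"
begin

abbreviation "\<Lambda> \<equiv> intensity_measure \<nu>"

lemma sets_\<pi>: "\<omega> \<in> space P \<Longrightarrow> sets (\<pi> \<omega>) = sets borel"
  using prm unfolding poisson_random_measure_def by auto

lemma sets_\<Lambda> [measurable_cong]: "sets \<Lambda> = sets borel"
  by (rule sets_intensity_measure[OF levy])

lemma measurable_emeasure_\<pi>: "E \<in> sets borel \<Longrightarrow> (\<lambda>\<omega>. emeasure (\<pi> \<omega>) E) \<in> borel_measurable P"
  using prm unfolding poisson_random_measure_def by auto

lemma prob_count:
  assumes "E \<in> sets borel" "emeasure \<Lambda> E < \<infinity>"
  shows "prob {\<omega>\<in>space P. emeasure (\<pi> \<omega>) E = of_nat k}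
      = measure \<Lambda> E ^ k / fact k * exp (- measure \<Lambda> E)"
  using prm assms unfolding poisson_random_measure_def measure_def emeasure_intensity_measure[OF levy assms(1)]
  by simp

text \<open>Sets of infinite intensity are included, so that both sides are measures in
  \<open>E\<close> and the identity can be extended from sets to functions.\<close>

lemma nn_mean:
  assumes E: "E \<in> sets borel"
  shows "(\<integral>\<^sup>+\<omega>. emeasure (\<pi> \<omega>) E \<partial>P) = emeasure \<Lambda> E"
proof (cases "emeasure \<Lambda> E < \<infinity>")
  case True
  have "(\<integral>\<^sup>+\<omega>. emeasure (\<pi> \<omega>) E \<partial>P)
      = (\<Sum>k. ennreal (real k * (measure \<Lambda> E ^ k / fact k * exp (- measure \<Lambda> E))))"
    using nn_integral_of_nat_valued[OF measurable_emeasure_\<pi>[OF E] prob_count[OF E True] poisson_series(1), of "\<lambda>x. x"]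
    by (simp add: ennreal_mult[symmetric] ennreal_of_nat_eq_real_of_nat)
  also have "\<dots> = ennreal (measure \<Lambda> E)"
    by (rule suminf_ennreal_eq[OF _ poisson_series(2)]) simp
  also have "\<dots> = emeasure \<Lambda> E" using True by (simp add: emeasure_eq_ennreal_measure)
  finally show ?thesis .
next
  case False
  then have inf: "emeasure \<Lambda> E = \<infinity>" by (simp add: not_less top_unique)
  then have "AE \<omega> in P. emeasure (\<pi> \<omega>) E = \<infinity>"
    using prm E unfolding poisson_random_measure_def emeasure_intensity_measure[OF levy E] by auto
  then have "(\<integral>\<^sup>+\<omega>. emeasure (\<pi> \<omega>) E \<partial>P) = (\<integral>\<^sup>+\<omega>. \<infinity> \<partial>P)" by (rule nn_integral_cong_AE)
  then show ?thesis using inf by (simp add: emeasure_space_1)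
qed

lemma nn_second_moment:
  assumes E: "E \<in> sets borel" "emeasure \<Lambda> E < \<infinity>"
  shows "(\<integral>\<^sup>+\<omega>. emeasure (\<pi> \<omega>) E * emeasure (\<pi> \<omega>) E \<partial>P) = emeasure \<Lambda> E * emeasure \<Lambda> E + emeasure \<Lambda> E"
proof -
  have "(\<integral>\<^sup>+\<omega>. emeasure (\<pi> \<omega>) E * emeasure (\<pi> \<omega>) E \<partial>P)
      = (\<Sum>k. ennreal (real k * real k * (measure \<Lambda> E ^ k / fact k * exp (- measure \<Lambda> E))))"
    using nn_integral_of_nat_valued[OF measurable_emeasure_\<pi>[OF E(1)] prob_count[OF E] poisson_series(1), of "\<lambda>x. x * x"]
    by (simp add: ennreal_mult[symmetric] ennreal_of_nat_eq_real_of_nat)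
  also have "\<dots> = ennreal (measure \<Lambda> E * measure \<Lambda> E + measure \<Lambda> E)"
    by (rule suminf_ennreal_eq[OF _ poisson_series(3)]) simp
  also have "\<dots> = emeasure \<Lambda> E * emeasure \<Lambda> E + emeasure \<Lambda> E" using E(2)
    by (simp add: emeasure_eq_ennreal_measure ennreal_mult)
  finally show ?thesis .
qed

lemma nn_product_disjoint:
  assumes E: "E \<in> sets borel" "E' \<in> sets borel" "E \<inter> E' = {}"
  shows "(\<integral>\<^sup>+\<omega>. emeasure (\<pi> \<omega>) E * emeasure (\<pi> \<omega>) E' \<partial>P) = emeasure \<Lambda> E * emeasure \<Lambda> E'"
proof -
  \<comment> \<open>The independence clause speaks of infinite disjoint families, so the two sets
    are continued by empty ones.\<close>
  define F where "F i = (if i = 0 then E else if i = Suc 0 then E' else {})" for i :: nat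
  have "range F \<subseteq> sets borel \<and> disjoint_family F"
    using E unfolding F_def by (auto simp: disjoint_family_on_def)
  then have "indep_vars (\<lambda>_. borel) (\<lambda>i \<omega>. emeasure (\<pi> \<omega>) (F i)) UNIV"
    using prm unfolding poisson_random_measure_def by blast
  then have "indep_vars (\<lambda>_. borel) (\<lambda>i \<omega>. emeasure (\<pi> \<omega>) (F i)) {0, Suc 0}"
    by (rule indep_vars_subset) simp
  from indep_vars_nn_integral[OF _ this] show ?thesis
    by (simp add: F_def nn_mean E)
qed

text \<open>Cutting both sets along their intersection leaves products of independent counts, except
  for the square of the count of the intersection, whose variance is the extra term.\<close>

lemma nn_product:
  assumes E: "E \<in> sets borel" "emeasure \<Lambda> E < \<infinity>" and E': "E' \<in> sets borel" "emeasure \<Lambda> E' < \<infinity>"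
  shows "(\<integral>\<^sup>+\<omega>. emeasure (\<pi> \<omega>) E * emeasure (\<pi> \<omega>) E' \<partial>P)
      = emeasure \<Lambda> E * emeasure \<Lambda> E' + emeasure \<Lambda> (E \<inter> E')"
proof -
  note [measurable] = E(1) E'(1) measurable_emeasure_\<pi>
  let ?a = "E - E'" and ?b = "E \<inter> E'" and ?c = "E' - E"
  have s: "?a \<in> sets borel" "?b \<in> sets borel" "?c \<in> sets borel" by auto
  have fb: "emeasure \<Lambda> ?b < \<infinity>"
    using E emeasure_mono[of ?b E \<Lambda>] by (auto simp: sets_\<Lambda> less_top top.extremum_unique)
  have eq: "emeasure N E = emeasure N ?a + emeasure N ?b" "emeasure N E' = emeasure N ?b + emeasure N ?c"
    if "sets N = sets borel" for N :: "(real \<times> 'a) measure"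
  proof -
    have "emeasure N ?a + emeasure N ?b = emeasure N (?a \<union> ?b)"
      by (rule plus_emeasure) (use s that in auto)
    also have "?a \<union> ?b = E" by auto
    finally show "emeasure N E = emeasure N ?a + emeasure N ?b" by simp
    have "emeasure N ?b + emeasure N ?c = emeasure N (?b \<union> ?c)"
      by (rule plus_emeasure) (use s that in auto)
    also have "?b \<union> ?c = E'" by auto
    finally show "emeasure N E' = emeasure N ?b + emeasure N ?c" by simp
  qed
  have "(\<integral>\<^sup>+\<omega>. emeasure (\<pi> \<omega>) E * emeasure (\<pi> \<omega>) E' \<partial>P)
    = (\<integral>\<^sup>+\<omega>. emeasure (\<pi> \<omega>) ?a * emeasure (\<pi> \<omega>) ?b + emeasure (\<pi> \<omega>) ?a * emeasure (\<pi> \<omega>) ?c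
       + (emeasure (\<pi> \<omega>) ?b * emeasure (\<pi> \<omega>) ?b + emeasure (\<pi> \<omega>) ?b * emeasure (\<pi> \<omega>) ?c) \<partial>P)"
    by (rule nn_integral_cong) (simp add: eq[OF sets_\<pi>] algebra_simps)
  also have "\<dots> = emeasure \<Lambda> ?a * emeasure \<Lambda> ?b + emeasure \<Lambda> ?a * emeasure \<Lambda> ?c
       + (emeasure \<Lambda> ?b * emeasure \<Lambda> ?b + emeasure \<Lambda> ?b + emeasure \<Lambda> ?b * emeasure \<Lambda> ?c)"
  proof -
    have d: "?a \<inter> ?b = {}" "?a \<inter> ?c = {}" "?b \<inter> ?c = {}" by auto
    show ?thesis
      by (simp add: nn_integral_add nn_second_moment[OF s(2) fb] nn_product_disjoint[OF s(1,2) d(1)]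
          nn_product_disjoint[OF s(1,3) d(2)] nn_product_disjoint[OF s(2,3) d(3)])
  qed
  also have "\<dots> = emeasure \<Lambda> E * emeasure \<Lambda> E' + emeasure \<Lambda> ?b"
    by (simp add: eq[OF sets_\<Lambda>] algebra_simps)
  finally show ?thesis .
qed

end

text \<open>The weight \<open>W\<close> allows a product of two random integrals to be treated one
  factor at a time: the extension from sets to functions is made first with a count as
  \<open>W\<close>, then with the integral just obtained as \<open>W\<close>.\<close>

lemma kernel_nn_integral:
  assumes sets: "\<And>\<omega>. \<omega> \<in> space P \<Longrightarrow> sets (\<kappa> \<omega>) = sets M"
    and meas: "\<And>E. E \<in> sets M \<Longrightarrow> (\<lambda>\<omega>. emeasure (\<kappa> \<omega>) E) \<in> borel_measurable P"
    and W [measurable]: "W \<in> borel_measurable P" and N: "sets N = sets M"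
    and eq: "\<And>E. E \<in> sets M \<Longrightarrow> (\<integral>\<^sup>+\<omega>. emeasure (\<kappa> \<omega>) E * W \<omega> \<partial>P) = emeasure N E"
    and g: "g \<in> borel_measurable M"
  shows "(\<lambda>\<omega>. \<integral>\<^sup>+p. g p \<partial>\<kappa> \<omega>) \<in> borel_measurable P
    \<and> (\<integral>\<^sup>+\<omega>. (\<integral>\<^sup>+p. g p \<partial>\<kappa> \<omega>) * W \<omega> \<partial>P) = (\<integral>\<^sup>+p. g p \<partial>N)"
  using g
proof (induction g rule: borel_measurable_induct)
  case (cong f g)
  have "(\<integral>\<^sup>+p. f p \<partial>\<kappa> \<omega>) = (\<integral>\<^sup>+p. g p \<partial>\<kappa> \<omega>)" if "\<omega> \<in> space P" for \<omega>
    using cong sets_eq_imp_space_eq[OF sets[OF that]] by (intro nn_integral_cong) auto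
  moreover have "(\<integral>\<^sup>+p. f p \<partial>N) = (\<integral>\<^sup>+p. g p \<partial>N)"
    using cong sets_eq_imp_space_eq[OF N] by (intro nn_integral_cong) auto
  ultimately show ?case using cong by (simp cong: measurable_cong nn_integral_cong)
next
  case (set A)
  have "(\<integral>\<^sup>+p. indicator A p \<partial>\<kappa> \<omega>) = emeasure (\<kappa> \<omega>) A" if "\<omega> \<in> space P" for \<omega>
    using set sets[OF that] by simp
  moreover have "(\<integral>\<^sup>+p. indicator A p \<partial>N) = emeasure N A" using set N by simp
  ultimately show ?case using set
    by (simp add: meas eq cong: measurable_cong nn_integral_cong)
next
  case (mult u c)
  have 1: "(\<integral>\<^sup>+p. c * u p \<partial>\<kappa> \<omega>) = c * (\<integral>\<^sup>+p. u p \<partial>\<kappa> \<omega>)" if "\<omega> \<in> space P" for \<omega>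
    using mult sets[OF that] by (intro nn_integral_cmult) (simp cong: measurable_cong_sets)
  have 2: "(\<integral>\<^sup>+p. c * u p \<partial>N) = c * (\<integral>\<^sup>+p. u p \<partial>N)"
    using mult N by (intro nn_integral_cmult) (simp cong: measurable_cong_sets)
  have [measurable]: "(\<lambda>\<omega>. integral\<^sup>N (\<kappa> \<omega>) u) \<in> borel_measurable P" using mult by simp
  have "(\<lambda>\<omega>. c * integral\<^sup>N (\<kappa> \<omega>) u) \<in> borel_measurable P" by measurable
  then show ?case using mult
    by (simp add: 1 2 mult.assoc nn_integral_cmult cong: measurable_cong nn_integral_cong)
next
  case (add u v)
  have 1: "(\<integral>\<^sup>+p. v p + u p \<partial>\<kappa> \<omega>) = (\<integral>\<^sup>+p. v p \<partial>\<kappa> \<omega>) + (\<integral>\<^sup>+p. u p \<partial>\<kappa> \<omega>)" if "\<omega> \<in> space P" for \<omega>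
    using add sets[OF that] by (intro nn_integral_add) (simp_all cong: measurable_cong_sets)
  have 2: "(\<integral>\<^sup>+p. v p + u p \<partial>N) = (\<integral>\<^sup>+p. v p \<partial>N) + (\<integral>\<^sup>+p. u p \<partial>N)"
    using add N by (intro nn_integral_add) (simp_all cong: measurable_cong_sets)
  have [measurable]: "(\<lambda>\<omega>. integral\<^sup>N (\<kappa> \<omega>) u) \<in> borel_measurable P"
    "(\<lambda>\<omega>. integral\<^sup>N (\<kappa> \<omega>) v) \<in> borel_measurable P" using add by simp_all
  have "(\<lambda>\<omega>. integral\<^sup>N (\<kappa> \<omega>) v + integral\<^sup>N (\<kappa> \<omega>) u) \<in> borel_measurable P" by measurable
  then show ?case using add
    by (simp add: 1 2 distrib_right nn_integral_add cong: measurable_cong nn_integral_cong)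
next
  case (seq U)
  have e: "(SUP i. U i) = (\<lambda>p. SUP i. U i p)" by (auto simp: fun_eq_iff image_comp)
  have 1: "(\<integral>\<^sup>+p. (SUP i. U i p) \<partial>\<kappa> \<omega>) = (SUP i. \<integral>\<^sup>+p. U i p \<partial>\<kappa> \<omega>)" if "\<omega> \<in> space P" for \<omega>
    using seq sets[OF that] by (intro nn_integral_monotone_convergence_SUP) (simp_all cong: measurable_cong_sets)
  have 2: "(\<integral>\<^sup>+p. (SUP i. U i p) \<partial>N) = (SUP i. \<integral>\<^sup>+p. U i p \<partial>N)"
    using seq N by (intro nn_integral_monotone_convergence_SUP) (simp_all cong: measurable_cong_sets)
  have [measurable]: "(\<lambda>\<omega>. integral\<^sup>N (\<kappa> \<omega>) (U i)) \<in> borel_measurable P" for i using seq by simp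
  have 3: "(\<integral>\<^sup>+\<omega>. (SUP i. (\<integral>\<^sup>+p. U i p \<partial>\<kappa> \<omega>) * W \<omega>) \<partial>P) = (SUP i. \<integral>\<^sup>+\<omega>. (\<integral>\<^sup>+p. U i p \<partial>\<kappa> \<omega>) * W \<omega> \<partial>P)"
    using seq by (intro nn_integral_monotone_convergence_SUP)
      (auto simp: incseq_def le_fun_def intro!: nn_integral_mono mult_right_mono)
  have "(\<lambda>\<omega>. SUP i. \<integral>\<^sup>+p. U i p \<partial>\<kappa> \<omega>) \<in> borel_measurable P" by measurable
  then show ?case unfolding e using seq
    by (simp add: 1 2 3 SUP_mult_right_ennreal cong: measurable_cong nn_integral_cong)
qed

context poisson_rm
begin

lemma nn_campbell:
  assumes "g \<in> borel_measurable borel"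
  shows "(\<lambda>\<omega>. \<integral>\<^sup>+p. g p \<partial>\<pi> \<omega>) \<in> borel_measurable P"
    and "(\<integral>\<^sup>+\<omega>. (\<integral>\<^sup>+p. g p \<partial>\<pi> \<omega>) \<partial>P) = (\<integral>\<^sup>+p. g p \<partial>\<Lambda>)"
  using kernel_nn_integral[where \<kappa>=\<pi> and W="\<lambda>_. 1" and P=P and N=\<Lambda>, OF sets_\<pi> measurable_emeasure_\<pi> _ sets_\<Lambda> _ assms]
  by (auto simp: nn_mean)

text \<open>The product formula for counts asks for finite intensity, which is secured by
  restricting both measures to \<open>E0\<close>, a set that carries g and h. The last summand is
  the diagonal contribution of a point paired with itself.\<close>

lemma nn_campbell2:
  assumes E0 [measurable]: "E0 \<in> sets borel" and fin: "emeasure \<Lambda> E0 < \<infinity>"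
    and g [measurable]: "g \<in> borel_measurable borel" and h [measurable]: "h \<in> borel_measurable borel"
    and supp: "\<And>p. p \<notin> E0 \<Longrightarrow> g p = 0" "\<And>p. p \<notin> E0 \<Longrightarrow> h p = 0"
  shows "(\<integral>\<^sup>+\<omega>. (\<integral>\<^sup>+p. h p \<partial>\<pi> \<omega>) * (\<integral>\<^sup>+p. g p \<partial>\<pi> \<omega>) \<partial>P)
      = (\<integral>\<^sup>+p. h p \<partial>\<Lambda>) * (\<integral>\<^sup>+p. g p \<partial>\<Lambda>) + (\<integral>\<^sup>+p. h p * g p \<partial>\<Lambda>)"
proof -
  define \<kappa> where "\<kappa> \<omega> = density (\<pi> \<omega>) (indicator E0)" for \<omega>
  define \<Lambda>0 where "\<Lambda>0 = density \<Lambda> (indicator E0)"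
  have sk: "sets (\<kappa> \<omega>) = sets borel" if "\<omega> \<in> space P" for \<omega>
    unfolding \<kappa>_def using sets_\<pi>[OF that] by simp
  have s0 [measurable_cong]: "sets \<Lambda>0 = sets borel" unfolding \<Lambda>0_def by (simp add: sets_\<Lambda>)
  have ek: "emeasure (\<kappa> \<omega>) E = emeasure (\<pi> \<omega>) (E0 \<inter> E)" if "\<omega> \<in> space P" "E \<in> sets borel" for \<omega> E
    unfolding \<kappa>_def using sets_\<pi>[OF that(1)] that(2) E0
    by (subst emeasure_density) (auto simp: indicator_inter_arith[symmetric])
  have e0: "emeasure \<Lambda>0 E = emeasure \<Lambda> (E0 \<inter> E)" if "E \<in> sets borel" for E
    unfolding \<Lambda>0_def using that E0 sets_\<Lambda>
    by (subst emeasure_density) (auto simp: indicator_inter_arith[symmetric])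
  have mk: "(\<lambda>\<omega>. emeasure (\<kappa> \<omega>) E) \<in> borel_measurable P" if "E \<in> sets borel" for E
    using measurable_emeasure_\<pi>[of "E0 \<inter> E"] that by (simp add: ek cong: measurable_cong)
  have ik: "(\<integral>\<^sup>+p. f p \<partial>\<kappa> \<omega>) = (\<integral>\<^sup>+p. f p \<partial>\<pi> \<omega>)"
    if "\<omega> \<in> space P" "f \<in> borel_measurable borel" "\<And>p. p \<notin> E0 \<Longrightarrow> f p = 0" for \<omega> f
    unfolding \<kappa>_def using that E0 sets_\<pi>[OF that(1)]
    by (subst nn_integral_density)
       (auto simp: indicator_def cong: measurable_cong_sets intro!: nn_integral_cong)
  have i0: "(\<integral>\<^sup>+p. f p \<partial>\<Lambda>0) = (\<integral>\<^sup>+p. f p \<partial>\<Lambda>)"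
    if "f \<in> borel_measurable borel" "\<And>p. p \<notin> E0 \<Longrightarrow> f p = 0" for f
    unfolding \<Lambda>0_def using that E0 sets_\<Lambda>
    by (subst nn_integral_density)
       (auto simp: indicator_def cong: measurable_cong_sets intro!: nn_integral_cong)
  have fin': "emeasure \<Lambda> (E0 \<inter> E) < \<infinity>" for E
    using fin emeasure_mono[of "E0 \<inter> E" E0 \<Lambda>] E0 by (auto simp: sets_\<Lambda> less_top top_unique)
  \<comment> \<open>For fixed \<open>E'\<close> the right side of the product formula is a measure
    in \<open>E\<close>: its density with respect to \<open>\<Lambda>0\<close> is the mass of
    \<open>E'\<close> plus the indicator of \<open>E'\<close>. In this form the extension to
    functions applies.\<close>
  have prod: "(\<integral>\<^sup>+\<omega>. emeasure (\<kappa> \<omega>) E * emeasure (\<kappa> \<omega>) E' \<partial>P)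
      = emeasure (density \<Lambda>0 (\<lambda>p. emeasure \<Lambda>0 E' + indicator E' p)) E"
    if E [measurable]: "E \<in> sets borel" and E' [measurable]: "E' \<in> sets borel" for E E'
  proof -
    have "emeasure (density \<Lambda>0 (\<lambda>p. emeasure \<Lambda>0 E' + indicator E' p)) E
        = (\<integral>\<^sup>+p. emeasure \<Lambda>0 E' * indicator E p + indicator (E \<inter> E') p \<partial>\<Lambda>0)"
      using E E' s0 by (subst emeasure_density) (auto intro!: nn_integral_cong split: split_indicator)
    also have "\<dots> = emeasure \<Lambda>0 E' * emeasure \<Lambda>0 E + emeasure \<Lambda>0 (E \<inter> E')"
      by (simp add: nn_integral_add nn_integral_cmult s0)
    also have "\<dots> = (\<integral>\<^sup>+\<omega>. emeasure (\<pi> \<omega>) (E0 \<inter> E) * emeasure (\<pi> \<omega>) (E0 \<inter> E') \<partial>P)"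
    proof -
      have i: "E0 \<inter> E \<inter> (E0 \<inter> E') = E0 \<inter> (E \<inter> E')" by auto
      show ?thesis
        by (subst nn_product[OF _ fin' _ fin']) (auto simp: e0 i mult.commute)
    qed
    finally show ?thesis by (simp add: ek cong: nn_integral_cong)
  qed
  have k1: "(\<lambda>\<omega>. \<integral>\<^sup>+p. g p \<partial>\<kappa> \<omega>) \<in> borel_measurable P \<and>
    (\<integral>\<^sup>+\<omega>. (\<integral>\<^sup>+p. g p \<partial>\<kappa> \<omega>) * emeasure (\<kappa> \<omega>) E \<partial>P)
      = (\<integral>\<^sup>+p. g p \<partial>density \<Lambda>0 (\<lambda>p. emeasure \<Lambda>0 E + indicator E p))" if "E \<in> sets borel" for E
    by (rule kernel_nn_integral[OF sk mk mk _ prod g]) (auto simp: that s0)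
  have "(\<integral>\<^sup>+\<omega>. (\<integral>\<^sup>+p. h p \<partial>\<kappa> \<omega>) * (\<integral>\<^sup>+p. g p \<partial>\<kappa> \<omega>) \<partial>P)
      = (\<integral>\<^sup>+p. h p \<partial>density \<Lambda>0 (\<lambda>p. (\<integral>\<^sup>+p. g p \<partial>\<Lambda>0) + g p))"
  proof (rule kernel_nn_integral[OF sk mk _ _ _ h, THEN conjunct2])
    show "(\<lambda>\<omega>. \<integral>\<^sup>+p. g p \<partial>\<kappa> \<omega>) \<in> borel_measurable P" using k1[of "{}"] by simp
    fix E :: "(real \<times> 'a) set" assume E [measurable]: "E \<in> sets borel"
    have "(\<integral>\<^sup>+\<omega>. emeasure (\<kappa> \<omega>) E * (\<integral>\<^sup>+p. g p \<partial>\<kappa> \<omega>) \<partial>P)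
        = (\<integral>\<^sup>+p. emeasure \<Lambda>0 E * g p + g p * indicator E p \<partial>\<Lambda>0)"
    proof -
      have "(\<integral>\<^sup>+\<omega>. emeasure (\<kappa> \<omega>) E * (\<integral>\<^sup>+p. g p \<partial>\<kappa> \<omega>) \<partial>P)
          = (\<integral>\<^sup>+\<omega>. (\<integral>\<^sup>+p. g p \<partial>\<kappa> \<omega>) * emeasure (\<kappa> \<omega>) E \<partial>P)" by (simp add: mult.commute)
      also have "\<dots> = (\<integral>\<^sup>+p. g p \<partial>density \<Lambda>0 (\<lambda>p. emeasure \<Lambda>0 E + indicator E p))"
        using k1[OF E] by simp
      finally show ?thesis by (simp add: nn_integral_density distrib_left mult.commute)
    qed
    also have "\<dots> = (\<integral>\<^sup>+p. g p \<partial>\<Lambda>0) * emeasure \<Lambda>0 E + (\<integral>\<^sup>+p. g p * indicator E p \<partial>\<Lambda>0)"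
      by (simp add: nn_integral_add nn_integral_cmult nn_integral_multc mult.commute)
    also have "\<dots> = (\<integral>\<^sup>+p. (\<integral>\<^sup>+p. g p \<partial>\<Lambda>0) * indicator E p + g p * indicator E p \<partial>\<Lambda>0)"
      by (simp add: nn_integral_add nn_integral_cmult s0)
    also have "\<dots> = emeasure (density \<Lambda>0 (\<lambda>p. (\<integral>\<^sup>+p. g p \<partial>\<Lambda>0) + g p)) E"
      by (subst emeasure_density) (auto simp: s0 distrib_right)
    finally show "(\<integral>\<^sup>+\<omega>. emeasure (\<kappa> \<omega>) E * (\<integral>\<^sup>+p. g p \<partial>\<kappa> \<omega>) \<partial>P) = \<dots>" .
  qed (auto simp: s0)
  also have "\<dots> = (\<integral>\<^sup>+p. (\<integral>\<^sup>+p. g p \<partial>\<Lambda>0) * h p + h p * g p \<partial>\<Lambda>0)"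
    by (subst nn_integral_density) (auto simp: distrib_left mult.commute)
  also have "\<dots> = (\<integral>\<^sup>+p. h p \<partial>\<Lambda>0) * (\<integral>\<^sup>+p. g p \<partial>\<Lambda>0) + (\<integral>\<^sup>+p. h p * g p \<partial>\<Lambda>0)"
    by (simp add: nn_integral_add nn_integral_cmult nn_integral_multc mult.commute)
  finally show ?thesis using supp by (simp add: ik i0 cong: nn_integral_cong)
qed

end

text \<open>In this form the integral is a linear combination of masses of level sets. Against a
  random measure these are counts, whose moments are known.\<close>

lemma integral_simple_function:
  fixes s :: "'b \<Rightarrow> 'c::{banach, second_countable_topology}"
  assumes s: "simple_function N s" and fin: "\<And>y. y \<noteq> 0 \<Longrightarrow> emeasure N (s -` {y} \<inter> space N) < \<infinity>"
  shows "integrable N s"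
    and "integral\<^sup>L N s = (\<Sum>y\<in>s ` space N - {0}. measure N (s -` {y} \<inter> space N) *\<^sub>R y)"
proof -
  let ?A = "\<lambda>y. s -` {y} \<inter> space N"
  have finY: "finite (s ` space N - {0})" using s by (auto simp: simple_function_def)
  have A: "?A y \<in> sets N" for y
  proof (cases "y \<in> s ` space N")
    case True then show ?thesis using s by (auto simp: simple_function_def)
  next
    case False then have "?A y = {}" by auto
    then show ?thesis by simp
  qed
  have eq: "s p = (\<Sum>y\<in>s ` space N - {0}. indicator (?A y) p *\<^sub>R y)" if "p \<in> space N" for p
  proof -
    have "(\<Sum>y\<in>s ` space N - {0}. indicator (?A y) p *\<^sub>R y) = (\<Sum>y\<in>s ` space N - {0}. if y = s p then y else 0)"
      using that by (intro sum.cong) (auto simp: indicator_def)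
    also have "\<dots> = s p" using that finY by simp
    finally show ?thesis by simp
  qed
  have int: "integrable N (\<lambda>p. indicator (?A y) p *\<^sub>R y)" if "y \<in> s ` space N - {0}" for y
    using that fin A by (intro integrable_scaleR_left integrable_real_indicator) auto
  have "integrable N (\<lambda>p. \<Sum>y\<in>s ` space N - {0}. indicator (?A y) p *\<^sub>R y)"
    by (rule Bochner_Integration.integrable_sum[OF int])
  then show "integrable N s" by (subst Bochner_Integration.integrable_cong[OF refl eq])
  have "integral\<^sup>L N s = (\<integral>p. (\<Sum>y\<in>s ` space N - {0}. indicator (?A y) p *\<^sub>R y) \<partial>N)"
    by (rule Bochner_Integration.integral_cong[OF refl eq])
  also have "\<dots> = (\<Sum>y\<in>s ` space N - {0}. \<integral>p. indicator (?A y) p *\<^sub>R y \<partial>N)"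
    by (rule Bochner_Integration.integral_sum[OF int])
  also have "\<dots> = (\<Sum>y\<in>s ` space N - {0}. measure N (?A y) *\<^sub>R y)"
    using fin A by (intro sum.cong refl) (subst integral_scaleR_left, auto)
  finally show "integral\<^sup>L N s = (\<Sum>y\<in>s ` space N - {0}. measure N (?A y) *\<^sub>R y)" .
qed

context poisson_rm
begin

lemma AE_nn_integral_finite:
  assumes "g \<in> borel_measurable borel" "(\<integral>\<^sup>+p. g p \<partial>\<Lambda>) < \<infinity>"
  shows "AE \<omega> in P. (\<integral>\<^sup>+p. g p \<partial>\<pi> \<omega>) < \<infinity>"
proof -
  have "AE \<omega> in P. (\<integral>\<^sup>+p. g p \<partial>\<pi> \<omega>) \<noteq> \<infinity>"
    using nn_campbell[OF assms(1)] assms(2) by (intro nn_integral_noteq_infinite) auto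
  then show ?thesis by (simp add: less_top)
qed

text \<open>Counts are finite almost surely, so the moments of the extended-valued counts pass to
  \<open>measure\<close>, the form in which they occur as coefficients of Bochner integrals.\<close>

lemma measure_count_moments:
  assumes A: "A \<in> sets borel" "emeasure \<Lambda> A < \<infinity>" and A': "A' \<in> sets borel" "emeasure \<Lambda> A' < \<infinity>"
  shows "integrable P (\<lambda>\<omega>. measure (\<pi> \<omega>) A)" "(\<integral>\<omega>. measure (\<pi> \<omega>) A \<partial>P) = measure \<Lambda> A"
    and "integrable P (\<lambda>\<omega>. measure (\<pi> \<omega>) A * measure (\<pi> \<omega>) A')"
    and "(\<integral>\<omega>. measure (\<pi> \<omega>) A * measure (\<pi> \<omega>) A' \<partial>P) = measure \<Lambda> A * measure \<Lambda> A' + measure \<Lambda> (A \<inter> A')"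
proof -
  note [measurable] = measurable_emeasure_\<pi>[OF A(1)] measurable_emeasure_\<pi>[OF A'(1)]
  have m [measurable]: "(\<lambda>\<omega>. measure (\<pi> \<omega>) A) \<in> borel_measurable P" "(\<lambda>\<omega>. measure (\<pi> \<omega>) A') \<in> borel_measurable P"
    unfolding measure_def by measurable
  have fin: "AE \<omega> in P. emeasure (\<pi> \<omega>) E \<noteq> \<infinity>" if "E \<in> sets borel" "emeasure \<Lambda> E < \<infinity>" for E
    using nn_mean[OF that(1)] that by (intro nn_integral_noteq_infinite measurable_emeasure_\<pi>) auto
  have fb: "emeasure \<Lambda> (A \<inter> A') < \<infinity>"
    using A emeasure_mono[of "A \<inter> A'" A \<Lambda>] by (auto simp: sets_\<Lambda> less_top top_unique)
  have "(\<integral>\<^sup>+\<omega>. ennreal (measure (\<pi> \<omega>) A) \<partial>P) = (\<integral>\<^sup>+\<omega>. emeasure (\<pi> \<omega>) A \<partial>P)"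
    using fin[OF A] by (intro nn_integral_cong_AE) (auto simp: emeasure_eq_ennreal_measure)
  also have "\<dots> = ennreal (measure \<Lambda> A)" unfolding nn_mean[OF A(1)]
    using A by (simp add: emeasure_eq_ennreal_measure)
  finally have 1: "(\<integral>\<^sup>+\<omega>. ennreal (measure (\<pi> \<omega>) A) \<partial>P) = ennreal (measure \<Lambda> A)" .
  then show "integrable P (\<lambda>\<omega>. measure (\<pi> \<omega>) A)" by (intro integrableI_nonneg) auto
  show "(\<integral>\<omega>. measure (\<pi> \<omega>) A \<partial>P) = measure \<Lambda> A"
    using 1 by (subst integral_eq_nn_integral) auto
  have "(\<integral>\<^sup>+\<omega>. ennreal (measure (\<pi> \<omega>) A * measure (\<pi> \<omega>) A') \<partial>P)
      = (\<integral>\<^sup>+\<omega>. emeasure (\<pi> \<omega>) A * emeasure (\<pi> \<omega>) A' \<partial>P)"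
    using fin[OF A] fin[OF A'] by (intro nn_integral_cong_AE) (auto simp: emeasure_eq_ennreal_measure ennreal_mult)
  also have "\<dots> = ennreal (measure \<Lambda> A * measure \<Lambda> A' + measure \<Lambda> (A \<inter> A'))"
    unfolding nn_product[OF A A'] using A A' fb by (simp add: emeasure_eq_ennreal_measure ennreal_mult)
  finally have 2: "(\<integral>\<^sup>+\<omega>. ennreal (measure (\<pi> \<omega>) A * measure (\<pi> \<omega>) A') \<partial>P)
      = ennreal (measure \<Lambda> A * measure \<Lambda> A' + measure \<Lambda> (A \<inter> A'))" .
  then show "integrable P (\<lambda>\<omega>. measure (\<pi> \<omega>) A * measure (\<pi> \<omega>) A')"
    by (intro integrableI_nonneg) auto
  show "(\<integral>\<omega>. measure (\<pi> \<omega>) A * measure (\<pi> \<omega>) A' \<partial>P) = measure \<Lambda> A * measure \<Lambda> A' + measure \<Lambda> (A \<inter> A')"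
    using 2 by (subst integral_eq_nn_integral) (simp_all del: ennreal_plus)
qed

text \<open>For simple functions the random integral is a finite sum of counts with vector
  coefficients, and both moments are explicit. Domination carries them to f; compensation then
  cancels the squared mean and leaves only the diagonal term.\<close>

lemma vector_campbell:
  fixes f :: "real \<times> 'a \<Rightarrow> 'a"
  assumes f [measurable]: "f \<in> borel_measurable borel"
    and E0: "E0 \<in> sets borel" "emeasure \<Lambda> E0 < \<infinity>" "\<And>p. p \<notin> E0 \<Longrightarrow> f p = 0"
    and f1: "(\<integral>\<^sup>+p. ennreal (norm (f p)) \<partial>\<Lambda>) < \<infinity>"
    and f2: "(\<integral>\<^sup>+p. ennreal ((norm (f p))\<^sup>2) \<partial>\<Lambda>) < \<infinity>"
  defines "J \<equiv> \<lambda>\<omega>. integral\<^sup>L (\<pi> \<omega>) f - integral\<^sup>L \<Lambda> f"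
  shows "J \<in> borel_measurable P" "integrable P J" "(\<integral>\<omega>. J \<omega> \<partial>P) = 0"
    and "integrable P (\<lambda>\<omega>. (norm (J \<omega>))\<^sup>2)"
    and "(\<integral>\<omega>. (norm (J \<omega>))\<^sup>2 \<partial>P) = (\<integral>p. (norm (f p))\<^sup>2 \<partial>\<Lambda>)"
proof -
  \<comment> \<open>The simple functions are dominated by twice the norm of f, the source of the
    factors 2 and 4 below.\<close>
  obtain s where s: "\<And>i. simple_function borel (s i)" and lim: "\<And>p. (\<lambda>i. s i p) \<longlonglongrightarrow> f p"
    and bd: "\<And>i p. norm (s i p) \<le> 2 * norm (f p)"
    using borel_measurable_implies_sequence_metric[OF f, of 0] by auto
  have sm [measurable]: "s i \<in> borel_measurable borel" for i
    using s by (rule borel_measurable_simple_function)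
  define Y where "Y i = range (s i) - {0}" for i
  have Y: "finite (Y i)" for i using s unfolding Y_def simple_function_def by auto
  define B where "B i y = s i -` {y}" for i y
  have B [measurable]: "B i y \<in> sets borel" for i y unfolding B_def using measurable_sets[OF sm, of "{y}"] by simp
  \<comment> \<open>The integral of the simple function as a function of the measure, so that one
    computation serves every realisation of \<pi> and the intensity alike.\<close>
  define I where "I i N = (\<Sum>y\<in>Y i. measure N (B i y) *\<^sub>R y)" for i and N :: "(real \<times> 'a) measure"
  have gen: "integrable N f" "integrable N (s i)" "I i N = integral\<^sup>L N (s i)"
      "y \<noteq> 0 \<Longrightarrow> emeasure N (B i y) < \<infinity>" "(\<lambda>i. I i N) \<longlonglongrightarrow> integral\<^sup>L N f"
      "norm (I i N) \<le> 2 * enn2real (\<integral>\<^sup>+p. ennreal (norm (f p)) \<partial>N)"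
    if sN: "sets N = sets borel" and fN: "(\<integral>\<^sup>+p. ennreal (norm (f p)) \<partial>N) < \<infinity>" for N i y
  proof -
    note [measurable_cong] = sN
    have sp: "space N = UNIV" using sets_eq_imp_space_eq[OF sN] by simp
    show intf: "integrable N f" using fN by (intro integrableI_bounded) auto
    have fB: "emeasure N (B i y) < \<infinity>" if "y \<noteq> 0" for y i
    proof -
      have "ennreal (norm y) * emeasure N (B i y) = (\<integral>\<^sup>+p. ennreal (norm y) * indicator (B i y) p \<partial>N)"
        by (subst nn_integral_cmult_indicator) auto
      also have "\<dots> \<le> (\<integral>\<^sup>+p. 2 * ennreal (norm (f p)) \<partial>N)"
      proof (rule nn_integral_mono)
        fix p
        have "ennreal (norm (s i p)) \<le> 2 * ennreal (norm (f p))"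
          using ennreal_leI[OF bd[of i p]] by (simp add: ennreal_mult)
        then show "ennreal (norm y) * indicator (B i y) p \<le> 2 * ennreal (norm (f p))"
          by (auto simp: B_def indicator_def)
      qed
      also have "\<dots> < \<infinity>" using fN by (simp add: nn_integral_cmult ennreal_mult_less_top)
      finally show ?thesis using that by (auto simp: ennreal_mult_less_top)
    qed
    then show "y \<noteq> 0 \<Longrightarrow> emeasure N (B i y) < \<infinity>" .
    have sfN: "simple_function N (s i)" for i
      using s[of i] sN sp unfolding simple_function_def by simp
    show "integrable N (s i)"
      using integral_simple_function(1)[OF sfN[of i]] fB[of _ i] by (simp add: sp B_def)
    show I: "I i N = integral\<^sup>L N (s i)" for i
      using integral_simple_function(2)[OF sfN[of i]] fB[of _ i] by (simp add: sp B_def I_def Y_def)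
    show "(\<lambda>i. I i N) \<longlonglongrightarrow> integral\<^sup>L N f" unfolding I
      by (rule integral_dominated_convergence[where w="\<lambda>p. 2 * norm (f p)"])
         (use intf lim bd in \<open>auto intro!: integrable_mult_right integrable_norm\<close>)
    have "norm (I i N) \<le> (\<integral>p. norm (s i p) \<partial>N)" unfolding I by (rule integral_norm_bound)
    also have "\<dots> \<le> (\<integral>p. 2 * norm (f p) \<partial>N)"
      using intf \<open>integrable N (s i)\<close> bd by (intro integral_mono) auto
    also have "\<dots> = 2 * enn2real (\<integral>\<^sup>+p. ennreal (norm (f p)) \<partial>N)"
      by (simp add: integral_eq_nn_integral)
    finally show "norm (I i N) \<le> 2 * enn2real (\<integral>\<^sup>+p. ennreal (norm (f p)) \<partial>N)" .
  qed
  note \<Lambda> = gen[OF sets_\<Lambda> f1]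
  \<comment> \<open>Dominates all the sums \<open>I i\<close> up to the factor 2. Its square is
    integrable by the second-moment formula, where finite first and second moments of f both
    enter.\<close>
  define w where "w \<omega> = (\<integral>\<^sup>+p. ennreal (norm (f p)) \<partial>\<pi> \<omega>)" for \<omega>
  have w [measurable]: "w \<in> borel_measurable P" unfolding w_def by (rule nn_campbell(1)) measurable
  have wfin: "AE \<omega> in P. w \<omega> < \<infinity>" unfolding w_def by (rule AE_nn_integral_finite[OF _ f1]) measurable
  have w1: "(\<integral>\<^sup>+\<omega>. w \<omega> \<partial>P) < \<infinity>"
    unfolding w_def using nn_campbell(2)[of "\<lambda>p. ennreal (norm (f p))"] f1 by simp
  have w2: "(\<integral>\<^sup>+\<omega>. w \<omega> * w \<omega> \<partial>P) < \<infinity>"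
    unfolding w_def using nn_campbell2[OF E0(1,2), of "\<lambda>p. ennreal (norm (f p))" "\<lambda>p. ennreal (norm (f p))"] f1 f2 E0(3)
    by (simp add: ennreal_mult_less_top ennreal_mult[symmetric] power2_eq_square)
  have i1: "integrable P (\<lambda>\<omega>. enn2real (w \<omega>))"
    using w1 by (intro integrableI_nonneg) (auto intro: le_less_trans[OF nn_integral_mono] simp: ennreal_enn2real_if)
  have i2: "integrable P (\<lambda>\<omega>. enn2real (w \<omega>) * enn2real (w \<omega>))"
    using w2 by (intro integrableI_nonneg)
      (auto intro!: le_less_trans[OF nn_integral_mono[where v="\<lambda>\<omega>. w \<omega> * w \<omega>"]] mult_mono simp: ennreal_enn2real_if ennreal_mult)
  have mI [measurable]: "(\<lambda>\<omega>. I i (\<pi> \<omega>)) \<in> borel_measurable P" for i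
    using measurable_emeasure_\<pi>[OF B] unfolding I_def measure_def by measurable
  \<comment> \<open>Measurability in \<omega> is read off a pointwise limit of sums of counts. Where
    \<open>w\<close> is infinite the Bochner integral has its default value 0, which is the second
    branch.\<close>
  have "integral\<^sup>L (\<pi> \<omega>) f = (if w \<omega> < \<infinity> then lim (\<lambda>i. if w \<omega> < \<infinity> then I i (\<pi> \<omega>) else 0) else 0)"
    if "\<omega> \<in> space P" for \<omega>
  proof (cases "w \<omega> < \<infinity>")
    case True
    then show ?thesis using gen(5)[OF sets_\<pi>[OF that]] unfolding w_def by (auto simp: limI)
  next
    case False
    then have "\<not> integrable (\<pi> \<omega>) f" unfolding w_def integrable_iff_bounded by auto
    then show ?thesis using False by (simp add: not_integrable_integral_eq)
  qed
  moreover have "(\<lambda>\<omega>. if w \<omega> < \<infinity> then lim (\<lambda>i. if w \<omega> < \<infinity> then I i (\<pi> \<omega>) else 0) else 0) \<in> borel_measurable P"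
  proof -
    have "(\<lambda>\<omega>. lim (\<lambda>i. if w \<omega> < \<infinity> then I i (\<pi> \<omega>) else 0)) \<in> borel_measurable P"
      by (rule borel_measurable_lim_metric) measurable
    then show ?thesis by measurable
  qed
  ultimately have mf [measurable]: "(\<lambda>\<omega>. integral\<^sup>L (\<pi> \<omega>) f) \<in> borel_measurable P"
    by (simp cong: measurable_cong)
  then show "J \<in> borel_measurable P" unfolding J_def by measurable
  have ae: "AE \<omega> in P. (\<lambda>i. I i (\<pi> \<omega>)) \<longlonglongrightarrow> integral\<^sup>L (\<pi> \<omega>) f"
    "AE \<omega> in P. norm (I i (\<pi> \<omega>)) \<le> 2 * enn2real (w \<omega>)" for i
    using wfin AE_space by (auto elim!: eventually_elim2 simp: w_def intro!: gen(5,6) sets_\<pi>)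
  have D1: "integrable P (\<lambda>\<omega>. integral\<^sup>L (\<pi> \<omega>) f)"
    "(\<lambda>i. \<integral>\<omega>. I i (\<pi> \<omega>) \<partial>P) \<longlonglongrightarrow> (\<integral>\<omega>. integral\<^sup>L (\<pi> \<omega>) f \<partial>P)"
    by (rule integrable_dominated_convergence[OF mf mI integrable_mult_right[OF i1, of 2] ae],
        rule integral_dominated_convergence[OF mf mI integrable_mult_right[OF i1, of 2] ae])
  have ae2: "AE \<omega> in P. (\<lambda>i. (norm (I i (\<pi> \<omega>)))\<^sup>2) \<longlonglongrightarrow> (norm (integral\<^sup>L (\<pi> \<omega>) f))\<^sup>2"
    using ae(1) by eventually_elim (intro tendsto_intros)
  have ae3: "AE \<omega> in P. norm ((norm (I i (\<pi> \<omega>)))\<^sup>2) \<le> 4 * (enn2real (w \<omega>) * enn2real (w \<omega>))" for i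
    using ae(2)[of i]
  proof eventually_elim
    case (elim \<omega>)
    then have "(norm (I i (\<pi> \<omega>)))\<^sup>2 \<le> (2 * enn2real (w \<omega>))\<^sup>2" by (intro power_mono) auto
    then show ?case by (simp add: power2_eq_square)
  qed
  have mf2: "(\<lambda>\<omega>. (norm (integral\<^sup>L (\<pi> \<omega>) f))\<^sup>2) \<in> borel_measurable P"
    and mI2: "(\<lambda>\<omega>. (norm (I i (\<pi> \<omega>)))\<^sup>2) \<in> borel_measurable P" for i by measurable
  have D2: "integrable P (\<lambda>\<omega>. (norm (integral\<^sup>L (\<pi> \<omega>) f))\<^sup>2)"
    "(\<lambda>i. \<integral>\<omega>. (norm (I i (\<pi> \<omega>)))\<^sup>2 \<partial>P) \<longlonglongrightarrow> (\<integral>\<omega>. (norm (integral\<^sup>L (\<pi> \<omega>) f))\<^sup>2 \<partial>P)"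
    by (rule integrable_dominated_convergence[OF mf2 mI2 integrable_mult_right[OF i2, of 4] ae2 ae3],
        rule integral_dominated_convergence[OF mf2 mI2 integrable_mult_right[OF i2, of 4] ae2 ae3])
  have fB: "emeasure \<Lambda> (B i y) < \<infinity>" if "y \<in> Y i" for i y using \<Lambda>(4) that unfolding Y_def by auto
  have m1: "(\<integral>\<omega>. I i (\<pi> \<omega>) \<partial>P) = I i \<Lambda>" for i
    unfolding I_def using fB measure_count_moments[OF B fB B fB]
    by (subst Bochner_Integration.integral_sum) auto
  have m2: "(\<integral>\<omega>. (norm (I i (\<pi> \<omega>)))\<^sup>2 \<partial>P) = (norm (I i \<Lambda>))\<^sup>2 + (\<integral>p. (norm (s i p))\<^sup>2 \<partial>\<Lambda>)" for i
  proof -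
    have exp: "(norm (I i N))\<^sup>2 = (\<Sum>y\<in>Y i. \<Sum>y'\<in>Y i. (measure N (B i y) * measure N (B i y')) * (y \<bullet> y'))" for N
      unfolding I_def power2_norm_eq_inner inner_sum_left inner_sum_right by (simp add: mult_ac inner_commute)
    have "(\<integral>\<omega>. (norm (I i (\<pi> \<omega>)))\<^sup>2 \<partial>P) = (\<Sum>y\<in>Y i. \<Sum>y'\<in>Y i.
        (measure \<Lambda> (B i y) * measure \<Lambda> (B i y') + measure \<Lambda> (B i y \<inter> B i y')) * (y \<bullet> y'))"
      unfolding exp using measure_count_moments(3,4)[OF B fB B fB]
      by (subst Bochner_Integration.integral_sum, force, intro sum.cong refl,
          subst Bochner_Integration.integral_sum) auto
    also have "\<dots> = (norm (I i \<Lambda>))\<^sup>2 + (\<Sum>y\<in>Y i. \<Sum>y'\<in>Y i. measure \<Lambda> (B i y \<inter> B i y') * (y \<bullet> y'))"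
      unfolding exp by (simp add: distrib_right sum.distrib)
    \<comment> \<open>Level sets of different values are disjoint, so only equal indices
      contribute.\<close>
    also have "(\<Sum>y\<in>Y i. \<Sum>y'\<in>Y i. measure \<Lambda> (B i y \<inter> B i y') * (y \<bullet> y'))
        = (\<Sum>y\<in>Y i. measure \<Lambda> (B i y) * (norm y)\<^sup>2)"
    proof (intro sum.cong refl)
      fix y assume y: "y \<in> Y i"
      have "(\<Sum>y'\<in>Y i. measure \<Lambda> (B i y \<inter> B i y') * (y \<bullet> y'))
          = (\<Sum>y'\<in>Y i. if y' = y then measure \<Lambda> (B i y) * (norm y)\<^sup>2 else 0)"
      proof (intro sum.cong refl)
        fix y'
        have "B i y \<inter> B i y' = (if y' = y then B i y else {})" by (auto simp: B_def)
        then show "measure \<Lambda> (B i y \<inter> B i y') * (y \<bullet> y') = (if y' = y then measure \<Lambda> (B i y) * (norm y)\<^sup>2 else 0)"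
          by (simp add: power2_norm_eq_inner)
      qed
      also have "\<dots> = measure \<Lambda> (B i y) * (norm y)\<^sup>2" using y Y by simp
      finally show "(\<Sum>y'\<in>Y i. measure \<Lambda> (B i y \<inter> B i y') * (y \<bullet> y')) = measure \<Lambda> (B i y) * (norm y)\<^sup>2" .
    qed
    also have "\<dots> = (\<integral>p. (\<Sum>y\<in>Y i. indicator (B i y) p * (norm y)\<^sup>2) \<partial>\<Lambda>)"
      using fB by (subst Bochner_Integration.integral_sum) (auto simp: sets_\<Lambda> sets_eq_imp_space_eq[OF sets_\<Lambda>])
    also have "\<dots> = (\<integral>p. (norm (s i p))\<^sup>2 \<partial>\<Lambda>)"
    proof (intro Bochner_Integration.integral_cong refl)
      fix p
      have "(\<Sum>y\<in>Y i. indicator (B i y) p * (norm y)\<^sup>2) = (\<Sum>y\<in>Y i. if y = s i p then (norm y)\<^sup>2 else 0)"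
        by (intro sum.cong refl) (auto simp: B_def indicator_def)
      also have "\<dots> = (norm (s i p))\<^sup>2" using Y by (auto simp: Y_def)
      finally show "(\<Sum>y\<in>Y i. indicator (B i y) p * (norm y)\<^sup>2) = (norm (s i p))\<^sup>2" .
    qed
    finally show ?thesis .
  qed
  have "(\<lambda>i. I i \<Lambda>) \<longlonglongrightarrow> (\<integral>\<omega>. integral\<^sup>L (\<pi> \<omega>) f \<partial>P)" using D1(2) unfolding m1 .
  then have M1: "(\<integral>\<omega>. integral\<^sup>L (\<pi> \<omega>) f \<partial>P) = integral\<^sup>L \<Lambda> f" using \<Lambda>(5) by (rule LIMSEQ_unique)
  have iff: "integrable \<Lambda> (\<lambda>p. (norm (f p))\<^sup>2)" using f2 by (intro integrableI_nonneg) auto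
  have "(\<lambda>i. \<integral>p. (norm (s i p))\<^sup>2 \<partial>\<Lambda>) \<longlonglongrightarrow> (\<integral>p. (norm (f p))\<^sup>2 \<partial>\<Lambda>)"
  proof (rule integral_dominated_convergence[where w="\<lambda>p. 4 * (norm (f p))\<^sup>2"])
    show "AE p in \<Lambda>. norm ((norm (s i p))\<^sup>2) \<le> 4 * (norm (f p))\<^sup>2" for i
    proof (rule AE_I2)
      fix p
      have "(norm (s i p))\<^sup>2 \<le> (2 * norm (f p))\<^sup>2" by (intro power_mono bd) auto
      then show "norm ((norm (s i p))\<^sup>2) \<le> 4 * (norm (f p))\<^sup>2" by (simp add: power_mult_distrib)
    qed
  qed (use iff lim in \<open>auto intro!: tendsto_intros\<close>)
  then have "(\<lambda>i. (norm (I i \<Lambda>))\<^sup>2 + (\<integral>p. (norm (s i p))\<^sup>2 \<partial>\<Lambda>))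
      \<longlonglongrightarrow> (norm (integral\<^sup>L \<Lambda> f))\<^sup>2 + (\<integral>p. (norm (f p))\<^sup>2 \<partial>\<Lambda>)"
    by (intro tendsto_intros \<Lambda>(5))
  then have M2: "(\<integral>\<omega>. (norm (integral\<^sup>L (\<pi> \<omega>) f))\<^sup>2 \<partial>P)
      = (norm (integral\<^sup>L \<Lambda> f))\<^sup>2 + (\<integral>p. (norm (f p))\<^sup>2 \<partial>\<Lambda>)"
    using D2(2) unfolding m2 by (rule LIMSEQ_unique[rotated])
  show "integrable P J" "(\<integral>\<omega>. J \<omega> \<partial>P) = 0"
    unfolding J_def using D1(1) M1 by (auto simp: prob_space)
  have Jeq: "(norm (J \<omega>))\<^sup>2 = (norm (integral\<^sup>L (\<pi> \<omega>) f))\<^sup>2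
      - 2 * (integral\<^sup>L (\<pi> \<omega>) f \<bullet> integral\<^sup>L \<Lambda> f) + (norm (integral\<^sup>L \<Lambda> f))\<^sup>2" for \<omega>
    unfolding J_def power2_norm_eq_inner by (simp add: inner_diff inner_commute)
  show "integrable P (\<lambda>\<omega>. (norm (J \<omega>))\<^sup>2)"
    unfolding Jeq using D1(1) D2(1) by auto
  have "(\<integral>\<omega>. (norm (J \<omega>))\<^sup>2 \<partial>P) = (\<integral>\<omega>. (norm (integral\<^sup>L (\<pi> \<omega>) f))\<^sup>2 \<partial>P)
      - 2 * ((\<integral>\<omega>. integral\<^sup>L (\<pi> \<omega>) f \<partial>P) \<bullet> integral\<^sup>L \<Lambda> f) + (norm (integral\<^sup>L \<Lambda> f))\<^sup>2"
    unfolding Jeq using D1(1) D2(1) by (simp add: prob_space)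
  then show "(\<integral>\<omega>. (norm (J \<omega>))\<^sup>2 \<partial>P) = (\<integral>p. (norm (f p))\<^sup>2 \<partial>\<Lambda>)"
    unfolding M1 M2 by (simp add: power2_norm_eq_inner)
qed

end

section \<open>Increments of the Levy martingale\<close>

lemma borel_measurable_blinfun_apply [measurable (raw)]:
  "f \<in> borel_measurable M \<Longrightarrow> (\<lambda>x. blinfun_apply R (f x)) \<in> borel_measurable M"
  by (rule borel_measurable_continuous_on[OF linear_continuous_on[OF blinfun.bounded_linear_right]])

lemma norm_blinfun_sq: "(norm (blinfun_apply R v))\<^sup>2 \<le> (norm R)\<^sup>2 * (norm v)\<^sup>2"
  using power_mono[OF norm_blinfun[of R v], of 2] by (simp add: power_mult_distrib)

lemma norm_sum_sq:
  fixes w :: "'i \<Rightarrow> 'a::real_inner"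
  shows "(norm (\<Sum>i\<in>I. w i))\<^sup>2 = (\<Sum>i\<in>I. \<Sum>j\<in>I. w i \<bullet> w j)"
  unfolding power2_norm_eq_inner inner_sum_left inner_sum_right by (simp add: inner_commute)

lemma integral_double_sum:
  fixes f :: "nat \<Rightarrow> nat \<Rightarrow> 'b \<Rightarrow> real"
  assumes "\<And>i j. i < n \<Longrightarrow> j < n \<Longrightarrow> integrable M (f i j)"
  shows "integrable M (\<lambda>x. \<Sum>i<n. \<Sum>j<n. f i j x)"
    and "(\<integral>x. (\<Sum>i<n. \<Sum>j<n. f i j x) \<partial>M) = (\<Sum>i<n. \<Sum>j<n. \<integral>x. f i j x \<partial>M)"
proof -
  have 1: "integrable M (\<lambda>x. \<Sum>j<n. f i j x)" "(\<integral>x. (\<Sum>j<n. f i j x) \<partial>M) = (\<Sum>j<n. \<integral>x. f i j x \<partial>M)"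
    if "i < n" for i
    using assms[OF that] by (auto intro!: Bochner_Integration.integrable_sum Bochner_Integration.integral_sum)
  show "integrable M (\<lambda>x. \<Sum>i<n. \<Sum>j<n. f i j x)" using assms by (intro Bochner_Integration.integrable_sum) auto
  have "(\<integral>x. (\<Sum>i<n. \<Sum>j<n. f i j x) \<partial>M) = (\<Sum>i<n. \<integral>x. (\<Sum>j<n. f i j x) \<partial>M)"
    using 1 by (intro Bochner_Integration.integral_sum) auto
  then show "(\<integral>x. (\<Sum>i<n. \<Sum>j<n. f i j x) \<partial>M) = (\<Sum>i<n. \<Sum>j<n. \<integral>x. f i j x \<partial>M)"
    using 1(2) by simp
qed

lemma sq_norm_add_le: "(norm (u + v))\<^sup>2 \<le> 2 * (norm u)\<^sup>2 + 2 * (norm (v::'a::real_normed_vector))\<^sup>2"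
proof -
  have "(norm (u + v))\<^sup>2 \<le> (norm u + norm v)\<^sup>2" by (intro power_mono norm_triangle_ineq) auto
  also have "\<dots> \<le> 2 * (norm u)\<^sup>2 + 2 * (norm v)\<^sup>2"
    using zero_le_power2[of "norm u - norm v"] by (simp add: power2_eq_square algebra_simps)
  finally show ?thesis .
qed

lemma sq_norm_add_le_ennreal:
  "ennreal ((norm (u + v))\<^sup>2) \<le> 2 * ennreal ((norm u)\<^sup>2) + 2 * ennreal ((norm (v::'a::real_normed_vector))\<^sup>2)"
  using ennreal_leI[OF sq_norm_add_le[of u v]] by (simp add: ennreal_mult)

lemma sq_norm_add3_le:
  "(norm (u + v + w))\<^sup>2 \<le> 3 * (norm u)\<^sup>2 + 3 * (norm v)\<^sup>2 + 3 * (norm (w::'a::real_normed_vector))\<^sup>2"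
proof -
  have "(norm (u + v + w))\<^sup>2 \<le> (norm u + norm v + norm w)\<^sup>2"
    by (intro power_mono norm_triangle_le add_right_mono norm_triangle_ineq) auto
  also have "\<dots> \<le> 3 * (norm u)\<^sup>2 + 3 * (norm v)\<^sup>2 + 3 * (norm w)\<^sup>2"
    using zero_le_power2[of "norm u - norm v"] zero_le_power2[of "norm u - norm w"]
      zero_le_power2[of "norm v - norm w"] by (simp add: power2_eq_square algebra_simps)
  finally show ?thesis .
qed

section \<open>Square integrable random vectors\<close>

context prob_space
begin

lemma integrable_of_square_integrable:
  fixes V :: "'a \<Rightarrow> 'b::{banach, second_countable_topology}"
  assumes [measurable]: "V \<in> borel_measurable M" and "integrable M (\<lambda>\<omega>. (norm (V \<omega>))\<^sup>2)"
  shows "integrable M V"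
proof (rule Bochner_Integration.integrable_bound[where f="\<lambda>\<omega>. 1 + (norm (V \<omega>))\<^sup>2"])
  show "AE \<omega> in M. norm (V \<omega>) \<le> norm (1 + (norm (V \<omega>))\<^sup>2)"
  proof (rule AE_I2)
    fix \<omega>
    have "0 \<le> (norm (V \<omega>) - 1)\<^sup>2" by simp
    then show "norm (V \<omega>) \<le> norm (1 + (norm (V \<omega>))\<^sup>2)"
      by (simp add: power2_eq_square algebra_simps) (smt (verit) norm_ge_zero)
  qed
qed (use assms in auto)

lemma integrable_inner_square_integrable:
  fixes U V :: "'a \<Rightarrow> 'b::{real_inner, banach, second_countable_topology}"
  assumes [measurable]: "U \<in> borel_measurable M" "V \<in> borel_measurable M"
    and "integrable M (\<lambda>\<omega>. (norm (U \<omega>))\<^sup>2)" "integrable M (\<lambda>\<omega>. (norm (V \<omega>))\<^sup>2)"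
  shows "integrable M (\<lambda>\<omega>. U \<omega> \<bullet> V \<omega>)"
proof (rule Bochner_Integration.integrable_bound[where f="\<lambda>\<omega>. (norm (U \<omega>))\<^sup>2 + (norm (V \<omega>))\<^sup>2"])
  show "AE \<omega> in M. norm (U \<omega> \<bullet> V \<omega>) \<le> norm ((norm (U \<omega>))\<^sup>2 + (norm (V \<omega>))\<^sup>2)"
  proof (rule AE_I2)
    fix \<omega>
    have "\<bar>U \<omega> \<bullet> V \<omega>\<bar> \<le> norm (U \<omega>) * norm (V \<omega>)" by (rule Cauchy_Schwarz_ineq2)
    moreover have "0 \<le> (norm (U \<omega>) - norm (V \<omega>))\<^sup>2" by simp
    moreover have "0 \<le> norm (U \<omega>) * norm (V \<omega>)" by simp
    ultimately show "norm (U \<omega> \<bullet> V \<omega>) \<le> norm ((norm (U \<omega>))\<^sup>2 + (norm (V \<omega>))\<^sup>2)"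
      by (simp add: power2_eq_square algebra_simps)
  qed
qed (use assms in auto)

lemma square_expectation_le:
  fixes V :: "'a \<Rightarrow> 'b::{banach, second_countable_topology}"
  assumes [measurable]: "V \<in> borel_measurable M" and i: "integrable M (\<lambda>\<omega>. (norm (V \<omega>))\<^sup>2)"
  shows "(norm (expectation V))\<^sup>2 \<le> expectation (\<lambda>\<omega>. (norm (V \<omega>))\<^sup>2)"
proof -
  have "integrable M (\<lambda>\<omega>. norm (V \<omega>))" using integrable_of_square_integrable[OF assms] by simp
  from variance_eq[OF this i] have "(expectation (\<lambda>\<omega>. norm (V \<omega>)))\<^sup>2 \<le> expectation (\<lambda>\<omega>. (norm (V \<omega>))\<^sup>2)"
    using variance_positive[of "\<lambda>\<omega>. norm (V \<omega>)"] by simp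
  moreover have "(norm (expectation V))\<^sup>2 \<le> (expectation (\<lambda>\<omega>. norm (V \<omega>)))\<^sup>2"
    by (intro power_mono integral_norm_bound) auto
  ultimately show ?thesis by linarith
qed

text \<open>For every c > 0 the difference of the squared norms of u and w is at most (1 + 1/c) |w -
  u|^2 + c |w|^2, a weighted Young inequality. First c is made small, and only then k large.\<close>

lemma square_norm_tendsto:
  fixes V :: "'a \<Rightarrow> 'b::{banach, second_countable_topology}"
  assumes [measurable]: "V \<in> borel_measurable M" "\<And>k. U k \<in> borel_measurable M"
    and V: "integrable M (\<lambda>\<omega>. (norm (V \<omega>))\<^sup>2)" and U: "\<And>k. integrable M (\<lambda>\<omega>. (norm (U k \<omega>))\<^sup>2)"
    and d: "\<And>k. integrable M (\<lambda>\<omega>. (norm (V \<omega> - U k \<omega>))\<^sup>2)"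
    and lim: "(\<lambda>k. expectation (\<lambda>\<omega>. (norm (V \<omega> - U k \<omega>))\<^sup>2)) \<longlonglongrightarrow> 0"
  shows "(\<lambda>k. expectation (\<lambda>\<omega>. (norm (U k \<omega>))\<^sup>2)) \<longlonglongrightarrow> expectation (\<lambda>\<omega>. (norm (V \<omega>))\<^sup>2)"
proof (rule LIMSEQ_I)
  fix e :: real assume e: "0 < e"
  define v where "v = expectation (\<lambda>\<omega>. (norm (V \<omega>))\<^sup>2)"
  have v: "0 \<le> v" unfolding v_def by simp
  \<comment> \<open>Chosen so that c times the second moment of \<open>V\<close> is at most e/2; the
    summand 1 excludes division by zero.\<close>
  define c where "c = e / (2 * (v + 1))"
  have c: "0 < c" unfolding c_def using e v by simp
  have cv: "c * v \<le> e / 2" unfolding c_def using e v by (simp add: field_simps)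
  have pt: "\<bar>(norm u)\<^sup>2 - (norm w)\<^sup>2\<bar> \<le> (1 + 1/c) * (norm (w - u))\<^sup>2 + c * (norm w)\<^sup>2" for u w :: 'b
  proof -
    define x where "x = norm (w - u)"
    have x: "\<bar>norm u - norm w\<bar> \<le> x" "0 \<le> x" unfolding x_def by (auto simp: norm_minus_commute norm_triangle_ineq3)
    have "\<bar>(norm u)\<^sup>2 - (norm w)\<^sup>2\<bar> = \<bar>norm u - norm w\<bar> * (norm u + norm w)"
      by (simp add: power2_eq_square square_diff_square_factored abs_mult)
    also have "\<dots> \<le> x * (x + 2 * norm w)"
      by (intro mult_mono) (use x in auto)
    also have "2 * x * norm w \<le> (1/c) * x\<^sup>2 + c * (norm w)\<^sup>2"
    proof -
      have "0 \<le> (x - c * norm w)\<^sup>2 / c" using c by simp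
      also have "\<dots> = (1/c) * x\<^sup>2 - 2 * x * norm w + c * (norm w)\<^sup>2"
        using c by (simp add: power2_eq_square field_simps)
      finally show ?thesis by simp
    qed
    then have "x * (x + 2 * norm w) \<le> (1 + 1/c) * x\<^sup>2 + c * (norm w)\<^sup>2"
      by (simp add: power2_eq_square algebra_simps)
    finally show ?thesis unfolding x_def .
  qed
  have "(\<lambda>k. (1 + 1/c) * expectation (\<lambda>\<omega>. (norm (V \<omega> - U k \<omega>))\<^sup>2)) \<longlonglongrightarrow> (1 + 1/c) * 0"
    by (intro tendsto_intros lim)
  then obtain N where N: "\<And>k. k \<ge> N \<Longrightarrow> norm ((1 + 1/c) * expectation (\<lambda>\<omega>. (norm (V \<omega> - U k \<omega>))\<^sup>2)) < e / 2"
    using LIMSEQ_D[of _ "(1 + 1/c) * 0" "e/2"] e by auto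
  show "\<exists>no. \<forall>k\<ge>no. norm (expectation (\<lambda>\<omega>. (norm (U k \<omega>))\<^sup>2) - expectation (\<lambda>\<omega>. (norm (V \<omega>))\<^sup>2)) < e"
  proof (intro exI allI impI)
    fix k assume k: "N \<le> k"
    have "norm (expectation (\<lambda>\<omega>. (norm (U k \<omega>))\<^sup>2) - expectation (\<lambda>\<omega>. (norm (V \<omega>))\<^sup>2))
        = norm (expectation (\<lambda>\<omega>. (norm (U k \<omega>))\<^sup>2 - (norm (V \<omega>))\<^sup>2))"
      using U V by simp
    also have "\<dots> \<le> expectation (\<lambda>\<omega>. norm ((norm (U k \<omega>))\<^sup>2 - (norm (V \<omega>))\<^sup>2))"
      by (rule integral_norm_bound)
    also have "\<dots> \<le> expectation (\<lambda>\<omega>. (1 + 1/c) * (norm (V \<omega> - U k \<omega>))\<^sup>2 + c * (norm (V \<omega>))\<^sup>2)"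
      using U V d pt by (intro integral_mono) auto
    also have "\<dots> = (1 + 1/c) * expectation (\<lambda>\<omega>. (norm (V \<omega> - U k \<omega>))\<^sup>2) + c * v"
      unfolding v_def using V d by simp
    also have "\<dots> < e" using N[OF k] cv unfolding real_norm_def by linarith
    finally show "norm (expectation (\<lambda>\<omega>. (norm (U k \<omega>))\<^sup>2) - expectation (\<lambda>\<omega>. (norm (V \<omega>))\<^sup>2)) < e" .
  qed
qed

end

section \<open>The intensity over time strips, and the moments of increments\<close>

lemma nn_integral_intensity_strip:
  assumes levy: "levy_measure2 \<nu>" and st: "0 \<le> s" "s \<le> t" and g: "g \<in> borel_measurable borel"
  shows "(\<integral>\<^sup>+p. indicator {s<..t} (fst p) * g (snd p) \<partial>intensity_measure \<nu>) = ennreal (t - s) * (\<integral>\<^sup>+z. g z \<partial>\<nu>)"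
proof -
  interpret sigma_finite_measure \<nu> by (rule levy_measure2_sigma_finite[OF levy])
  have sets [measurable_cong]: "sets \<nu> = sets borel" using levy unfolding levy_measure2_def by auto
  have [measurable]: "g \<in> borel_measurable borel" by (rule g)
  have "{0<..} \<times> UNIV \<in> sets ((lborel :: real measure) \<Otimes>\<^sub>M \<nu>)"
    using sets_eq_imp_space_eq[OF sets] by (intro pair_measureI) (auto simp: sets)
  then have [measurable]: "indicator ({0<..} \<times> UNIV) \<in> borel_measurable ((lborel :: real measure) \<Otimes>\<^sub>M \<nu>)"
    by (rule borel_measurable_indicator)
  have "(\<integral>\<^sup>+p. indicator {s<..t} (fst p) * g (snd p) \<partial>intensity_measure \<nu>)
      = (\<integral>\<^sup>+p. indicator ({0<..} \<times> UNIV) p * (indicator {s<..t} (fst p) * g (snd p)) \<partial>(lborel \<Otimes>\<^sub>M \<nu>))"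
    unfolding intensity_measure_def by (rule nn_integral_density) measurable
  also have "\<dots> = (\<integral>\<^sup>+p. indicator {s<..t} (fst p) * g (snd p) \<partial>(lborel \<Otimes>\<^sub>M \<nu>))"
    using st by (intro nn_integral_cong) (auto simp: indicator_def)
  also have "\<dots> = (\<integral>\<^sup>+r. (\<integral>\<^sup>+z. indicator {s<..t} r * g z \<partial>\<nu>) \<partial>lborel)"
    by (subst nn_integral_fst[symmetric]) auto
  also have "\<dots> = (\<integral>\<^sup>+r. (\<integral>\<^sup>+z. g z \<partial>\<nu>) * indicator {s<..t} (r::real) \<partial>lborel)"
    by (intro nn_integral_cong) (simp add: nn_integral_cmult nn_integral_multc mult.commute)
  also have "\<dots> = ennreal (t - s) * (\<integral>\<^sup>+z. g z \<partial>\<nu>)"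
    using st by (subst nn_integral_cmult_indicator) (auto simp: mult.commute)
  finally show ?thesis .
qed

lemma integral_intensity_strip:
  fixes g :: "'a::{real_inner, banach, second_countable_topology} \<Rightarrow> 'b::{banach, second_countable_topology}"
  assumes levy: "levy_measure2 \<nu>" and st: "0 \<le> s" "s \<le> t" and g: "g \<in> borel_measurable borel" "integrable \<nu> g"
  shows "integrable (intensity_measure \<nu>) (\<lambda>p. indicator {s<..t} (fst p) *\<^sub>R g (snd p))"
    and "(\<integral>p. indicator {s<..t} (fst p) *\<^sub>R g (snd p) \<partial>intensity_measure \<nu>) = (t - s) *\<^sub>R (\<integral>z. g z \<partial>\<nu>)"
proof -
  interpret N: sigma_finite_measure \<nu> by (rule levy_measure2_sigma_finite[OF levy])
  interpret pair_sigma_finite "lborel :: real measure" \<nu> by unfold_locales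
  have sets [measurable_cong]: "sets \<nu> = sets borel" using levy unfolding levy_measure2_def by auto
  note [measurable_cong] = sets_intensity_measure[OF levy, folded borel_prod]
  have [measurable]: "g \<in> borel_measurable borel" by (rule g)
  have "{0<..} \<times> UNIV \<in> sets ((lborel :: real measure) \<Otimes>\<^sub>M \<nu>)"
    using sets_eq_imp_space_eq[OF sets] by (intro pair_measureI) (auto simp: sets)
  then have m [measurable]: "(indicator ({0<..} \<times> UNIV) :: _ \<Rightarrow> real) \<in> borel_measurable ((lborel :: real measure) \<Otimes>\<^sub>M \<nu>)"
    by (rule borel_measurable_indicator)
  show i: "integrable (intensity_measure \<nu>) (\<lambda>p. indicator {s<..t} (fst p) *\<^sub>R g (snd p))"
  proof (rule integrableI_bounded)
    have "(\<integral>\<^sup>+p. ennreal (norm (indicator {s<..t} (fst p) *\<^sub>R g (snd p))) \<partial>intensity_measure \<nu>)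
        = (\<integral>\<^sup>+p. indicator {s<..t} (fst p) * ennreal (norm (g (snd p))) \<partial>intensity_measure \<nu>)"
      by (intro nn_integral_cong) (auto simp: indicator_def)
    also have "\<dots> = ennreal (t - s) * (\<integral>\<^sup>+z. ennreal (norm (g z)) \<partial>\<nu>)"
      by (rule nn_integral_intensity_strip[OF levy st]) measurable
    also have "\<dots> < \<infinity>" using g(2) unfolding integrable_iff_bounded by (simp add: ennreal_mult_less_top)
    finally show "(\<integral>\<^sup>+p. ennreal (norm (indicator {s<..t} (fst p) *\<^sub>R g (snd p))) \<partial>intensity_measure \<nu>) < \<infinity>" .
  qed measurable
  have dens: "intensity_measure \<nu> = density (lborel \<Otimes>\<^sub>M \<nu>) (\<lambda>p. ennreal (indicator ({0<..} \<times> UNIV) p))"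
    unfolding intensity_measure_def by (simp add: ennreal_indicator)
  have e: "indicator ({0<..} \<times> UNIV) p *\<^sub>R indicator {s<..t} (fst p) *\<^sub>R g (snd p)
      = (case p of (r, z) \<Rightarrow> indicat_real {s<..t} r *\<^sub>R g z)" for p
    using st by (cases p) (auto simp: indicator_def)
  have fm: "(\<lambda>p. indicat_real {s<..t} (fst p) *\<^sub>R g (snd p)) \<in> borel_measurable (lborel \<Otimes>\<^sub>M \<nu>)" by measurable
  have i2: "integrable (lborel \<Otimes>\<^sub>M \<nu>) (\<lambda>(r, z). indicat_real {s<..t} r *\<^sub>R g z)"
  proof -
    have "integrable (lborel \<Otimes>\<^sub>M \<nu>)
        (\<lambda>p. indicat_real ({0<..} \<times> UNIV) p *\<^sub>R indicat_real {s<..t} (fst p) *\<^sub>R g (snd p))"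
      using i unfolding dens by (subst (asm) integrable_density[OF fm m]) simp_all
    then show ?thesis unfolding e .
  qed
  have "(\<integral>p. indicator {s<..t} (fst p) *\<^sub>R g (snd p) \<partial>intensity_measure \<nu>)
      = (\<integral>p. (case p of (r, z) \<Rightarrow> indicat_real {s<..t} r *\<^sub>R g z) \<partial>(lborel \<Otimes>\<^sub>M \<nu>))"
    unfolding e[symmetric] dens by (rule integral_density[OF fm m]) simp
  also have "\<dots> = (\<integral>r. (\<integral>z. indicat_real {s<..t} r *\<^sub>R g z \<partial>\<nu>) \<partial>lborel)"
    by (rule integral_fst[symmetric, OF i2])
  also have "\<dots> = (t - s) *\<^sub>R (\<integral>z. g z \<partial>\<nu>)"
    using st by simp
  finally show "(\<integral>p. indicator {s<..t} (fst p) *\<^sub>R g (snd p) \<partial>intensity_measure \<nu>) = (t - s) *\<^sub>R (\<integral>z. g z \<partial>\<nu>)" .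
qed

text \<open>The increment is an L2 limit of compensated sums of the jumps in (s,t] above a vanishing
  threshold, and for those the Poisson formulas give mean and variance. The operator R is carried
  along because the quadratic forms for all R determine the covariance by polarization.\<close>

lemma levy_increment_moments:
  fixes L :: "real \<Rightarrow> 'w \<Rightarrow> 'a::{real_inner, banach, second_countable_topology}" and R :: "'a \<Rightarrow>\<^sub>L 'a"
  assumes PS: "prob_space P" and lm: "levy_measure2 \<nu>" and NF: "normal_filtration P \<F>"
    and LM: "levy_martingale P \<F> \<nu> L" and st: "0 \<le> s" "s \<le> t"
  defines "V \<equiv> \<lambda>\<omega>. L t \<omega> - L s \<omega>"
  shows "V \<in> borel_measurable P" "integrable P (\<lambda>\<omega>. (norm (V \<omega>))\<^sup>2)" "(\<integral>\<omega>. V \<omega> \<partial>P) = 0"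
    and "(\<integral>\<omega>. (norm (blinfun_apply R (V \<omega>)))\<^sup>2 \<partial>P) = (t - s) * (\<integral>z. (norm (blinfun_apply R z))\<^sup>2 \<partial>\<nu>)"
proof -
  interpret prob_space P by (rule PS)
  interpret poisson_rm P \<nu> "jump_measure L"
    by unfold_locales (rule lm, rule LM[unfolded levy_martingale_def, THEN conjunct2, THEN conjunct2, THEN conjunct1])
  have sets [measurable_cong]: "sets \<nu> = sets borel" and zero: "emeasure \<nu> {0} = 0"
    and fin: "(\<integral>\<^sup>+z. ennreal ((norm z)\<^sup>2) \<partial>\<nu>) < \<infinity>"
    using lm unfolding levy_measure2_def by auto
  have Lm [measurable]: "L u \<in> borel_measurable P" if "0 \<le> u" for u
  proof -
    have "L u \<in> borel_measurable (\<F> u)" using LM that unfolding levy_martingale_def by auto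
    moreover have "subalgebra P (\<F> u)" using NF[unfolded normal_filtration_def, THEN conjunct1] that unfolding subalgebra_def by blast
    ultimately show ?thesis by (rule measurable_from_subalg[rotated])
  qed
  have [measurable]: "L s \<in> borel_measurable P" "L t \<in> borel_measurable P" using st by auto
  show Vm [measurable]: "V \<in> borel_measurable P" unfolding V_def by measurable
  have sq: "integrable \<nu> (\<lambda>z. (norm z)\<^sup>2)" using fin by (intro integrableI_nonneg) auto
  define \<epsilon> where "\<epsilon> k = inverse (real (Suc k))" for k
  have \<epsilon>: "0 < \<epsilon> k" for k unfolding \<epsilon>_def by simp
  define g where "g k z = indicat_real {z. \<epsilon> k < norm z} z *\<^sub>R z" for k and z :: 'a
  have gm [measurable]: "g k \<in> borel_measurable borel" for k unfolding g_def by measurable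
  have g2: "(norm (g k z))\<^sup>2 \<le> (norm z)\<^sup>2" for k z unfolding g_def by (auto simp: indicator_def)
  \<comment> \<open>Above the threshold the norm is at most its square divided by
    \<open>\<epsilon> k\<close>. The second moment therefore makes the truncated identity
    integrable, although \<nu> may have infinite mass near 0.\<close>
  have g1: "norm (g k z) \<le> (1 / \<epsilon> k) * (norm z)\<^sup>2" for k z
  proof -
    have "norm z * \<epsilon> k \<le> norm z * norm z" if "\<epsilon> k < norm z" using that by (intro mult_left_mono) auto
    then show ?thesis unfolding g_def using \<epsilon>[of k] by (auto simp: indicator_def field_simps power2_eq_square)
  qed
  have gi: "integrable \<nu> (g k)" for k
    by (rule Bochner_Integration.integrable_bound[OF integrable_mult_right[OF sq, of "1 / \<epsilon> k"]])
       (use g1 \<epsilon> in \<open>auto intro!: AE_I2 simp: less_imp_le\<close>)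
  have gi2: "integrable \<nu> (\<lambda>z. (norm (blinfun_apply R (g k z)))\<^sup>2)" for k and R :: "'a \<Rightarrow>\<^sub>L 'a"
  proof (rule Bochner_Integration.integrable_bound[OF integrable_mult_right[OF sq, of "(norm R)\<^sup>2"]])
    show "AE z in \<nu>. norm ((norm (R (g k z)))\<^sup>2) \<le> norm ((norm R)\<^sup>2 * (norm z)\<^sup>2)"
    proof (rule AE_I2)
      fix z
      have "(norm (R (g k z)))\<^sup>2 \<le> (norm R * norm (g k z))\<^sup>2" by (intro power_mono norm_blinfun) auto
      also have "\<dots> \<le> (norm R)\<^sup>2 * (norm z)\<^sup>2"
        unfolding power_mult_distrib by (intro mult_left_mono g2) auto
      finally show "norm ((norm (R (g k z)))\<^sup>2) \<le> norm ((norm R)\<^sup>2 * (norm z)\<^sup>2)" by simp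
    qed
  qed measurable
  define f where "f a b k p = indicat_real {a<..b} (fst p) *\<^sub>R g k (snd p)" for a b k and p :: "real \<times> 'a"
  have fm [measurable]: "f a b k \<in> borel_measurable borel" for a b k
    unfolding f_def borel_prod[symmetric] by measurable
  define J where "J R a b k \<omega> = integral\<^sup>L (jump_measure L \<omega>) (\<lambda>p. R (f a b k p)) - (b - a) *\<^sub>R R (integral\<^sup>L \<nu> (g k))"
    for R :: "'a \<Rightarrow>\<^sub>L 'a" and a b k \<omega>
  have camp: "J R a b k \<in> borel_measurable P" "(\<integral>\<omega>. J R a b k \<omega> \<partial>P) = 0"
    "integrable P (\<lambda>\<omega>. (norm (J R a b k \<omega>))\<^sup>2)"
    "(\<integral>\<omega>. (norm (J R a b k \<omega>))\<^sup>2 \<partial>P) = (b - a) * (\<integral>z. (norm (R (g k z)))\<^sup>2 \<partial>\<nu>)"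
    if ab: "0 \<le> a" "a \<le> b" for a b k and R :: "'a \<Rightarrow>\<^sub>L 'a"
  proof -
    define E0 where "E0 = {a<..b} \<times> {z::'a. \<epsilon> k < norm z}"
    have E0 [measurable]: "E0 \<in> sets borel" unfolding E0_def borel_prod[symmetric] by measurable
    have one: "(\<integral>\<^sup>+z. indicator {z. \<epsilon> k < norm z} z \<partial>\<nu>) < \<infinity>"
    proof -
      have "(\<integral>\<^sup>+z. indicator {z. \<epsilon> k < norm z} z \<partial>\<nu>) \<le> (\<integral>\<^sup>+z. ennreal ((1/\<epsilon> k)\<^sup>2) * ennreal ((norm z)\<^sup>2) \<partial>\<nu>)"
      proof (rule nn_integral_mono)
        fix z
        have "1 \<le> (1/\<epsilon> k)\<^sup>2 * (norm z)\<^sup>2" if "\<epsilon> k < norm z"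
          unfolding power_mult_distrib[symmetric] using that \<epsilon>[of k] by (intro one_le_power) (simp add: field_simps)
        then show "indicator {z. \<epsilon> k < norm z} z \<le> ennreal ((1/\<epsilon> k)\<^sup>2) * ennreal ((norm z)\<^sup>2)"
          by (auto simp: indicator_def ennreal_mult[symmetric])
      qed
      also have "\<dots> < \<infinity>" using fin by (simp add: nn_integral_cmult ennreal_mult_less_top)
      finally show ?thesis .
    qed
    have "emeasure \<Lambda> E0 = (\<integral>\<^sup>+p. indicator E0 p \<partial>\<Lambda>)" using E0 sets_\<Lambda> by simp
    also have "\<dots> = (\<integral>\<^sup>+p. indicator {a<..b} (fst p) * indicator {z. \<epsilon> k < norm z} (snd p) \<partial>\<Lambda>)"
      by (intro nn_integral_cong) (auto simp: E0_def indicator_def)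
    also have "\<dots> < \<infinity>"
      using one by (subst nn_integral_intensity_strip[OF lm ab]) (auto simp: ennreal_mult_less_top)
    finally have E0f: "emeasure \<Lambda> E0 < \<infinity>" .
    have supp: "R (f a b k p) = 0" if "p \<notin> E0" for p
      using that unfolding f_def g_def E0_def by (cases p) (auto simp: indicator_def)
    have eq: "R (f a b k p) = indicat_real {a<..b} (fst p) *\<^sub>R R (g k (snd p))" for p
      unfolding f_def by (simp add: blinfun.scaleR_right)
    have iR: "integrable \<nu> (\<lambda>z. R (g k z))"
      by (rule integrable_bounded_linear[OF blinfun.bounded_linear_right gi])
    have m2 [measurable]: "(\<lambda>z. R (g k z)) \<in> borel_measurable borel" by measurable
    note strip = integral_intensity_strip[OF lm ab m2 iR]
    have f1: "(\<integral>\<^sup>+p. ennreal (norm (R (f a b k p))) \<partial>\<Lambda>) < \<infinity>"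
      using strip(1) unfolding eq integrable_iff_bounded by simp
    have i2: "integrable \<Lambda> (\<lambda>p. indicat_real {a<..b} (fst p) *\<^sub>R (norm (R (g k (snd p))))\<^sup>2)"
      "(\<integral>p. indicat_real {a<..b} (fst p) *\<^sub>R (norm (R (g k (snd p))))\<^sup>2 \<partial>\<Lambda>) = (b - a) *\<^sub>R (\<integral>z. (norm (R (g k z)))\<^sup>2 \<partial>\<nu>)"
      by (rule integral_intensity_strip[OF lm ab _ gi2]; measurable)+
    have eq2: "(norm (R (f a b k p)))\<^sup>2 = indicat_real {a<..b} (fst p) *\<^sub>R (norm (R (g k (snd p))))\<^sup>2" for p
      unfolding eq by (auto simp: indicator_def)
    have f2: "(\<integral>\<^sup>+p. ennreal ((norm (R (f a b k p)))\<^sup>2) \<partial>\<Lambda>) < \<infinity>"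
      using i2(1) unfolding eq2 integrable_iff_bounded by simp
    have L: "integral\<^sup>L \<Lambda> (\<lambda>p. R (f a b k p)) = (b - a) *\<^sub>R R (integral\<^sup>L \<nu> (g k))"
      unfolding eq strip(2) by (simp add: integral_bounded_linear[OF blinfun.bounded_linear_right gi])
    note c = vector_campbell[OF _ E0 E0f supp f1 f2, unfolded L]
    show "J R a b k \<in> borel_measurable P" "(\<integral>\<omega>. J R a b k \<omega> \<partial>P) = 0"
      "integrable P (\<lambda>\<omega>. (norm (J R a b k \<omega>))\<^sup>2)"
      unfolding J_def[abs_def] by (rule c; measurable)+
    show "(\<integral>\<omega>. (norm (J R a b k \<omega>))\<^sup>2 \<partial>P) = (b - a) * (\<integral>z. (norm (R (g k z)))\<^sup>2 \<partial>\<nu>)"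
      unfolding J_def[abs_def] by (subst c(5)) (use i2(2) in \<open>simp_all add: eq2\<close>)
  qed
  define K where "K u k \<omega> = integral\<^sup>L (jump_measure L \<omega>) (f 0 u k) - u *\<^sub>R integral\<^sup>L \<nu> (g k)" for u k \<omega>
  have Km [measurable]: "K u k \<in> borel_measurable P" if "0 \<le> u" for u k
    using camp(1)[of 0 u id_blinfun k] that unfolding K_def J_def[abs_def] by simp
  have [measurable]: "K s k \<in> borel_measurable P" "K t k \<in> borel_measurable P" for k using st by auto
  have Klim: "(\<lambda>k. \<integral>\<^sup>+\<omega>. ennreal ((norm (L u \<omega> - K u k \<omega>))\<^sup>2) \<partial>P) \<longlonglongrightarrow> 0" if "0 \<le> u" for u
  proof -
    have "filterlim \<epsilon> (at_right 0) sequentially"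
      unfolding filterlim_at using \<epsilon> LIMSEQ_inverse_real_of_nat by (auto simp: \<epsilon>_def[abs_def])
    from filterlim_compose[OF LM[unfolded levy_martingale_def, THEN conjunct2, THEN conjunct2, THEN conjunct2, THEN conjunct1, rule_format, OF that] this]
    have "(\<lambda>k. \<integral>\<^sup>+\<omega>. ennreal ((norm (L u \<omega> -
          ((LINT p:{0<..u} \<times> {z. \<epsilon> k < norm z}|jump_measure L \<omega>. snd p)
           - u *\<^sub>R (LINT z:{z. \<epsilon> k < norm z}|\<nu>. z))))\<^sup>2) \<partial>P) \<longlonglongrightarrow> 0" .
    moreover have "(LINT p:{0<..u} \<times> {z. \<epsilon> k < norm z}|N. snd p) = integral\<^sup>L N (f 0 u k)" for k N
      unfolding set_lebesgue_integral_def f_def g_def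
      by (intro Bochner_Integration.integral_cong refl) (auto simp: indicator_def)
    moreover have "(LINT z:{z. \<epsilon> k < norm z}|\<nu>. z) = integral\<^sup>L \<nu> (g k)" for k
      unfolding set_lebesgue_integral_def g_def ..
    ultimately show ?thesis unfolding K_def by simp
  qed
  define H where "H k \<omega> = K t k \<omega> - K s k \<omega>" for k \<omega>
  have Hm [measurable]: "H k \<in> borel_measurable P" for k unfolding H_def by measurable
  \<comment> \<open>Additivity of the jump sums over (0,s] and (s,t]. It rests on absolute
    convergence of the sum over (0,t], which is known almost surely only.\<close>
  have HJ: "AE \<omega> in P. J R s t k \<omega> = R (H k \<omega>)"
    for k and R :: "'a \<Rightarrow>\<^sub>L 'a"
  proof -
    have "(\<integral>\<^sup>+p. ennreal (norm (f 0 t k p)) \<partial>\<Lambda>) < \<infinity>"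
      using integral_intensity_strip(1)[OF lm _ _ gm gi, of 0 t k] st unfolding integrable_iff_bounded f_def by simp
    from AE_nn_integral_finite[OF _ this]
    have "AE \<omega> in P. (\<integral>\<^sup>+p. ennreal (norm (f 0 t k p)) \<partial>jump_measure L \<omega>) < \<infinity>" by measurable
    then show ?thesis using AE_space
    proof eventually_elim
      case (elim \<omega>)
      note [measurable_cong] = sets_\<pi>[OF elim(2)]
      have it: "integrable (jump_measure L \<omega>) (f 0 t k)" using elim by (intro integrableI_bounded) measurable
      have is': "integrable (jump_measure L \<omega>) (f 0 s k)"
        by (rule Bochner_Integration.integrable_bound[OF it]) (use st in \<open>auto simp: f_def indicator_def\<close>)
      have "f s t k = (\<lambda>p. f 0 t k p - f 0 s k p)"
        using st unfolding f_def by (intro ext) (auto simp: indicator_def)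
      then have "integral\<^sup>L (jump_measure L \<omega>) (\<lambda>p. R (f s t k p))
          = R (integral\<^sup>L (jump_measure L \<omega>) (f 0 t k) - integral\<^sup>L (jump_measure L \<omega>) (f 0 s k))"
        using it is' by (subst integral_bounded_linear[OF blinfun.bounded_linear_right]) auto
      then show ?case unfolding H_def K_def J_def
        by (simp add: blinfun.diff_right blinfun.add_right blinfun.scaleR_right algebra_simps)
    qed
  qed
  have H0: "(\<integral>\<omega>. H k \<omega> \<partial>P) = 0" for k
  proof -
    have "(\<integral>\<omega>. H k \<omega> \<partial>P) = (\<integral>\<omega>. J id_blinfun s t k \<omega> \<partial>P)"
      by (rule integral_cong_AE[OF _ camp(1)[OF st]]) (use HJ[of id_blinfun k] in \<open>auto elim!: eventually_mono\<close>)
    then show ?thesis using camp(2)[OF st] by simp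
  qed
  have HR: "integrable P (\<lambda>\<omega>. (norm (blinfun_apply R (H k \<omega>)))\<^sup>2)"
    "(\<integral>\<omega>. (norm (blinfun_apply R (H k \<omega>)))\<^sup>2 \<partial>P) = (t - s) * (\<integral>z. (norm (R (g k z)))\<^sup>2 \<partial>\<nu>)"
    for k and R :: "'a \<Rightarrow>\<^sub>L 'a"
  proof -
    let ?J = "J R s t k"
    have [measurable]: "?J \<in> borel_measurable P" by (rule camp(1)[OF st])
    have ae: "AE \<omega> in P. (norm (?J \<omega>))\<^sup>2 = (norm (R (H k \<omega>)))\<^sup>2"
      using HJ[of R k] by eventually_elim simp
    have m: "(\<lambda>\<omega>. (norm (?J \<omega>))\<^sup>2) \<in> borel_measurable P" "(\<lambda>\<omega>. (norm (R (H k \<omega>)))\<^sup>2) \<in> borel_measurable P" by measurable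
    show "integrable P (\<lambda>\<omega>. (norm (R (H k \<omega>)))\<^sup>2)"
      using integrable_cong_AE[OF m ae] camp(3)[OF st] by blast
    show "(\<integral>\<omega>. (norm (R (H k \<omega>)))\<^sup>2 \<partial>P) = (t - s) * (\<integral>z. (norm (R (g k z)))\<^sup>2 \<partial>\<nu>)"
      using integral_cong_AE[OF m ae] camp(4)[OF st] by simp
  qed
  have Hi: "integrable P (\<lambda>\<omega>. (norm (H k \<omega>))\<^sup>2)" for k using HR(1)[of id_blinfun k] by simp
  have nnlim: "(\<lambda>k. \<integral>\<^sup>+\<omega>. ennreal ((norm (V \<omega> - H k \<omega>))\<^sup>2) \<partial>P) \<longlonglongrightarrow> 0"
  proof (rule tendsto_sandwich[OF _ _ tendsto_const])
    let ?b = "\<lambda>k. 2 * (\<integral>\<^sup>+\<omega>. ennreal ((norm (L t \<omega> - K t k \<omega>))\<^sup>2) \<partial>P) + 2 * (\<integral>\<^sup>+\<omega>. ennreal ((norm (L s \<omega> - K s k \<omega>))\<^sup>2) \<partial>P)"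
    show "?b \<longlonglongrightarrow> 0"
    proof -
      have "?b \<longlonglongrightarrow> 2 * 0 + 2 * 0" using st by (intro tendsto_add ennreal_tendsto_cmult Klim) auto
      then show ?thesis by simp
    qed
    show "\<forall>\<^sub>F k in sequentially. (\<integral>\<^sup>+\<omega>. ennreal ((norm (V \<omega> - H k \<omega>))\<^sup>2) \<partial>P) \<le> ?b k"
    proof (intro always_eventually allI)
      fix k
      have "(\<integral>\<^sup>+\<omega>. ennreal ((norm (V \<omega> - H k \<omega>))\<^sup>2) \<partial>P)
          \<le> (\<integral>\<^sup>+\<omega>. 2 * ennreal ((norm (L t \<omega> - K t k \<omega>))\<^sup>2) + 2 * ennreal ((norm (L s \<omega> - K s k \<omega>))\<^sup>2) \<partial>P)"
      proof (rule nn_integral_mono)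
        fix \<omega>
        have "V \<omega> - H k \<omega> = (L t \<omega> - K t k \<omega>) + - (L s \<omega> - K s k \<omega>)"
          unfolding V_def H_def by simp
        then show "ennreal ((norm (V \<omega> - H k \<omega>))\<^sup>2) \<le> 2 * ennreal ((norm (L t \<omega> - K t k \<omega>))\<^sup>2) + 2 * ennreal ((norm (L s \<omega> - K s k \<omega>))\<^sup>2)"
          using sq_norm_add_le_ennreal[of "L t \<omega> - K t k \<omega>" "- (L s \<omega> - K s k \<omega>)"]
          unfolding norm_minus_cancel by simp
      qed
      also have "\<dots> = ?b k" by (simp add: nn_integral_add nn_integral_cmult)
      finally show "(\<integral>\<^sup>+\<omega>. ennreal ((norm (V \<omega> - H k \<omega>))\<^sup>2) \<partial>P) \<le> ?b k" .
    qed
  qed simp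
  \<comment> \<open>The L2 distance to the square integrable \<open>H k\<close> tends to 0, so it is
    finite for some k; this already forces V to be square integrable.\<close>
  show Vi: "integrable P (\<lambda>\<omega>. (norm (V \<omega>))\<^sup>2)"
  proof -
    have "\<forall>\<^sub>F k in sequentially. (\<integral>\<^sup>+\<omega>. ennreal ((norm (V \<omega> - H k \<omega>))\<^sup>2) \<partial>P) < \<infinity>"
      using order_tendstoD(2)[OF nnlim, of \<infinity>] by simp
    then obtain k where "(\<integral>\<^sup>+\<omega>. ennreal ((norm (V \<omega> - H k \<omega>))\<^sup>2) \<partial>P) < \<infinity>"
      using eventually_happens'[OF sequentially_bot] by blast
    then have "integrable P (\<lambda>\<omega>. (norm (V \<omega> - H k \<omega>))\<^sup>2)" by (intro integrableI_nonneg) auto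
    then have "integrable P (\<lambda>\<omega>. 2 * (norm (V \<omega> - H k \<omega>))\<^sup>2 + 2 * (norm (H k \<omega>))\<^sup>2)" using Hi by auto
    then show ?thesis
    proof (rule Bochner_Integration.integrable_bound)
      have "(norm (V \<omega>))\<^sup>2 \<le> 2 * (norm (V \<omega> - H k \<omega>))\<^sup>2 + 2 * (norm (H k \<omega>))\<^sup>2" for \<omega>
        using sq_norm_add_le[of "V \<omega> - H k \<omega>" "H k \<omega>"] by simp
      then show "AE \<omega> in P. norm ((norm (V \<omega>))\<^sup>2) \<le> norm (2 * (norm (V \<omega> - H k \<omega>))\<^sup>2 + 2 * (norm (H k \<omega>))\<^sup>2)"
        by (intro AE_I2) simp
    qed measurable
  qed
  have di: "integrable P (\<lambda>\<omega>. (norm (V \<omega> - H k \<omega>))\<^sup>2)" for k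
  proof (rule Bochner_Integration.integrable_bound[where f="\<lambda>\<omega>. 2 * (norm (V \<omega>))\<^sup>2 + 2 * (norm (H k \<omega>))\<^sup>2"])
    show "AE \<omega> in P. norm ((norm (V \<omega> - H k \<omega>))\<^sup>2) \<le> norm (2 * (norm (V \<omega>))\<^sup>2 + 2 * (norm (H k \<omega>))\<^sup>2)"
    proof (rule AE_I2)
      fix \<omega>
      show "norm ((norm (V \<omega> - H k \<omega>))\<^sup>2) \<le> norm (2 * (norm (V \<omega>))\<^sup>2 + 2 * (norm (H k \<omega>))\<^sup>2)"
        using sq_norm_add_le[of "V \<omega>" "- H k \<omega>"] by simp
    qed
  qed (use Vi Hi in auto)
  have lim: "(\<lambda>k. \<integral>\<omega>. (norm (V \<omega> - H k \<omega>))\<^sup>2 \<partial>P) \<longlonglongrightarrow> 0"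
  proof -
    have "(\<lambda>k. enn2real (\<integral>\<^sup>+\<omega>. ennreal ((norm (V \<omega> - H k \<omega>))\<^sup>2) \<partial>P)) \<longlonglongrightarrow> 0"
      by (rule tendsto_enn2real) (use nnlim in simp_all)
    then show ?thesis by (subst integral_eq_nn_integral) auto
  qed
  show "(\<integral>\<omega>. V \<omega> \<partial>P) = 0"
  proof -
    \<comment> \<open>\<open>H k\<close> is centred, so V and V - \<open>H k\<close> have the same
      mean, and Jensen bounds its square by the L2 distance, which vanishes in the limit.\<close>
    have "(norm (expectation V))\<^sup>2 \<le> (\<integral>\<omega>. (norm (V \<omega> - H k \<omega>))\<^sup>2 \<partial>P)" for k
    proof -
      have "expectation (\<lambda>\<omega>. V \<omega> - H k \<omega>) = expectation V - expectation (H k)"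
        by (rule Bochner_Integration.integral_diff[OF integrable_of_square_integrable[OF Vm Vi]
              integrable_of_square_integrable[OF Hm Hi]])
      then show ?thesis using square_expectation_le[OF _ di[of k]] H0 by simp
    qed
    then have "(norm (expectation V))\<^sup>2 \<le> 0" by (intro LIMSEQ_le_const[OF lim]) auto
    then show ?thesis by simp
  qed
  note Rbd = norm_blinfun_sq[of R]
  have RV: "integrable P (\<lambda>\<omega>. (norm (R (V \<omega>)))\<^sup>2)" "integrable P (\<lambda>\<omega>. (norm (R (V \<omega> - H k \<omega>)))\<^sup>2)" for k
    by (rule Bochner_Integration.integrable_bound[OF integrable_mult_right[OF Vi, of "(norm R)\<^sup>2"]];
        use Rbd in \<open>auto intro!: AE_I2\<close>)
       (rule Bochner_Integration.integrable_bound[OF integrable_mult_right[OF di[of k], of "(norm R)\<^sup>2"]];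
        use Rbd in \<open>auto intro!: AE_I2\<close>)
  have "(\<lambda>k. \<integral>\<omega>. (norm (R (H k \<omega>)))\<^sup>2 \<partial>P) \<longlonglongrightarrow> (\<integral>\<omega>. (norm (R (V \<omega>)))\<^sup>2 \<partial>P)"
  proof (rule square_norm_tendsto)
    show "(\<lambda>k. \<integral>\<omega>. (norm (R (V \<omega>) - R (H k \<omega>)))\<^sup>2 \<partial>P) \<longlonglongrightarrow> 0"
    proof (rule tendsto_sandwich[OF _ _ tendsto_const])
      show "(\<lambda>k. (norm R)\<^sup>2 * (\<integral>\<omega>. (norm (V \<omega> - H k \<omega>))\<^sup>2 \<partial>P)) \<longlonglongrightarrow> 0"
        by (intro tendsto_mult_right_zero lim)
      show "\<forall>\<^sub>F k in sequentially. (\<integral>\<omega>. (norm (R (V \<omega>) - R (H k \<omega>)))\<^sup>2 \<partial>P) \<le> (norm R)\<^sup>2 * (\<integral>\<omega>. (norm (V \<omega> - H k \<omega>))\<^sup>2 \<partial>P)"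
        using RV(2) di Rbd
        by (intro always_eventually allI, subst integral_mult_right_zero[symmetric], intro integral_mono)
           (auto simp: blinfun.diff_right[symmetric])
    qed simp
  qed (use RV HR in \<open>auto simp: blinfun.diff_right[symmetric]\<close>)
  moreover have "(\<lambda>k. \<integral>\<omega>. (norm (R (H k \<omega>)))\<^sup>2 \<partial>P) \<longlonglongrightarrow> (t - s) * (\<integral>z. (norm (R z))\<^sup>2 \<partial>\<nu>)"
    unfolding HR(2)
  proof (intro tendsto_mult_left integral_dominated_convergence[where w="\<lambda>z. (norm R)\<^sup>2 * (norm z)\<^sup>2"])
    show "AE z in \<nu>. (\<lambda>k. (norm (R (g k z)))\<^sup>2) \<longlonglongrightarrow> (norm (R z))\<^sup>2"
    proof (rule AE_I2)
      fix z
      show "(\<lambda>k. (norm (R (g k z)))\<^sup>2) \<longlonglongrightarrow> (norm (R z))\<^sup>2"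
      proof (cases "z = 0")
        case True then show ?thesis by (simp add: g_def)
      next
        case False
        then have "\<forall>\<^sub>F k in sequentially. \<epsilon> k < norm z"
          using order_tendstoD(2)[OF LIMSEQ_inverse_real_of_nat, of "norm z"] by (simp add: \<epsilon>_def)
        then have "\<forall>\<^sub>F k in sequentially. (norm (R (g k z)))\<^sup>2 = (norm (R z))\<^sup>2"
          by eventually_elim (simp add: g_def)
        then show ?thesis by (rule tendsto_eventually)
      qed
    qed
    show "AE z in \<nu>. norm ((norm (R (g k z)))\<^sup>2) \<le> (norm R)\<^sup>2 * (norm z)\<^sup>2" for k
    proof (rule AE_I2)
      fix z
      have "(norm (R (g k z)))\<^sup>2 \<le> (norm R)\<^sup>2 * (norm (g k z))\<^sup>2" by (rule Rbd)
      also have "\<dots> \<le> (norm R)\<^sup>2 * (norm z)\<^sup>2" by (intro mult_left_mono g2) auto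
      finally show "norm ((norm (R (g k z)))\<^sup>2) \<le> (norm R)\<^sup>2 * (norm z)\<^sup>2" by simp
    qed
  qed (use sq in auto)
  ultimately show "(\<integral>\<omega>. (norm (R (V \<omega>)))\<^sup>2 \<partial>P) = (t - s) * (\<integral>z. (norm (R z))\<^sup>2 \<partial>\<nu>)"
    by (rule LIMSEQ_unique)
qed

section \<open>The isometry for elementary integrands\<close>

text \<open>The interface on which the isometry is built. The jumps have disappeared; what remains
  is adaptedness, the second-order structure of the increments and their independence of the
  past.\<close>

locale levy_driver = prob_space P for P :: "'w measure" +
  fixes \<F> :: "real \<Rightarrow> 'w measure" and \<mu> :: "'a::{real_inner, banach, second_countable_topology} measure"
    and N :: "real \<Rightarrow> 'w \<Rightarrow> 'a"
  assumes filt: "\<And>u. 0 \<le> u \<Longrightarrow> subalgebra P (\<F> u)"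
    and filt_mono: "\<And>u v. 0 \<le> u \<Longrightarrow> u \<le> v \<Longrightarrow> sets (\<F> u) \<subseteq> sets (\<F> v)"
    and adapted: "\<And>u. 0 \<le> u \<Longrightarrow> N u \<in> borel_measurable (\<F> u)"
    and levy: "levy_measure2 \<mu>"
    and inc_sq: "\<And>u v. 0 \<le> u \<Longrightarrow> u \<le> v \<Longrightarrow> integrable P (\<lambda>\<omega>. (norm (N v \<omega> - N u \<omega>))\<^sup>2)"
    and inc_mean: "\<And>u v. 0 \<le> u \<Longrightarrow> u \<le> v \<Longrightarrow> (\<integral>\<omega>. N v \<omega> - N u \<omega> \<partial>P) = 0"
    and inc_var: "\<And>u v (R :: 'a \<Rightarrow>\<^sub>L 'a). 0 \<le> u \<Longrightarrow> u \<le> v \<Longrightarrow>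
      (\<integral>\<omega>. (norm (blinfun_apply R (N v \<omega> - N u \<omega>)))\<^sup>2 \<partial>P) = (v - u) * (\<integral>z. (norm (blinfun_apply R z))\<^sup>2 \<partial>\<mu>)"
    and inc_indep: "\<And>u v. 0 \<le> u \<Longrightarrow> u \<le> v \<Longrightarrow> indep_set (sets (\<F> u))
      (sets (vimage_algebra (space P) (\<lambda>\<omega>. N v \<omega> - N u \<omega>) borel))"
begin

lemma filt_mono_measurable: "f \<in> borel_measurable (\<F> u) \<Longrightarrow> 0 \<le> u \<Longrightarrow> u \<le> v \<Longrightarrow> f \<in> borel_measurable (\<F> v)"
  using filt[of u] filt[of v] filt_mono[of u v] measurable_from_subalg[of "\<F> v" "\<F> u" f borel]
  by (auto simp: subalgebra_def)

lemma filt_measurable: "f \<in> borel_measurable (\<F> u) \<Longrightarrow> 0 \<le> u \<Longrightarrow> f \<in> borel_measurable P"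
  using filt measurable_from_subalg by blast

lemma filt_sets: "E \<in> sets (\<F> u) \<Longrightarrow> 0 \<le> u \<Longrightarrow> E \<in> sets P"
  using filt by (auto simp: subalgebra_def)

lemma increment_adapted: "0 \<le> u \<Longrightarrow> u \<le> v \<Longrightarrow> (\<lambda>\<omega>. N v \<omega> - N u \<omega>) \<in> borel_measurable (\<F> v)"
  using adapted[of v] filt_mono_measurable[OF adapted[of u]] by measurable

lemma increment_measurable: "0 \<le> u \<Longrightarrow> u \<le> v \<Longrightarrow> (\<lambda>\<omega>. N v \<omega> - N u \<omega>) \<in> borel_measurable P"
  using filt_measurable[OF increment_adapted] by auto

text \<open>Independence is given between \<sigma>-algebras; a variable known at time u and a Borel
  image of the later increment generate smaller ones.\<close>

lemma indep_var_increment: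
  assumes Y: "Y \<in> borel_measurable (\<F> u)" and uv: "0 \<le> u" "u \<le> v" and h: "h \<in> borel_measurable borel"
  shows "indep_var borel Y borel (\<lambda>\<omega>. h (N v \<omega> - N u \<omega>))"
  unfolding indep_var_eq
proof (intro conjI)
  show "random_variable borel Y" using filt_measurable[OF Y uv(1)] .
  show "random_variable borel (\<lambda>\<omega>. h (N v \<omega> - N u \<omega>))"
    by (rule measurable_compose[OF increment_measurable[OF uv] h])
  have sp: "space (\<F> u) = space P" using filt[OF uv(1)] by (simp add: subalgebra_def)
  have 1: "sigma_sets (space P) {Y -` A \<inter> space P |A. A \<in> sets borel} \<subseteq> sets (\<F> u)"
    unfolding sp[symmetric] by (rule sets.sigma_sets_subset) (use measurable_sets[OF Y] in auto)
  have 2: "sigma_sets (space P) {(\<lambda>\<omega>. h (N v \<omega> - N u \<omega>)) -` A \<inter> space P |A. A \<in> sets borel}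
      \<subseteq> sigma_sets (space P) {(\<lambda>\<omega>. N v \<omega> - N u \<omega>) -` A \<inter> space P |A. A \<in> sets borel}"
  proof (rule sigma_sets_mono')
    show "{(\<lambda>\<omega>. h (N v \<omega> - N u \<omega>)) -` A \<inter> space P |A. A \<in> sets borel}
        \<subseteq> {(\<lambda>\<omega>. N v \<omega> - N u \<omega>) -` A \<inter> space P |A. A \<in> sets borel}"
    proof clarify
      fix A :: "'b set" assume "A \<in> sets borel"
      then have "h -` A \<in> sets borel" using measurable_sets[OF h, of A] by simp
      then show "\<exists>A'. (\<lambda>\<omega>. h (N v \<omega> - N u \<omega>)) -` A \<inter> space P
          = (\<lambda>\<omega>. N v \<omega> - N u \<omega>) -` A' \<inter> space P \<and> A' \<in> sets borel"
        by (intro exI[of _ "h -` A"]) auto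
    qed
  qed
  show "indep_set (sigma_sets (space P) {Y -` A \<inter> space P |A. A \<in> sets borel})
      (sigma_sets (space P) {(\<lambda>\<omega>. h (N v \<omega> - N u \<omega>)) -` A \<inter> space P |A. A \<in> sets borel})"
    using inc_indep[OF uv] unfolding indep_set_def sets_vimage_algebra
    by (rule indep_sets_mono_sets) (use 1 2 in \<open>auto split: bool.splits\<close>)
qed

lemma blinfun_square_integrable:
  fixes V :: "'w \<Rightarrow> 'a" and R :: "'a \<Rightarrow>\<^sub>L 'a"
  assumes [measurable]: "V \<in> borel_measurable P" and i: "integrable P (\<lambda>\<omega>. (norm (V \<omega>))\<^sup>2)"
    and E [measurable]: "E \<in> sets P"
  shows "integrable P (\<lambda>\<omega>. (norm (indicat_real E \<omega> *\<^sub>R blinfun_apply R (V \<omega>)))\<^sup>2)"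
proof (rule Bochner_Integration.integrable_bound[OF integrable_mult_right[OF i, of "(norm R)\<^sup>2"]])
  show "AE \<omega> in P. norm ((norm (indicat_real E \<omega> *\<^sub>R R (V \<omega>)))\<^sup>2) \<le> norm ((norm R)\<^sup>2 * (norm (V \<omega>))\<^sup>2)"
    using norm_blinfun_sq[of R] by (intro AE_I2) (auto simp: indicator_def)
  show "(\<lambda>\<omega>. (norm (indicat_real E \<omega> *\<^sub>R R (V \<omega>)))\<^sup>2) \<in> borel_measurable P" by measurable
qed

text \<open>The inner product couples two vector-valued variables, so independence is used through
  the joint law: it is a product, and Fubini integrates the centred increment first.\<close>

lemma increment_orthogonal:
  fixes R :: "'a \<Rightarrow>\<^sub>L 'a"
  assumes Y: "Y \<in> borel_measurable (\<F> u)" "integrable P (\<lambda>\<omega>. (norm (Y \<omega>))\<^sup>2)" and uv: "0 \<le> u" "u \<le> v"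
  shows "(\<integral>\<omega>. Y \<omega> \<bullet> blinfun_apply R (N v \<omega> - N u \<omega>) \<partial>P) = 0"
proof -
  let ?W = "\<lambda>\<omega>. N v \<omega> - N u \<omega>"
  have [measurable]: "Y \<in> borel_measurable P" "?W \<in> borel_measurable P"
    using filt_measurable[OF Y(1) uv(1)] increment_measurable[OF uv] by auto
  have RW: "integrable P (\<lambda>\<omega>. (norm (R (?W \<omega>)))\<^sup>2)"
    using blinfun_square_integrable[OF _ inc_sq[OF uv], of "space P" R]
    by (simp cong: Bochner_Integration.integrable_cong)
  have int: "integrable P (\<lambda>\<omega>. Y \<omega> \<bullet> R (?W \<omega>))"
    by (rule integrable_inner_square_integrable[OF _ _ Y(2) RW]) measurable
  have Wi: "integrable P ?W" by (rule integrable_of_square_integrable[OF _ inc_sq[OF uv]]) measurable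
  define D1 where "D1 = distr P borel Y"
  define D2 where "D2 = distr P borel ?W"
  interpret D1: prob_space D1 unfolding D1_def by (rule prob_space_distr) measurable
  interpret D2: prob_space D2 unfolding D2_def by (rule prob_space_distr) measurable
  interpret pair_sigma_finite D1 D2 by unfold_locales
  have [measurable_cong]: "sets D1 = sets borel" "sets D2 = sets borel" unfolding D1_def D2_def by auto
  have eq: "D1 \<Otimes>\<^sub>M D2 = distr P (borel \<Otimes>\<^sub>M borel) (\<lambda>\<omega>. (Y \<omega>, ?W \<omega>))"
    using indep_var_distribution_eq[THEN iffD1, OF indep_var_increment[OF Y(1) uv, of "\<lambda>w. w"]]
    unfolding D1_def D2_def by simp
  have m [measurable]: "(\<lambda>p. fst p \<bullet> R (snd p)) \<in> borel_measurable (borel \<Otimes>\<^sub>M borel)" by measurable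
  have "(\<integral>\<omega>. Y \<omega> \<bullet> R (?W \<omega>) \<partial>P) = (\<integral>p. fst p \<bullet> R (snd p) \<partial>(D1 \<Otimes>\<^sub>M D2))"
    unfolding eq by (subst integral_distr) auto
  also have "\<dots> = (\<integral>y. (\<integral>w. y \<bullet> R w \<partial>D2) \<partial>D1)"
  proof -
    have "integrable (D1 \<Otimes>\<^sub>M D2) (\<lambda>p. fst p \<bullet> R (snd p))"
      unfolding eq using int by (subst integrable_distr_eq) auto
    from integral_fst'[OF this] show ?thesis by simp
  qed
  also have "\<dots> = (\<integral>y. 0 \<partial>D1)"
  proof (intro Bochner_Integration.integral_cong refl)
    fix y
    have "integrable D2 (\<lambda>w. w)" unfolding D2_def using Wi by (subst integrable_distr_eq) auto
    then have "(\<integral>w. y \<bullet> R w \<partial>D2) = y \<bullet> R (\<integral>w. w \<partial>D2)"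
      by (intro integral_bounded_linear[where T="\<lambda>w. y \<bullet> R w"])
         (auto intro!: bounded_linear_intros)
    also have "(\<integral>w. w \<partial>D2) = 0" unfolding D2_def using inc_mean[OF uv] by (subst integral_distr) auto
    finally show "(\<integral>w. y \<bullet> R w \<partial>D2) = 0" by simp
  qed
  finally show ?thesis by simp
qed

text \<open>With Q the covariance operator of \<mu>, this is the Hilbert-Schmidt inner product of R
  Q^(1/2) and R' Q^(1/2).\<close>

definition covar :: "('a \<Rightarrow>\<^sub>L 'a) \<Rightarrow> ('a \<Rightarrow>\<^sub>L 'a) \<Rightarrow> real" where
  "covar R R' = (\<integral>z. R z \<bullet> R' z \<partial>\<mu>)"

lemma sets_\<mu> [measurable_cong]: "sets \<mu> = sets borel"
  using levy unfolding levy_measure2_def by auto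

lemma \<mu>_square_integrable: "integrable \<mu> (\<lambda>z. (norm z)\<^sup>2)"
  using levy unfolding levy_measure2_def by (intro integrableI_nonneg) auto

lemma blinfun_inner_integrable:
  fixes R R' :: "'a \<Rightarrow>\<^sub>L 'a"
  shows "integrable \<mu> (\<lambda>z. blinfun_apply R z \<bullet> blinfun_apply R' z)"
proof (rule Bochner_Integration.integrable_bound[OF integrable_mult_right[OF \<mu>_square_integrable, of "norm R * norm R'"]])
  show "AE z in \<mu>. norm (R z \<bullet> R' z) \<le> norm (norm R * norm R' * (norm z)\<^sup>2)"
  proof (rule AE_I2)
    fix z
    have "\<bar>R z \<bullet> R' z\<bar> \<le> norm (R z) * norm (R' z)" by (rule Cauchy_Schwarz_ineq2)
    also have "\<dots> \<le> (norm R * norm z) * (norm R' * norm z)" by (intro mult_mono norm_blinfun) auto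
    finally show "norm (R z \<bullet> R' z) \<le> norm (norm R * norm R' * (norm z)\<^sup>2)"
      by (simp add: power2_eq_square mult_ac)
  qed
qed measurable

text \<open>Variances are known for single operators, and polarization with R + R' yields the mixed
  covariance. The event belongs to the past, so its probability splits off by independence.\<close>

lemma increment_covariance:
  fixes R R' :: "'a \<Rightarrow>\<^sub>L 'a"
  assumes E: "E \<in> sets (\<F> u)" and uv: "0 \<le> u" "u \<le> v"
  shows "(\<integral>\<omega>. indicat_real E \<omega> * (blinfun_apply R (N v \<omega> - N u \<omega>) \<bullet> blinfun_apply R' (N v \<omega> - N u \<omega>)) \<partial>P)
      = prob E * ((v - u) * covar R R')"
proof -
  let ?W = "\<lambda>\<omega>. N v \<omega> - N u \<omega>"
  have [measurable]: "?W \<in> borel_measurable P" using increment_measurable[OF uv] .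
  have Em [measurable]: "E \<in> sets P" using filt_sets[OF E uv(1)] .
  have RW: "integrable P (\<lambda>\<omega>. (norm (blinfun_apply R (?W \<omega>)))\<^sup>2)" for R :: "'a \<Rightarrow>\<^sub>L 'a"
    using blinfun_square_integrable[OF _ inc_sq[OF uv], of "space P" R]
    by (simp cong: Bochner_Integration.integrable_cong)
  have int: "integrable P (\<lambda>\<omega>. blinfun_apply R (?W \<omega>) \<bullet> blinfun_apply R' (?W \<omega>))" for R R' :: "'a \<Rightarrow>\<^sub>L 'a"
    by (rule integrable_inner_square_integrable[OF _ _ RW RW]) measurable
  have pol: "blinfun_apply R z \<bullet> R' z = ((norm ((R + R') z))\<^sup>2 - (norm (R z))\<^sup>2 - (norm (R' z))\<^sup>2) / 2" for z
    unfolding power2_norm_eq_inner by (simp add: blinfun.add_left inner_add inner_commute)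
  have nz: "integrable \<mu> (\<lambda>z. (norm (blinfun_apply R z))\<^sup>2)" for R :: "'a \<Rightarrow>\<^sub>L 'a"
    using blinfun_inner_integrable[of R R] by (simp add: power2_norm_eq_inner)
  have cov: "(\<integral>\<omega>. R (?W \<omega>) \<bullet> R' (?W \<omega>) \<partial>P) = (v - u) * covar R R'"
    unfolding covar_def pol using RW nz inc_var[OF uv] by (simp add: right_diff_distrib)
  have "indep_var borel (indicat_real E) borel (\<lambda>\<omega>. R (?W \<omega>) \<bullet> R' (?W \<omega>))"
    by (rule indep_var_increment[OF _ uv]) (use E in measurable)
  moreover have "integrable P (indicat_real E)"
    using Em by (intro integrable_real_indicator) (auto simp: less_top[symmetric])
  ultimately
  have "(\<integral>\<omega>. indicat_real E \<omega> * (R (?W \<omega>) \<bullet> R' (?W \<omega>)) \<partial>P)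
      = (\<integral>\<omega>. indicat_real E \<omega> \<partial>P) * (\<integral>\<omega>. R (?W \<omega>) \<bullet> R' (?W \<omega>) \<partial>P)"
    using int by (rule indep_var_lebesgue_integral)
  also have "(\<integral>\<omega>. indicat_real E \<omega> \<partial>P) = prob E" using sets.sets_into_space[OF Em] by (simp add: Int_absorb2)
  finally show ?thesis unfolding cov .
qed

definition entry_integral :: "real \<times> real \<times> 'w set \<times> ('a \<Rightarrow>\<^sub>L 'a) \<Rightarrow> 'w \<Rightarrow> 'a" where
  "entry_integral = (\<lambda>(a, b, E, R) \<omega>. indicat_real E \<omega> *\<^sub>R R (N b \<omega> - N a \<omega>))"

lemma entry_integral_measurable:
  assumes "0 \<le> a" "a \<le> b" "E \<in> sets (\<F> a)" "b \<le> v"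
  shows "entry_integral (a, b, E, R) \<in> borel_measurable (\<F> v)" "entry_integral (a, b, E, R) \<in> borel_measurable P"
    and "integrable P (\<lambda>\<omega>. (norm (entry_integral (a, b, E, R) \<omega>))\<^sup>2)"
proof -
  have [measurable]: "E \<in> sets (\<F> v)" "(\<lambda>\<omega>. N b \<omega> - N a \<omega>) \<in> borel_measurable (\<F> v)"
    using assms filt_mono[of a v] filt_mono_measurable[OF increment_adapted[of a b], of v] by auto
  show m: "entry_integral (a, b, E, R) \<in> borel_measurable (\<F> v)"
    unfolding entry_integral_def prod.case by measurable
  show "entry_integral (a, b, E, R) \<in> borel_measurable P"
    using filt_measurable[OF m] assms by simp
  show "integrable P (\<lambda>\<omega>. (norm (entry_integral (a, b, E, R) \<omega>))\<^sup>2)"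
    unfolding entry_integral_def prod.case using assms
    by (intro blinfun_square_integrable increment_measurable inc_sq filt_sets) auto
qed

text \<open>The intervals are cut at \<open>a'\<close> and at the end of the overlap. Pieces over
  disjoint times are orthogonal, so only the common piece contributes, and there the two events
  intersect.\<close>

lemma entry_covariance_ordered:
  assumes 1: "0 \<le> a" "a \<le> b" "E \<in> sets (\<F> a)" and 2: "a' \<le> b'" "E' \<in> sets (\<F> a')" and le: "a \<le> a'"
  shows "(\<integral>\<omega>. entry_integral (a, b, E, R) \<omega> \<bullet> entry_integral (a', b', E', R') \<omega> \<partial>P)
      = prob (E \<inter> E') * (measure lborel ({a<..b} \<inter> {a'<..b'}) * covar R R')"
proof -
  have a': "0 \<le> a'" using 1 le by simp
  have E: "E \<in> sets (\<F> a')" using filt_mono[OF 1(1) le] 1(3) by auto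
  then have EE: "E \<inter> E' \<in> sets (\<F> a')" using 2 by auto
  have ii: "integrable P (\<lambda>\<omega>. entry_integral (a, b, E, R) \<omega> \<bullet> entry_integral (a', b', E', R') \<omega>)"
    if "0 \<le> a" "a \<le> b" "E \<in> sets (\<F> a)" "0 \<le> a'" "a' \<le> b'" "E' \<in> sets (\<F> a')" for a b E R a' b' E' R'
    using that by (intro integrable_inner_square_integrable entry_integral_measurable) auto
  \<comment> \<open>The earlier integral, multiplied by the indicator of \<open>E'\<close>, is known
    at time \<open>a'\<close> and hence orthogonal to the increment that starts there.\<close>
  have zero: "(\<integral>\<omega>. entry_integral (a, b, E, R) \<omega> \<bullet> entry_integral (a', b', E', R') \<omega> \<partial>P) = 0"
    if "0 \<le> a" "a \<le> b" "E \<in> sets (\<F> a)" "b \<le> a'" "a' \<le> b'" "E' \<in> sets (\<F> a')" for a b E R a' b' E' R'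
  proof -
    have EE: "E \<inter> E' \<in> sets (\<F> a')" using that filt_mono[of a a'] by auto
    have m: "entry_integral (a, b, E, R) \<in> borel_measurable (\<F> a')" using that by (intro entry_integral_measurable) auto
    have [measurable]: "E' \<in> sets (\<F> a')" "entry_integral (a, b, E, R) \<in> borel_measurable (\<F> a')" using that m by auto
    have [measurable]: "E' \<in> sets P" "entry_integral (a, b, E, R) \<in> borel_measurable P"
      using that filt_sets[OF that(6)] filt_measurable[OF m] by auto
    have "(\<integral>\<omega>. (indicat_real E' \<omega> *\<^sub>R entry_integral (a, b, E, R) \<omega>) \<bullet> R' (N b' \<omega> - N a' \<omega>) \<partial>P) = 0"
    proof (rule increment_orthogonal)
      show "(\<lambda>\<omega>. indicat_real E' \<omega> *\<^sub>R entry_integral (a, b, E, R) \<omega>) \<in> borel_measurable (\<F> a')" by measurable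
      show "integrable P (\<lambda>\<omega>. (norm (indicat_real E' \<omega> *\<^sub>R entry_integral (a, b, E, R) \<omega>))\<^sup>2)"
        using that by (intro Bochner_Integration.integrable_bound[OF entry_integral_measurable(3)[of a b E b R]])
           (auto simp: indicator_def)
    qed (use that in auto)
    then show ?thesis by (simp add: entry_integral_def mult_ac)
  qed
  show ?thesis
  proof (cases "b \<le> a'")
    case True
    then have e: "{a<..b} \<inter> {a'<..b'} = {}" by auto
    show ?thesis unfolding zero[OF 1 True 2] e by simp
  next
    case False
    have split: "entry_integral (a, c, E, R) \<omega> = entry_integral (a, b, E, R) \<omega> + entry_integral (b, c, E, R) \<omega>" for a b c E R \<omega>
      unfolding entry_integral_def prod.case scaleR_add_right[symmetric] blinfun.add_right[symmetric] by simp
    define m where "m = min b b'"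
    have m: "a' \<le> m" "m \<le> b" "m \<le> b'" "0 \<le> m" using False 2 a' unfolding m_def by auto
    let ?V = "entry_integral (a', m, E, R)" and ?V' = "entry_integral (a', m, E', R')"
    have "(\<integral>\<omega>. entry_integral (a, b, E, R) \<omega> \<bullet> entry_integral (a', b', E', R') \<omega> \<partial>P)
        = (\<integral>\<omega>. entry_integral (a, a', E, R) \<omega> \<bullet> entry_integral (a', b', E', R') \<omega>
            + entry_integral (a', b, E, R) \<omega> \<bullet> entry_integral (a', b', E', R') \<omega> \<partial>P)"
      by (subst split[of a b E R _ a']) (simp add: inner_add_left)
    also have "\<dots> = (\<integral>\<omega>. entry_integral (a', b, E, R) \<omega> \<bullet> entry_integral (a', b', E', R') \<omega> \<partial>P)"
      using zero[of a a' E a' b' E' R R'] 1 2 le a' E False by (subst Bochner_Integration.integral_add) (auto intro!: ii)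
    also have "\<dots> = (\<integral>\<omega>. ?V \<omega> \<bullet> ?V' \<omega> \<partial>P)"
    proof (cases "b \<le> b'")
      case True
      then have mb: "m = b" by (simp add: m_def)
      \<comment> \<open>After the cut at b the remaining piece starts later; monotonicity of the
        filtration keeps it an admissible entry.\<close>
      have Eb': "E' \<in> sets (\<F> b)" using 2 filt_mono[OF a', of b] False by auto
      have "(\<integral>\<omega>. entry_integral (a', b, E, R) \<omega> \<bullet> entry_integral (a', b', E', R') \<omega> \<partial>P)
        = (\<integral>\<omega>. ?V \<omega> \<bullet> ?V' \<omega> + ?V \<omega> \<bullet> entry_integral (b, b', E', R') \<omega> \<partial>P)"
        unfolding mb by (subst split[of a' b' E' R' _ b]) (simp add: inner_add_right)
      also have "\<dots> = (\<integral>\<omega>. ?V \<omega> \<bullet> ?V' \<omega> \<partial>P)"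
        using zero[of a' b E b b' E' R R'] True 1 2 a' E Eb' False m
        by (subst Bochner_Integration.integral_add) (auto intro!: ii simp: mb)
      finally show ?thesis .
    next
      case False': False
      then have mb: "m = b'" by (simp add: m_def)
      have Eb: "E \<in> sets (\<F> b')" using E filt_mono[OF a' 2(1)] by auto
      have "(\<integral>\<omega>. entry_integral (a', b, E, R) \<omega> \<bullet> entry_integral (a', b', E', R') \<omega> \<partial>P)
        = (\<integral>\<omega>. ?V \<omega> \<bullet> ?V' \<omega> + ?V' \<omega> \<bullet> entry_integral (b', b, E, R) \<omega> \<partial>P)"
        unfolding mb by (subst split[of a' b E R _ b']) (simp add: inner_add_left inner_add_right inner_commute)
      also have "\<dots> = (\<integral>\<omega>. ?V \<omega> \<bullet> ?V' \<omega> \<partial>P)"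
        using zero[of a' b' E' b' b E R' R] False' 1 2 a' E Eb False m
        by (subst Bochner_Integration.integral_add) (auto intro!: ii simp: mb)
      finally show ?thesis .
    qed
    also have "\<dots> = (\<integral>\<omega>. indicat_real (E \<inter> E') \<omega> * (R (N m \<omega> - N a' \<omega>) \<bullet> R' (N m \<omega> - N a' \<omega>)) \<partial>P)"
      unfolding entry_integral_def by (intro Bochner_Integration.integral_cong) (auto simp: indicator_def)
    also have "\<dots> = prob (E \<inter> E') * ((m - a') * covar R R')"
      by (rule increment_covariance[OF EE a' m(1)])
    also have "m - a' = measure lborel ({a<..b} \<inter> {a'<..b'})"
    proof -
      have e: "{a<..b} \<inter> {a'<..b'} = {a'<..m}" using le m_def by auto
      show ?thesis unfolding e using m by simp
    qed
    finally show ?thesis .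
  qed
qed

lemma entry_covariance:
  assumes 1: "0 \<le> a" "a \<le> b" "E \<in> sets (\<F> a)" and 2: "0 \<le> a'" "a' \<le> b'" "E' \<in> sets (\<F> a')"
  shows "(\<integral>\<omega>. entry_integral (a, b, E, R) \<omega> \<bullet> entry_integral (a', b', E', R') \<omega> \<partial>P)
      = prob (E \<inter> E') * (measure lborel ({a<..b} \<inter> {a'<..b'}) * covar R R')"
proof (cases "a \<le> a'")
  case True
  then show ?thesis using entry_covariance_ordered assms by blast
next
  case False
  have "covar R R' = covar R' R" unfolding covar_def by (simp add: inner_commute)
  then show ?thesis
    using entry_covariance_ordered[OF 2 1(2,3), of R' R] False
    by (simp add: inner_commute Int_commute)
qed

text \<open>Entries of a list may overlap, so both sides are expanded into a double sum over pairs
  of entries. The left side is evaluated by \<open>entry_covariance\<close>, the right side by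
  integrating out z, \<tau> and \<omega> in turn; both give \<open>tot\<close>.\<close>

lemma elementary_isometry:
  assumes t: "0 \<le> t" and el: "elementary_on \<F> t s ps"
  shows "elementary_integral N ps \<in> borel_measurable P"
    and "(\<integral>\<^sup>+\<omega>. ennreal ((norm (elementary_integral N ps \<omega>))\<^sup>2) \<partial>P)
      = (\<integral>\<^sup>+\<omega>. (\<integral>\<^sup>+\<tau>\<in>{t<..s}. (\<integral>\<^sup>+z. ennreal ((norm (elementary_val ps \<tau> \<omega> z))\<^sup>2) \<partial>\<mu>) \<partial>lborel) \<partial>P)"
proof -
  define n where "n = length ps"
  define a where "a i = fst (ps ! i)" for i
  define b where "b i = fst (snd (ps ! i))" for i
  define E where "E i = fst (snd (snd (ps ! i)))" for i
  define R where "R i = snd (snd (snd (ps ! i)))" for i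
  have pi: "ps ! i = (a i, b i, E i, R i)" for i unfolding a_def b_def E_def R_def by simp
  have ent: "t \<le> a i" "a i \<le> b i" "b i \<le> s" "E i \<in> sets (\<F> (a i))" "0 \<le> a i" if "i < n" for i
    using el nth_mem[of i ps] that t unfolding elementary_on_def n_def pi by auto
  have EP: "E i \<in> sets P" if "i < n" for i using filt_sets[OF ent(4,5)[OF that]] .
  have I: "elementary_integral N ps \<omega> = (\<Sum>i<n. entry_integral (a i, b i, E i, R i) \<omega>)" for \<omega>
    unfolding elementary_integral_def sum_list_sum_nth entry_integral_def n_def
    by (auto simp: pi atLeast0LessThan intro!: sum.cong)
  have V: "elementary_val ps \<tau> \<omega> = (\<Sum>i<n. indicat_real ({a i<..b i} \<times> E i) (\<tau>, \<omega>) *\<^sub>R R i)" for \<tau> \<omega>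
    unfolding elementary_val_def sum_list_sum_nth n_def
    by (auto simp: pi atLeast0LessThan intro!: sum.cong)
  have em: "entry_integral (a i, b i, E i, R i) \<in> borel_measurable P"
    "integrable P (\<lambda>\<omega>. (norm (entry_integral (a i, b i, E i, R i) \<omega>))\<^sup>2)" if "i < n" for i
    using entry_integral_measurable(2,3)[OF ent(5,2,4)[OF that] order_refl] by auto
  show "elementary_integral N ps \<in> borel_measurable P"
    unfolding I[abs_def] by (intro borel_measurable_sum em) auto
  define C where "C i j = measure lborel ({a i<..b i} \<inter> {a j<..b j}) * covar (R i) (R j)" for i j
  let ?A = "\<lambda>i. {a i<..b i}"
  define tot where "tot = (\<Sum>i<n. \<Sum>j<n. prob (E i \<inter> E j) * C i j)"
  have sqI: "(norm (elementary_integral N ps \<omega>))\<^sup>2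
      = (\<Sum>i<n. \<Sum>j<n. entry_integral (a i, b i, E i, R i) \<omega> \<bullet> entry_integral (a j, b j, E j, R j) \<omega>)" for \<omega>
    unfolding I by (rule norm_sum_sq)
  have ii: "integrable P (\<lambda>\<omega>. entry_integral (a i, b i, E i, R i) \<omega> \<bullet> entry_integral (a j, b j, E j, R j) \<omega>)"
    if "i < n" "j < n" for i j
    by (rule integrable_inner_square_integrable[OF em(1) em(1) em(2) em(2), OF that(1) that(2) that(1) that(2)])
  have iI: "integrable P (\<lambda>\<omega>. (norm (elementary_integral N ps \<omega>))\<^sup>2)"
    unfolding sqI by (rule integral_double_sum(1)[OF ii])
  have "(\<integral>\<omega>. (norm (elementary_integral N ps \<omega>))\<^sup>2 \<partial>P) = (\<Sum>i<n. \<Sum>j<n.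
      (\<integral>\<omega>. entry_integral (a i, b i, E i, R i) \<omega> \<bullet> entry_integral (a j, b j, E j, R j) \<omega> \<partial>P))"
    unfolding sqI by (rule integral_double_sum(2)[OF ii])
  also have "\<dots> = tot"
    unfolding tot_def C_def using ent by (intro sum.cong refl entry_covariance) auto
  finally have L: "(\<integral>\<^sup>+\<omega>. ennreal ((norm (elementary_integral N ps \<omega>))\<^sup>2) \<partial>P) = ennreal tot"
    using nn_integral_eq_integral[OF iI] by simp
  define ind where "ind i j \<tau> \<omega> = indicat_real (E i \<inter> E j) \<omega> * indicat_real (?A i \<inter> ?A j) \<tau>" for i j \<tau> \<omega>
  have sqV: "(norm (elementary_val ps \<tau> \<omega> z))\<^sup>2 = (\<Sum>i<n. \<Sum>j<n. ind i j \<tau> \<omega> * (R i z \<bullet> R j z))" for \<tau> \<omega> z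
  proof -
    have "elementary_val ps \<tau> \<omega> z = (\<Sum>i<n. indicat_real (?A i \<times> E i) (\<tau>, \<omega>) *\<^sub>R R i z)"
      unfolding V by (simp add: blinfun.sum_left blinfun.scaleR_left)
    then have "(norm (elementary_val ps \<tau> \<omega> z))\<^sup>2 = (\<Sum>i<n. \<Sum>j<n.
        (indicat_real (?A i \<times> E i) (\<tau>, \<omega>) *\<^sub>R R i z) \<bullet> (indicat_real (?A j \<times> E j) (\<tau>, \<omega>) *\<^sub>R R j z))"
      by (simp only: norm_sum_sq)
    also have "\<dots> = (\<Sum>i<n. \<Sum>j<n. ind i j \<tau> \<omega> * (R i z \<bullet> R j z))"
      by (intro sum.cong refl) (auto simp: ind_def indicator_def)
    finally show ?thesis .
  qed
  define h1 where "h1 \<tau> \<omega> = (\<Sum>i<n. \<Sum>j<n. ind i j \<tau> \<omega> * covar (R i) (R j))" for \<tau> \<omega>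
  have s1: "integrable \<mu> (\<lambda>z. (norm (elementary_val ps \<tau> \<omega> z))\<^sup>2)"
    "(\<integral>z. (norm (elementary_val ps \<tau> \<omega> z))\<^sup>2 \<partial>\<mu>) = h1 \<tau> \<omega>" for \<tau> \<omega>
    unfolding sqV h1_def covar_def
    using integral_double_sum[of n \<mu> "\<lambda>i j z. ind i j \<tau> \<omega> * (R i z \<bullet> R j z)"] blinfun_inner_integrable
    by simp_all
  have h1: "(\<integral>\<^sup>+z. ennreal ((norm (elementary_val ps \<tau> \<omega> z))\<^sup>2) \<partial>\<mu>) = ennreal (h1 \<tau> \<omega>)" "0 \<le> h1 \<tau> \<omega>" for \<tau> \<omega>
    using nn_integral_eq_integral[OF s1(1)[of \<tau> \<omega>]] integral_nonneg_AE[of "\<lambda>z. (norm (elementary_val ps \<tau> \<omega> z))\<^sup>2" \<mu>]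
    by (auto simp: s1(2))
  define h2 where "h2 \<omega> = (\<Sum>i<n. \<Sum>j<n. indicat_real (E i \<inter> E j) \<omega> * C i j)" for \<omega>
  have fA: "emeasure lborel (?A i \<inter> ?A j) < \<infinity>" if "i < n" for i j
  proof -
    have "emeasure lborel (?A i \<inter> ?A j) \<le> emeasure lborel (?A i)" by (intro emeasure_mono) auto
    also have "\<dots> < \<infinity>" using ent(2)[OF that] by simp
    finally show ?thesis .
  qed
  have il: "integrable lborel (\<lambda>\<tau>. ind i j \<tau> \<omega> * c)" if "i < n" for i j \<omega> c
    unfolding ind_def using fA[OF that, of j] by (intro integrable_mult_left integrable_mult_right integrable_real_indicator) auto
  have s2: "integrable lborel (\<lambda>\<tau>. h1 \<tau> \<omega>)" "(\<integral>\<tau>. h1 \<tau> \<omega> \<partial>lborel) = h2 \<omega>" for \<omega>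
  proof -
    show "integrable lborel (\<lambda>\<tau>. h1 \<tau> \<omega>)"
      unfolding h1_def by (rule integral_double_sum(1)[OF il])
    have "(\<integral>\<tau>. h1 \<tau> \<omega> \<partial>lborel) = (\<Sum>i<n. \<Sum>j<n. (\<integral>\<tau>. ind i j \<tau> \<omega> * covar (R i) (R j) \<partial>lborel))"
      unfolding h1_def by (rule integral_double_sum(2)[OF il])
    also have "\<dots> = h2 \<omega>" unfolding h2_def C_def ind_def
      by (intro sum.cong refl) (simp add: fA)
    finally show "(\<integral>\<tau>. h1 \<tau> \<omega> \<partial>lborel) = h2 \<omega>" .
  qed
  have h2: "(\<integral>\<^sup>+\<tau>. ennreal (h1 \<tau> \<omega>) \<partial>lborel) = ennreal (h2 \<omega>)" "0 \<le> h2 \<omega>" for \<omega>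
    using nn_integral_eq_integral[OF s2(1)[of \<omega>]] integral_nonneg_AE[of "\<lambda>\<tau>. h1 \<tau> \<omega>" lborel] h1(2)
    by (auto simp: s2(2))
  \<comment> \<open>All entries live inside (t,s], so the restriction of the time integral may be
    dropped.\<close>
  have supp: "h1 \<tau> \<omega> = 0" if "\<tau> \<notin> {t<..s}" for \<tau> \<omega>
  proof -
    have "ind i j \<tau> \<omega> = 0" if "i < n" for i j
      using ent(1,3)[OF that] \<open>\<tau> \<notin> {t<..s}\<close> unfolding ind_def by (auto simp: indicator_def)
    then show ?thesis unfolding h1_def by simp
  qed
  have s3: "integrable P h2" "(\<integral>\<omega>. h2 \<omega> \<partial>P) = tot"
  proof -
    have m: "integrable P (\<lambda>\<omega>. indicat_real (E i \<inter> E j) \<omega> * c)" if "i < n" "j < n" for i j c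
      using EP that by (intro integrable_mult_left integrable_real_indicator) (auto simp: less_top[symmetric])
    show "integrable P h2" unfolding h2_def[abs_def] by (rule integral_double_sum(1)[OF m])
    have "(\<integral>\<omega>. h2 \<omega> \<partial>P) = (\<Sum>i<n. \<Sum>j<n. (\<integral>\<omega>. indicat_real (E i \<inter> E j) \<omega> * C i j \<partial>P))"
      unfolding h2_def by (rule integral_double_sum(2)[OF m])
    also have "\<dots> = tot" unfolding tot_def
    proof (intro sum.cong refl)
      fix i j assume "i \<in> {..<n}" "j \<in> {..<n}"
      then have "E i \<inter> E j \<in> sets P" using EP by auto
      then have "E i \<inter> E j \<subseteq> space P" by (rule sets.sets_into_space)
      then show "(\<integral>\<omega>. indicat_real (E i \<inter> E j) \<omega> * C i j \<partial>P) = prob (E i \<inter> E j) * C i j"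
        by (simp add: Int_absorb2)
    qed
    finally show "(\<integral>\<omega>. h2 \<omega> \<partial>P) = tot" .
  qed
  have "(\<integral>\<^sup>+\<omega>. (\<integral>\<^sup>+\<tau>\<in>{t<..s}. (\<integral>\<^sup>+z. ennreal ((norm (elementary_val ps \<tau> \<omega> z))\<^sup>2) \<partial>\<mu>) \<partial>lborel) \<partial>P)
      = (\<integral>\<^sup>+\<omega>. (\<integral>\<^sup>+\<tau>. ennreal (h1 \<tau> \<omega>) \<partial>lborel) \<partial>P)"
    unfolding h1(1) by (intro nn_integral_cong) (auto simp: indicator_def supp)
  also have "\<dots> = ennreal tot"
    unfolding h2(1) using nn_integral_eq_integral[OF s3(1)] h2(2) s3(2) by simp
  finally show "(\<integral>\<^sup>+\<omega>. ennreal ((norm (elementary_integral N ps \<omega>))\<^sup>2) \<partial>P)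
      = (\<integral>\<^sup>+\<omega>. (\<integral>\<^sup>+\<tau>\<in>{t<..s}. (\<integral>\<^sup>+z. ennreal ((norm (elementary_val ps \<tau> \<omega> z))\<^sup>2) \<partial>\<mu>) \<partial>lborel) \<partial>P)"
    unfolding L by simp
qed

end

section \<open>The rescaled driver\<close>

lemma nn_integral_scaled_levy_measure:
  fixes \<nu> :: "'a::{real_inner, banach, second_countable_topology} measure"
  assumes sets: "sets \<nu> = sets borel" and g: "g \<in> borel_measurable borel"
  shows "(\<integral>\<^sup>+z. g z \<partial>scaled_levy_measure n \<nu>) = of_nat n * (\<integral>\<^sup>+z. g ((1 / real n) *\<^sub>R z) \<partial>\<nu>)"
proof -
  note [measurable_cong] = sets and [measurable] = g
  show ?thesis unfolding scaled_levy_measure_def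
    by (subst nn_integral_scale_measure) (auto simp: nn_integral_distr)
qed

text \<open>Jumps are shrunk by n and become n times as frequent, which leaves n / n^2. This is the
  source of the uniformity in n.\<close>

lemma nn_integral_square_scaled:
  fixes \<nu> :: "'a::{real_inner, banach, second_countable_topology} measure" and R :: "'a \<Rightarrow>\<^sub>L 'a"
  assumes sets: "sets \<nu> = sets borel" and n: "1 \<le> n"
  shows "(\<integral>\<^sup>+z. ennreal ((norm (R z))\<^sup>2) \<partial>scaled_levy_measure n \<nu>)
      = ennreal (1 / real n) * (\<integral>\<^sup>+z. ennreal ((norm (R z))\<^sup>2) \<partial>\<nu>)"
proof -
  note [measurable_cong] = sets
  have "(\<integral>\<^sup>+z. ennreal ((norm (R z))\<^sup>2) \<partial>scaled_levy_measure n \<nu>)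
      = of_nat n * (\<integral>\<^sup>+z. ennreal ((norm (R ((1 / real n) *\<^sub>R z)))\<^sup>2) \<partial>\<nu>)"
    by (rule nn_integral_scaled_levy_measure[OF sets]) measurable
  also have "(\<integral>\<^sup>+z. ennreal ((norm (R ((1 / real n) *\<^sub>R z)))\<^sup>2) \<partial>\<nu>)
      = (\<integral>\<^sup>+z. ennreal ((1 / real n)\<^sup>2) * ennreal ((norm (R z))\<^sup>2) \<partial>\<nu>)"
    by (intro nn_integral_cong) (simp add: blinfun.scaleR_right power_divide ennreal_mult[symmetric] power_mult_distrib)
  also have "\<dots> = ennreal ((1 / real n)\<^sup>2) * (\<integral>\<^sup>+z. ennreal ((norm (R z))\<^sup>2) \<partial>\<nu>)"
    by (rule nn_integral_cmult) measurable
  also have "of_nat n * (ennreal ((1 / real n)\<^sup>2) * (\<integral>\<^sup>+z. ennreal ((norm (R z))\<^sup>2) \<partial>\<nu>))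
      = (ennreal (real n) * ennreal ((1 / real n)\<^sup>2)) * (\<integral>\<^sup>+z. ennreal ((norm (R z))\<^sup>2) \<partial>\<nu>)"
    by (simp add: mult.assoc ennreal_of_nat_eq_real_of_nat)
  also have "ennreal (real n) * ennreal ((1 / real n)\<^sup>2) = ennreal (1 / real n)"
    using n by (subst ennreal_mult[symmetric]) (auto simp: power2_eq_square)
  finally show ?thesis .
qed

lemma levy_measure2_scaled:
  fixes \<nu> :: "'a::{real_inner, banach, second_countable_topology} measure"
  assumes lm: "levy_measure2 \<nu>" and n: "1 \<le> n"
  shows "levy_measure2 (scaled_levy_measure n \<nu>)"
proof -
  have sets [measurable_cong]: "sets \<nu> = sets borel" and zero: "emeasure \<nu> {0} = 0"
    and fin: "(\<integral>\<^sup>+z. ennreal ((norm z)\<^sup>2) \<partial>\<nu>) < \<infinity>"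
    using lm unfolding levy_measure2_def by auto
  have sp: "space \<nu> = UNIV" using sets_eq_imp_space_eq[OF sets] by simp
  have "(\<lambda>z::'a. (1 / real n) *\<^sub>R z) -` {0} = {0}" using n by auto
  then have "emeasure (scaled_levy_measure n \<nu>) {0} = 0"
    unfolding scaled_levy_measure_def using zero sp by (simp add: emeasure_distr)
  moreover have "(\<integral>\<^sup>+z. ennreal ((norm z)\<^sup>2) \<partial>scaled_levy_measure n \<nu>) < \<infinity>"
    using nn_integral_square_scaled[OF sets n, of id_blinfun] fin by (simp add: ennreal_mult_less_top)
  ultimately show ?thesis unfolding levy_measure2_def scaled_levy_measure_def by simp
qed

text \<open>Running time at speed n multiplies the variance by n, and the factor 1/n in space
  divides it by n^2, in agreement with \<open>scaled_levy_measure\<close>. Independence persists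
  because the scaled increment is a Borel function of an increment of L.\<close>

lemma scaled_levy_driver:
  fixes L :: "real \<Rightarrow> 'w \<Rightarrow> 'a::{real_inner, banach, second_countable_topology}"
  assumes PS: "prob_space P" and lm: "levy_measure2 \<nu>" and NF: "normal_filtration P \<F>"
    and LM: "levy_martingale P \<F> \<nu> L" and n: "1 \<le> n"
  shows "levy_driver P (scaled_filtration n \<F>) (scaled_levy_measure n \<nu>) (scaled_process n L)"
proof -
  interpret prob_space P by (rule PS)
  have sets [measurable_cong]: "sets \<nu> = sets borel" using lm unfolding levy_measure2_def by auto
  have inc: "scaled_process n L v \<omega> - scaled_process n L u \<omega> = (1 / real n) *\<^sub>R (L (real n * v) \<omega> - L (real n * u) \<omega>)" for u v \<omega>
    unfolding scaled_process_def by (simp add: scaleR_diff_right)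
  have uv: "0 \<le> real n * u" "real n * u \<le> real n * v" if "0 \<le> u" "u \<le> v" for u v
    using that by (auto intro: mult_left_mono)
  note mom = levy_increment_moments[OF PS lm NF LM]
  show ?thesis
  proof unfold_locales
    show "subalgebra P (scaled_filtration n \<F> u)" if "0 \<le> u" for u
      using NF[unfolded normal_filtration_def, THEN conjunct1, rule_format, of "real n * u"] that
      unfolding subalgebra_def scaled_filtration_def by auto
    show "sets (scaled_filtration n \<F> u) \<subseteq> sets (scaled_filtration n \<F> v)" if "0 \<le> u" "u \<le> v" for u v
      using NF[unfolded normal_filtration_def, THEN conjunct2, THEN conjunct1, rule_format, OF uv[OF that]]
      unfolding scaled_filtration_def .
    show "scaled_process n L u \<in> borel_measurable (scaled_filtration n \<F> u)" if "0 \<le> u" for u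
    proof -
      have [measurable]: "L (real n * u) \<in> borel_measurable (\<F> (real n * u))"
        using LM[unfolded levy_martingale_def, THEN conjunct1] that by simp
      show ?thesis unfolding scaled_process_def[abs_def] scaled_filtration_def by measurable
    qed
    show "levy_measure2 (scaled_levy_measure n \<nu>)" by (rule levy_measure2_scaled[OF lm n])
    fix u v :: real assume *: "0 \<le> u" "u \<le> v"
    show "integrable P (\<lambda>\<omega>. (norm (scaled_process n L v \<omega> - scaled_process n L u \<omega>))\<^sup>2)"
      unfolding inc using mom(2)[OF uv[OF *]] by (simp add: power_divide)
    show "(\<integral>\<omega>. scaled_process n L v \<omega> - scaled_process n L u \<omega> \<partial>P) = 0"
      unfolding inc using mom(3)[OF uv[OF *]] by simp
    show "(\<integral>\<omega>. (norm (blinfun_apply R (scaled_process n L v \<omega> - scaled_process n L u \<omega>)))\<^sup>2 \<partial>P)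
        = (v - u) * (\<integral>z. (norm (R z))\<^sup>2 \<partial>scaled_levy_measure n \<nu>)" for R :: "'a \<Rightarrow>\<^sub>L 'a"
    proof -
      have [measurable_cong]: "sets (scaled_levy_measure n \<nu>) = sets borel" unfolding scaled_levy_measure_def by simp
      have "(\<integral>z. (norm (R z))\<^sup>2 \<partial>scaled_levy_measure n \<nu>) = enn2real (\<integral>\<^sup>+z. ennreal ((norm (R z))\<^sup>2) \<partial>scaled_levy_measure n \<nu>)"
        by (rule integral_eq_nn_integral) auto
      also have "\<dots> = (1 / real n) * enn2real (\<integral>\<^sup>+z. ennreal ((norm (R z))\<^sup>2) \<partial>\<nu>)"
        unfolding nn_integral_square_scaled[OF sets n] enn2real_mult by simp
      also have "enn2real (\<integral>\<^sup>+z. ennreal ((norm (R z))\<^sup>2) \<partial>\<nu>) = (\<integral>z. (norm (R z))\<^sup>2 \<partial>\<nu>)"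
        by (rule integral_eq_nn_integral[symmetric]) auto
      finally have e: "(\<integral>z. (norm (R z))\<^sup>2 \<partial>scaled_levy_measure n \<nu>) = (1 / real n) * (\<integral>z. (norm (R z))\<^sup>2 \<partial>\<nu>)" .
      have "(\<integral>\<omega>. (norm (R (scaled_process n L v \<omega> - scaled_process n L u \<omega>)))\<^sup>2 \<partial>P)
          = (\<integral>\<omega>. (1 / real n)\<^sup>2 * (norm (R (L (real n * v) \<omega> - L (real n * u) \<omega>)))\<^sup>2 \<partial>P)"
        unfolding inc by (simp add: blinfun.scaleR_right power_divide)
      also have "\<dots> = (1 / real n)\<^sup>2 * ((real n * v - real n * u) * (\<integral>z. (norm (R z))\<^sup>2 \<partial>\<nu>))"
        using mom(4)[OF uv[OF *], of R] by simp
      also have "\<dots> = (v - u) * ((1 / real n) * (\<integral>z. (norm (R z))\<^sup>2 \<partial>\<nu>))"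
        using n by (simp add: power2_eq_square field_simps)
      finally show ?thesis unfolding e .
    qed
    show "indep_set (sets (scaled_filtration n \<F> u))
        (sets (vimage_algebra (space P) (\<lambda>\<omega>. scaled_process n L v \<omega> - scaled_process n L u \<omega>) borel))"
    proof -
      have "indep_set (sets (\<F> (real n * u)))
          (sets (vimage_algebra (space P) (\<lambda>\<omega>. L (real n * v) \<omega> - L (real n * u) \<omega>) borel))"
        using LM[unfolded levy_martingale_def, THEN conjunct2, THEN conjunct2, THEN conjunct2, THEN conjunct2,
          rule_format, OF uv[OF *]] .
      moreover have "sets (vimage_algebra (space P) (\<lambda>\<omega>. scaled_process n L v \<omega> - scaled_process n L u \<omega>) borel)
          \<subseteq> sets (vimage_algebra (space P) (\<lambda>\<omega>. L (real n * v) \<omega> - L (real n * u) \<omega>) borel)"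
      proof (subst (1 2) sets_vimage_algebra2; clarify?)
        fix A :: "'a set" assume "A \<in> sets borel"
        then have "(\<lambda>z. (1 / real n) *\<^sub>R z) -` A \<in> sets borel"
          using measurable_sets[of "\<lambda>z::'a. (1 / real n) *\<^sub>R z" borel borel A] by simp
        then show "\<exists>A'. (\<lambda>\<omega>. scaled_process n L v \<omega> - scaled_process n L u \<omega>) -` A \<inter> space P
            = (\<lambda>\<omega>. L (real n * v) \<omega> - L (real n * u) \<omega>) -` A' \<inter> space P \<and> A' \<in> sets borel"
          by (intro exI[of _ "(\<lambda>z. (1 / real n) *\<^sub>R z) -` A"]) (auto simp: inc)
      qed auto
      ultimately show ?thesis
        unfolding indep_set_def scaled_filtration_def
        by (elim indep_sets_mono_sets) (auto split: bool.splits)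
    qed
  qed
qed

section \<open>The stochastic integral\<close>

text \<open>Approximating the vector argument by simple functions leaves finite sums over fixed
  vectors, where strong measurability applies; continuity of each operator gives the limit. Joint
  measurability is what allows \<mu> to be integrated out.\<close>

lemma strongly_measurable_joint:
  fixes h :: "'b \<Rightarrow> 'a::{real_normed_vector, second_countable_topology} \<Rightarrow>\<^sub>L 'c::{real_normed_vector, second_countable_topology}"
  assumes h: "\<And>z. (\<lambda>p. h p z) \<in> borel_measurable M"
  shows "(\<lambda>(p, z). h p z) \<in> borel_measurable (M \<Otimes>\<^sub>M borel)"
proof -
  obtain s :: "nat \<Rightarrow> 'a \<Rightarrow> 'a" where s: "\<And>i. simple_function borel (s i)" and lim: "\<And>z. (\<lambda>i. s i z) \<longlonglongrightarrow> z"
    using borel_measurable_implies_sequence_metric[of "\<lambda>z::'a. z" borel 0] by auto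
  have [measurable]: "s i \<in> borel_measurable borel" for i using s by (rule borel_measurable_simple_function)
  have fin: "finite (range (s i))" for i using s[of i] unfolding simple_function_def by auto
  show ?thesis
  proof (rule borel_measurable_LIMSEQ_metric)
    fix i
    have B: "s i -` {y} \<in> sets borel" for y using measurable_sets[of "s i" borel borel "{y}"] by simp
    have "(\<lambda>(p, z). h p (s i z)) = (\<lambda>q. \<Sum>y\<in>range (s i). indicat_real (s i -` {y}) (snd q) *\<^sub>R h (fst q) y)"
    proof (rule ext)
      fix q :: "'b \<times> 'a"
      have "(\<Sum>y\<in>range (s i). indicat_real (s i -` {y}) (snd q) *\<^sub>R h (fst q) y)
          = (\<Sum>y\<in>range (s i). if y = s i (snd q) then h (fst q) y else 0)"
        by (intro sum.cong) (auto simp: indicator_def)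
      also have "\<dots> = h (fst q) (s i (snd q))" using fin by simp
      finally show "(case q of (p, z) \<Rightarrow> h p (s i z)) = (\<Sum>y\<in>range (s i). indicat_real (s i -` {y}) (snd q) *\<^sub>R h (fst q) y)"
        by (simp add: case_prod_beta)
    qed
    moreover have "(\<lambda>q. \<Sum>y\<in>range (s i). indicat_real (s i -` {y}) (snd q) *\<^sub>R h (fst q) y) \<in> borel_measurable (M \<Otimes>\<^sub>M borel)"
    proof (rule borel_measurable_sum)
      fix y
      note [measurable] = h[of y] B[of y]
      show "(\<lambda>q. indicat_real (s i -` {y}) (snd q) *\<^sub>R h (fst q) y) \<in> borel_measurable (M \<Otimes>\<^sub>M borel)"
        by measurable
    qed
    ultimately show "(\<lambda>(p, z). h p (s i z)) \<in> borel_measurable (M \<Otimes>\<^sub>M borel)" by simp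
  next
    fix q assume "q \<in> space (M \<Otimes>\<^sub>M (borel :: 'a measure))"
    show "(\<lambda>i. case q of (p, z) \<Rightarrow> h p (s i z)) \<longlonglongrightarrow> (case q of (p, z) \<Rightarrow> h p z)"
      by (cases q) (auto intro!: tendsto_intros lim)
  qed
qed

lemma predictable_generator_subset:
  fixes t s :: real
  assumes filt: "\<And>u. t \<le> u \<Longrightarrow> sets (\<F> u) \<subseteq> sets P"
  shows "{{a<..b} \<times> E |a b E. t \<le> a \<and> a \<le> b \<and> b \<le> s \<and> E \<in> sets (\<F> a)} \<subseteq> Pow ({t<..s} \<times> space P)"
proof
  fix Y assume "Y \<in> {{a<..b} \<times> E |a b E. t \<le> a \<and> a \<le> b \<and> b \<le> s \<and> E \<in> sets (\<F> a)}"
  then obtain a b E where Y: "Y = {a<..b} \<times> E" "t \<le> a" "b \<le> s" "E \<in> sets (\<F> a)" by auto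
  have "E \<subseteq> space P" using filt[OF Y(2)] Y(4) by (intro sets.sets_into_space) auto
  then show "Y \<in> Pow ({t<..s} \<times> space P)" using Y by auto
qed

text \<open>The predictable \<sigma>-algebra lives on (t,s] x \<Omega>, whereas Tonelli is applied
  on \<Omega> x R. With swapped coordinates the generating rectangles are product sets; the function
  is then extended by zero beyond the strip.\<close>

lemma predictable_measurable_product:
  fixes g :: "real \<times> 'w \<Rightarrow> ennreal"
  assumes filt: "\<And>u. t \<le> u \<Longrightarrow> sets (\<F> u) \<subseteq> sets P"
    and g: "g \<in> borel_measurable (predictable_sigma P \<F> t s)"
  shows "(\<lambda>(\<omega>, \<tau>). g (\<tau>, \<omega>) * indicator {t<..s} \<tau>) \<in> borel_measurable (P \<Otimes>\<^sub>M lborel)"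
proof -
  let ?\<Omega> = "space P \<times> {t<..s}"
  let ?N = "restrict_space (P \<Otimes>\<^sub>M (lborel :: real measure)) ?\<Omega>"
  have O: "?\<Omega> \<inter> space (P \<Otimes>\<^sub>M (lborel :: real measure)) \<in> sets (P \<Otimes>\<^sub>M (lborel :: real measure))" by auto
  have "(\<lambda>(\<omega>, \<tau>). (\<tau>, \<omega>)) \<in> measurable ?N (predictable_sigma P \<F> t s)"
    unfolding predictable_sigma_def
  proof (rule measurable_measure_of)
    show "{{a<..b} \<times> E |a b E. t \<le> a \<and> a \<le> b \<and> b \<le> s \<and> E \<in> sets (\<F> a)} \<subseteq> Pow ({t<..s} \<times> space P)"
      by (rule predictable_generator_subset[OF filt])
    show "(\<lambda>(\<omega>, \<tau>). (\<tau>, \<omega>)) \<in> space ?N \<rightarrow> {t<..s} \<times> space P"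
      by (auto simp: space_restrict_space)
    fix Y assume "Y \<in> {{a<..b} \<times> E |a b E. t \<le> a \<and> a \<le> b \<and> b \<le> s \<and> E \<in> sets (\<F> a)}"
    then obtain a b E where Y: "Y = {a<..b} \<times> E" "t \<le> a" "b \<le> s" "E \<in> sets (\<F> a)" by auto
    have E: "E \<in> sets P" "E \<subseteq> space P" using filt[OF Y(2)] Y(4) sets.sets_into_space by auto
    have "(\<lambda>(\<omega>, \<tau>). (\<tau>, \<omega>)) -` Y \<inter> space ?N = E \<times> {a<..b}"
      using E Y by (auto simp: space_restrict_space space_pair_measure)
    moreover have "E \<times> {a<..b} \<in> sets ?N"
      unfolding sets_restrict_space_iff[OF O] using E Y by auto
    ultimately show "(\<lambda>(\<omega>, \<tau>). (\<tau>, \<omega>)) -` Y \<inter> space ?N \<in> sets ?N" by simp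
  qed
  from measurable_compose[OF this g]
  have "(\<lambda>x. g (case x of (\<omega>, \<tau>) \<Rightarrow> (\<tau>, \<omega>)) * indicator ?\<Omega> x) \<in> borel_measurable (P \<Otimes>\<^sub>M lborel)"
    by (subst (asm) borel_measurable_restrict_space_iff_ennreal[OF O])
  then show ?thesis
    by (rule measurable_cong[THEN iffD1, rotated]) (auto simp: indicator_def space_pair_measure)
qed

section \<open>The energy of an integrand and the norm estimate for the stochastic integral\<close>

context levy_driver
begin

abbreviation "strongly_predictable t s \<Phi> \<equiv>
  (\<forall>z. (\<lambda>(\<tau>, \<omega>). blinfun_apply (\<Phi> \<tau> \<omega>) z) \<in> borel_measurable (predictable_sigma P \<F> t s))"

text \<open>The squared norm that the isometry puts on integrands, kept extended-valued so that it
  can be manipulated before it is known to be finite.\<close>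

definition energy :: "real \<Rightarrow> real \<Rightarrow> (real \<Rightarrow> 'w \<Rightarrow> 'a \<Rightarrow>\<^sub>L 'a) \<Rightarrow> ennreal" where
  "energy t s \<Phi> = (\<integral>\<^sup>+\<omega>. (\<integral>\<^sup>+\<tau>\<in>{t<..s}. (\<integral>\<^sup>+z. ennreal ((norm (\<Phi> \<tau> \<omega> z))\<^sup>2) \<partial>\<mu>) \<partial>lborel) \<partial>P)"

lemma energy_density_measurable:
  fixes \<Phi> :: "real \<Rightarrow> 'w \<Rightarrow> 'a \<Rightarrow>\<^sub>L 'a"
  assumes t: "0 \<le> t" and \<Phi>: "strongly_predictable t s \<Phi>"
  shows "(\<lambda>(\<omega>, \<tau>). (\<integral>\<^sup>+z. ennreal ((norm (\<Phi> \<tau> \<omega> z))\<^sup>2) \<partial>\<mu>) * indicator {t<..s} \<tau>) \<in> borel_measurable (P \<Otimes>\<^sub>M lborel)"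
proof -
  interpret \<mu>: sigma_finite_measure \<mu> by (rule levy_measure2_sigma_finite[OF levy])
  let ?M = "predictable_sigma P \<F> t s"
  define h where "h p = \<Phi> (fst p) (snd p)" for p
  have "(\<lambda>(p, z). h p z) \<in> borel_measurable (?M \<Otimes>\<^sub>M borel)"
    by (rule strongly_measurable_joint[of h ?M]) (use \<Phi> in \<open>simp add: case_prod_unfold h_def\<close>)
  then have [measurable]: "(\<lambda>(p, z). h p z) \<in> borel_measurable (?M \<Otimes>\<^sub>M \<mu>)"
    using measurable_cong_sets[OF sets_pair_measure_cong[OF refl sets_\<mu>] refl] by blast
  have "(\<lambda>(p, z). ennreal ((norm (h p z))\<^sup>2)) \<in> borel_measurable (?M \<Otimes>\<^sub>M \<mu>)" by measurable
  then have "(\<lambda>p. \<integral>\<^sup>+z. ennreal ((norm (h p z))\<^sup>2) \<partial>\<mu>) \<in> borel_measurable ?M"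
    by (rule \<mu>.borel_measurable_nn_integral)
  from predictable_measurable_product[OF _ this] show ?thesis
    using filt t unfolding subalgebra_def h_def by simp
qed

text \<open>A quadratic substitute for the triangle inequality; the factor 2 only affects
  constants.\<close>

lemma energy_add_le:
  fixes \<Phi> \<Psi> :: "real \<Rightarrow> 'w \<Rightarrow> 'a \<Rightarrow>\<^sub>L 'a"
  assumes t: "0 \<le> t" and \<Phi>: "strongly_predictable t s \<Phi>" and \<Psi>: "strongly_predictable t s \<Psi>"
    and le: "\<And>\<tau> \<omega>. \<Theta> \<tau> \<omega> = \<Phi> \<tau> \<omega> + \<Psi> \<tau> \<omega>"
  shows "energy t s \<Theta> \<le> 2 * energy t s \<Phi> + 2 * energy t s \<Psi>"
proof -
  define f where "f \<Phi> \<omega> \<tau> = (\<integral>\<^sup>+z. ennreal ((norm (blinfun_apply (\<Phi> \<tau> \<omega>) z))\<^sup>2) \<partial>\<mu>) * indicator {t<..s} \<tau>"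
    for \<Phi> :: "real \<Rightarrow> 'w \<Rightarrow> 'a \<Rightarrow>\<^sub>L 'a" and \<omega> \<tau>
  have f: "energy t s \<Phi> = (\<integral>\<^sup>+\<omega>. (\<integral>\<^sup>+\<tau>. f \<Phi> \<omega> \<tau> \<partial>lborel) \<partial>P)" for \<Phi> unfolding energy_def f_def ..
  have [measurable]: "(\<lambda>(\<omega>, \<tau>). f \<Phi> \<omega> \<tau>) \<in> borel_measurable (P \<Otimes>\<^sub>M lborel)"
    "(\<lambda>(\<omega>, \<tau>). f \<Psi> \<omega> \<tau>) \<in> borel_measurable (P \<Otimes>\<^sub>M lborel)"
    unfolding f_def using energy_density_measurable[OF t] \<Phi> \<Psi> by auto
  have "f \<Theta> \<omega> \<tau> \<le> 2 * f \<Phi> \<omega> \<tau> + 2 * f \<Psi> \<omega> \<tau>" for \<omega> \<tau>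
  proof -
    have "(\<integral>\<^sup>+z. ennreal ((norm (\<Theta> \<tau> \<omega> z))\<^sup>2) \<partial>\<mu>)
        \<le> (\<integral>\<^sup>+z. 2 * ennreal ((norm (\<Phi> \<tau> \<omega> z))\<^sup>2) + 2 * ennreal ((norm (\<Psi> \<tau> \<omega> z))\<^sup>2) \<partial>\<mu>)"
      unfolding le blinfun.add_left by (intro nn_integral_mono sq_norm_add_le_ennreal)
    also have "\<dots> = 2 * (\<integral>\<^sup>+z. ennreal ((norm (\<Phi> \<tau> \<omega> z))\<^sup>2) \<partial>\<mu>) + 2 * (\<integral>\<^sup>+z. ennreal ((norm (\<Psi> \<tau> \<omega> z))\<^sup>2) \<partial>\<mu>)"
      by (simp add: nn_integral_add nn_integral_cmult)
    finally show ?thesis unfolding f_def by (auto simp: indicator_def)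
  qed
  then have "energy t s \<Theta> \<le> (\<integral>\<^sup>+\<omega>. (\<integral>\<^sup>+\<tau>. 2 * f \<Phi> \<omega> \<tau> + 2 * f \<Psi> \<omega> \<tau> \<partial>lborel) \<partial>P)"
    unfolding f by (intro nn_integral_mono)
  also have "\<dots> = (\<integral>\<^sup>+\<omega>. 2 * (\<integral>\<^sup>+\<tau>. f \<Phi> \<omega> \<tau> \<partial>lborel) + 2 * (\<integral>\<^sup>+\<tau>. f \<Psi> \<omega> \<tau> \<partial>lborel) \<partial>P)"
    by (intro nn_integral_cong) (simp add: nn_integral_add nn_integral_cmult)
  also have "\<dots> = 2 * energy t s \<Phi> + 2 * energy t s \<Psi>"
    unfolding f by (simp add: nn_integral_add nn_integral_cmult)
  finally show ?thesis .
qed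

lemma strongly_predictable_elementary:
  fixes ps :: "('w, 'a) elementary"
  assumes t: "0 \<le> t" and el: "elementary_on \<F> t s ps"
  shows "strongly_predictable t s (elementary_val ps)"
proof (intro allI)
  fix z
  have gen: "{{a<..b} \<times> E |a b E. t \<le> a \<and> a \<le> b \<and> b \<le> s \<and> E \<in> sets (\<F> a)} \<subseteq> Pow ({t<..s} \<times> space P)"
    by (rule predictable_generator_subset) (use filt t in \<open>auto simp: subalgebra_def\<close>)
  show "(\<lambda>(\<tau>, \<omega>). elementary_val ps \<tau> \<omega> z) \<in> borel_measurable (predictable_sigma P \<F> t s)"
    using el
  proof (induction ps)
    case Nil
    then show ?case by (simp add: elementary_val_def case_prod_beta)
  next
    case (Cons e ps)
    obtain a b E R where e: "e = (a, b, E, R)" by (cases e)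
    have el: "t \<le> a" "a \<le> b" "b \<le> s" "E \<in> sets (\<F> a)" "elementary_on \<F> t s ps"
      using Cons.prems unfolding elementary_on_def e by auto
    have [measurable]: "{a<..b} \<times> E \<in> sets (predictable_sigma P \<F> t s)"
      unfolding predictable_sigma_def sets_measure_of[OF gen] using el by (intro sigma_sets.Basic) auto
    have [measurable]: "(\<lambda>p. case p of (\<tau>, \<omega>) \<Rightarrow> elementary_val ps \<tau> \<omega> z) \<in> borel_measurable (predictable_sigma P \<F> t s)"
      by (rule Cons.IH[OF el(5)])
    have "(\<lambda>(\<tau>, \<omega>). elementary_val (e # ps) \<tau> \<omega> z)
        = (\<lambda>p. indicat_real ({a<..b} \<times> E) p *\<^sub>R R z + (case p of (\<tau>, \<omega>) \<Rightarrow> elementary_val ps \<tau> \<omega> z))"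
      by (auto simp: elementary_val_def e blinfun.add_left blinfun.scaleR_left)
    moreover have "(\<lambda>p. indicat_real ({a<..b} \<times> E) p *\<^sub>R R z + (case p of (\<tau>, \<omega>) \<Rightarrow> elementary_val ps \<tau> \<omega> z))
        \<in> borel_measurable (predictable_sigma P \<F> t s)" by measurable
    ultimately show ?case by simp
  qed
qed

text \<open>The inequality |u + v|^2 <= 2 |u|^2 + 2 |v|^2 is used twice, for Z against the
  elementary integrals and for the elementary integrands against \<Phi>. Hence the constant 4 in
  place of an equality; both errors vanish along the approximating sequence.\<close>

lemma has_stoch_integral_norm_le:
  assumes t: "0 \<le> t" and Z: "has_stoch_integral P \<F> \<mu> N t s \<Phi> Z"
  shows "(\<integral>\<^sup>+\<omega>. ennreal ((norm (Z \<omega>))\<^sup>2) \<partial>P) \<le> 4 * energy t s \<Phi>"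
proof -
  obtain ps where \<Phi>: "strongly_predictable t s \<Phi>" and Zm [measurable]: "Z \<in> borel_measurable P"
    and el: "\<And>k. elementary_on \<F> t s (ps k)"
    and l1: "(\<lambda>k. energy t s (\<lambda>\<tau> \<omega>. \<Phi> \<tau> \<omega> - elementary_val (ps k) \<tau> \<omega>)) \<longlonglongrightarrow> 0"
    and l2: "(\<lambda>k. \<integral>\<^sup>+\<omega>. ennreal ((norm (Z \<omega> - elementary_integral N (ps k) \<omega>))\<^sup>2) \<partial>P) \<longlonglongrightarrow> 0"
    using Z unfolding has_stoch_integral_def energy_def by auto
  define D where "D k = energy t s (\<lambda>\<tau> \<omega>. \<Phi> \<tau> \<omega> - elementary_val (ps k) \<tau> \<omega>)" for k
  define D' where "D' k = energy t s (\<lambda>\<tau> \<omega>. elementary_val (ps k) \<tau> \<omega> - \<Phi> \<tau> \<omega>)" for k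
  have DD: "D' k = D k" for k
    unfolding D_def D'_def energy_def by (simp add: blinfun.diff_left norm_minus_commute)
  define Q where "Q k = (\<integral>\<^sup>+\<omega>. ennreal ((norm (Z \<omega> - elementary_integral N (ps k) \<omega>))\<^sup>2) \<partial>P)" for k
  have "(\<integral>\<^sup>+\<omega>. ennreal ((norm (Z \<omega>))\<^sup>2) \<partial>P) \<le> 2 * Q k + (4 * D k + 4 * energy t s \<Phi>)" for k
  proof -
    note iso = elementary_isometry[OF t el[of k]]
    have [measurable]: "elementary_integral N (ps k) \<in> borel_measurable P" by (rule iso(1))
    have "(\<integral>\<^sup>+\<omega>. ennreal ((norm (Z \<omega>))\<^sup>2) \<partial>P)
        \<le> (\<integral>\<^sup>+\<omega>. 2 * ennreal ((norm (Z \<omega> - elementary_integral N (ps k) \<omega>))\<^sup>2) + 2 * ennreal ((norm (elementary_integral N (ps k) \<omega>))\<^sup>2) \<partial>P)"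
    proof (rule nn_integral_mono)
      fix \<omega>
      show "ennreal ((norm (Z \<omega>))\<^sup>2) \<le> 2 * ennreal ((norm (Z \<omega> - elementary_integral N (ps k) \<omega>))\<^sup>2) + 2 * ennreal ((norm (elementary_integral N (ps k) \<omega>))\<^sup>2)"
        using sq_norm_add_le_ennreal[of "Z \<omega> - elementary_integral N (ps k) \<omega>" "elementary_integral N (ps k) \<omega>"] by simp
    qed
    also have "\<dots> = 2 * Q k + 2 * energy t s (elementary_val (ps k))"
      unfolding Q_def energy_def iso(2)[symmetric] by (simp add: nn_integral_add nn_integral_cmult)
    also have "energy t s (elementary_val (ps k)) \<le> 2 * D' k + 2 * energy t s \<Phi>"
      unfolding D'_def
    proof (rule energy_add_le[OF t _ \<Phi>])
      show "strongly_predictable t s (\<lambda>\<tau> \<omega>. elementary_val (ps k) \<tau> \<omega> - \<Phi> \<tau> \<omega>)"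
      proof
        fix z
        have [measurable]: "(\<lambda>p. case p of (\<tau>, \<omega>) \<Rightarrow> elementary_val (ps k) \<tau> \<omega> z) \<in> borel_measurable (predictable_sigma P \<F> t s)"
          "(\<lambda>p. case p of (\<tau>, \<omega>) \<Rightarrow> \<Phi> \<tau> \<omega> z) \<in> borel_measurable (predictable_sigma P \<F> t s)"
          using strongly_predictable_elementary[OF t el[of k]] \<Phi> by auto
        have "(\<lambda>p. (case p of (\<tau>, \<omega>) \<Rightarrow> elementary_val (ps k) \<tau> \<omega> z) - (case p of (\<tau>, \<omega>) \<Rightarrow> \<Phi> \<tau> \<omega> z)) \<in> borel_measurable (predictable_sigma P \<F> t s)"
          by measurable
        then show "(\<lambda>(\<tau>, \<omega>). (elementary_val (ps k) \<tau> \<omega> - \<Phi> \<tau> \<omega>) z) \<in> borel_measurable (predictable_sigma P \<F> t s)"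
          by (simp add: blinfun.diff_left case_prod_unfold)
      qed
    qed simp
    finally show ?thesis unfolding DD by (simp add: distrib_left mult.assoc[symmetric] add_mono mult_left_mono)
  qed
  moreover have "(\<lambda>k. 2 * Q k + (4 * D k + 4 * energy t s \<Phi>)) \<longlonglongrightarrow> 2 * 0 + (4 * 0 + 4 * energy t s \<Phi>)"
    by (intro tendsto_add tendsto_const ennreal_tendsto_cmult) (use l1 l2 in \<open>auto simp: D_def[abs_def] Q_def[abs_def]\<close>)
  ultimately have "(\<integral>\<^sup>+\<omega>. ennreal ((norm (Z \<omega>))\<^sup>2) \<partial>P) \<le> 2 * 0 + (4 * 0 + 4 * energy t s \<Phi>)"
    by (intro LIMSEQ_le_const) auto
  then show ?thesis by simp
qed

end

context levy_driver
begin

text \<open>Comparing two solutions requires their stochastic convolutions to be subtracted under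
  one integral. The approximants of the difference are the lists of the first integrand followed by
  those of the second with negated operators.\<close>

lemma has_stoch_integral_diff:
  fixes \<Phi> \<Psi> :: "real \<Rightarrow> 'w \<Rightarrow> 'a \<Rightarrow>\<^sub>L 'a"
  assumes t: "0 \<le> t" and Z: "has_stoch_integral P \<F> \<mu> N t s \<Phi> Z" and W: "has_stoch_integral P \<F> \<mu> N t s \<Psi> W"
  shows "has_stoch_integral P \<F> \<mu> N t s (\<lambda>\<tau> \<omega>. \<Phi> \<tau> \<omega> - \<Psi> \<tau> \<omega>) (\<lambda>\<omega>. Z \<omega> - W \<omega>)"
proof -
  let ?M = "predictable_sigma P \<F> t s"
  obtain ps where \<Phi>: "strongly_predictable t s \<Phi>" and Zm [measurable]: "Z \<in> borel_measurable P"
    and el: "\<And>k. elementary_on \<F> t s (ps k)"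
    and l1: "(\<lambda>k. energy t s (\<lambda>\<tau> \<omega>. \<Phi> \<tau> \<omega> - elementary_val (ps k) \<tau> \<omega>)) \<longlonglongrightarrow> 0"
    and l2: "(\<lambda>k. \<integral>\<^sup>+\<omega>. ennreal ((norm (Z \<omega> - elementary_integral N (ps k) \<omega>))\<^sup>2) \<partial>P) \<longlonglongrightarrow> 0"
    using Z unfolding has_stoch_integral_def energy_def by auto
  obtain qs where \<Psi>: "strongly_predictable t s \<Psi>" and Wm [measurable]: "W \<in> borel_measurable P"
    and el': "\<And>k. elementary_on \<F> t s (qs k)"
    and l1': "(\<lambda>k. energy t s (\<lambda>\<tau> \<omega>. \<Psi> \<tau> \<omega> - elementary_val (qs k) \<tau> \<omega>)) \<longlonglongrightarrow> 0"
    and l2': "(\<lambda>k. \<integral>\<^sup>+\<omega>. ennreal ((norm (W \<omega> - elementary_integral N (qs k) \<omega>))\<^sup>2) \<partial>P) \<longlonglongrightarrow> 0"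
    using W unfolding has_stoch_integral_def energy_def by auto
  define neg :: "('w, 'a) elementary \<Rightarrow> ('w, 'a) elementary" where "neg = map (\<lambda>(a, b, E, R). (a, b, E, - R))"
  have nv: "elementary_val (neg q) \<tau> \<omega> = - elementary_val q \<tau> \<omega>" for q \<tau> \<omega>
    by (induction q) (auto simp: neg_def elementary_val_def)
  have ni: "elementary_integral N (neg q) \<omega> = - elementary_integral N q \<omega>" for q \<omega>
    by (induction q) (auto simp: neg_def elementary_integral_def blinfun.minus_left)
  define rs where "rs k = ps k @ neg (qs k)" for k
  have rv: "elementary_val (rs k) \<tau> \<omega> = elementary_val (ps k) \<tau> \<omega> - elementary_val (qs k) \<tau> \<omega>" for k \<tau> \<omega>
    using nv[of "qs k"] unfolding rs_def by (simp add: elementary_val_def)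
  have ri: "elementary_integral N (rs k) \<omega> = elementary_integral N (ps k) \<omega> - elementary_integral N (qs k) \<omega>" for k \<omega>
    using ni[of "qs k"] unfolding rs_def by (simp add: elementary_integral_def)
  have elr: "elementary_on \<F> t s (rs k)" for k
    using el[of k] el'[of k] unfolding rs_def elementary_on_def neg_def by fastforce
  have spd: "strongly_predictable t s (\<lambda>\<tau> \<omega>. A \<tau> \<omega> - B \<tau> \<omega>)"
    if A: "strongly_predictable t s A" and B: "strongly_predictable t s B" for A B :: "real \<Rightarrow> 'w \<Rightarrow> 'a \<Rightarrow>\<^sub>L 'a"
  proof
    fix z
    have "(\<lambda>p. (case p of (\<tau>, \<omega>) \<Rightarrow> A \<tau> \<omega> z) - (case p of (\<tau>, \<omega>) \<Rightarrow> B \<tau> \<omega> z)) \<in> borel_measurable ?M"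
      using A B by (intro borel_measurable_diff) auto
    then show "(\<lambda>(\<tau>, \<omega>). (A \<tau> \<omega> - B \<tau> \<omega>) z) \<in> borel_measurable ?M"
      by (simp add: blinfun.diff_left case_prod_unfold)
  qed
  have sym: "energy t s (\<lambda>\<tau> \<omega>. A \<tau> \<omega> - B \<tau> \<omega>) = energy t s (\<lambda>\<tau> \<omega>. B \<tau> \<omega> - A \<tau> \<omega>)" for A B
    unfolding energy_def by (simp add: blinfun.diff_left norm_minus_commute)
  have lim0: "(\<lambda>k. 2 * f k + 2 * g k) \<longlonglongrightarrow> 0" if "f \<longlonglongrightarrow> 0" "g \<longlonglongrightarrow> 0" for f g :: "nat \<Rightarrow> ennreal"
  proof -
    have "(\<lambda>k. 2 * f k + 2 * g k) \<longlonglongrightarrow> 2 * 0 + 2 * 0"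
      by (intro tendsto_add ennreal_tendsto_cmult that) auto
    then show ?thesis by simp
  qed
  have "(\<lambda>k. energy t s (\<lambda>\<tau> \<omega>. \<Phi> \<tau> \<omega> - \<Psi> \<tau> \<omega> - elementary_val (rs k) \<tau> \<omega>)) \<longlonglongrightarrow> 0"
  proof (rule tendsto_sandwich[OF _ _ tendsto_const lim0[OF l1 l1']])
    show "\<forall>\<^sub>F k in sequentially. energy t s (\<lambda>\<tau> \<omega>. \<Phi> \<tau> \<omega> - \<Psi> \<tau> \<omega> - elementary_val (rs k) \<tau> \<omega>)
      \<le> 2 * energy t s (\<lambda>\<tau> \<omega>. \<Phi> \<tau> \<omega> - elementary_val (ps k) \<tau> \<omega>) + 2 * energy t s (\<lambda>\<tau> \<omega>. \<Psi> \<tau> \<omega> - elementary_val (qs k) \<tau> \<omega>)"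
    proof (intro always_eventually allI)
      fix k
      show "energy t s (\<lambda>\<tau> \<omega>. \<Phi> \<tau> \<omega> - \<Psi> \<tau> \<omega> - elementary_val (rs k) \<tau> \<omega>)
        \<le> 2 * energy t s (\<lambda>\<tau> \<omega>. \<Phi> \<tau> \<omega> - elementary_val (ps k) \<tau> \<omega>) + 2 * energy t s (\<lambda>\<tau> \<omega>. \<Psi> \<tau> \<omega> - elementary_val (qs k) \<tau> \<omega>)"
        unfolding sym[of \<Psi>]
        by (rule energy_add_le[OF t spd[OF \<Phi> strongly_predictable_elementary[OF t el]]
              spd[OF strongly_predictable_elementary[OF t el'] \<Psi>]]) (simp add: rv)
    qed
  qed simp
  moreover have "(\<lambda>k. \<integral>\<^sup>+\<omega>. ennreal ((norm (Z \<omega> - W \<omega> - elementary_integral N (rs k) \<omega>))\<^sup>2) \<partial>P) \<longlonglongrightarrow> 0"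
  proof (rule tendsto_sandwich[OF _ _ tendsto_const lim0[OF l2 l2']])
    show "\<forall>\<^sub>F k in sequentially. (\<integral>\<^sup>+\<omega>. ennreal ((norm (Z \<omega> - W \<omega> - elementary_integral N (rs k) \<omega>))\<^sup>2) \<partial>P)
      \<le> 2 * (\<integral>\<^sup>+\<omega>. ennreal ((norm (Z \<omega> - elementary_integral N (ps k) \<omega>))\<^sup>2) \<partial>P)
        + 2 * (\<integral>\<^sup>+\<omega>. ennreal ((norm (W \<omega> - elementary_integral N (qs k) \<omega>))\<^sup>2) \<partial>P)"
    proof (intro always_eventually allI)
      fix k
      have [measurable]: "elementary_integral N (ps k) \<in> borel_measurable P" "elementary_integral N (qs k) \<in> borel_measurable P"
        by (rule elementary_isometry(1)[OF t el], rule elementary_isometry(1)[OF t el'])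
      have "(\<integral>\<^sup>+\<omega>. ennreal ((norm (Z \<omega> - W \<omega> - elementary_integral N (rs k) \<omega>))\<^sup>2) \<partial>P)
        \<le> (\<integral>\<^sup>+\<omega>. 2 * ennreal ((norm (Z \<omega> - elementary_integral N (ps k) \<omega>))\<^sup>2)
            + 2 * ennreal ((norm (W \<omega> - elementary_integral N (qs k) \<omega>))\<^sup>2) \<partial>P)"
      proof (rule nn_integral_mono)
        fix \<omega>
        have e: "Z \<omega> - W \<omega> - elementary_integral N (rs k) \<omega>
            = (Z \<omega> - elementary_integral N (ps k) \<omega>) + - (W \<omega> - elementary_integral N (qs k) \<omega>)"
          by (simp add: ri)
        show "ennreal ((norm (Z \<omega> - W \<omega> - elementary_integral N (rs k) \<omega>))\<^sup>2)
          \<le> 2 * ennreal ((norm (Z \<omega> - elementary_integral N (ps k) \<omega>))\<^sup>2)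
            + 2 * ennreal ((norm (W \<omega> - elementary_integral N (qs k) \<omega>))\<^sup>2)"
          unfolding e using sq_norm_add_le_ennreal[of "Z \<omega> - elementary_integral N (ps k) \<omega>" "- (W \<omega> - elementary_integral N (qs k) \<omega>)"]
          by (simp only: norm_minus_cancel)
      qed
      then show "(\<integral>\<^sup>+\<omega>. ennreal ((norm (Z \<omega> - W \<omega> - elementary_integral N (rs k) \<omega>))\<^sup>2) \<partial>P)
      \<le> 2 * (\<integral>\<^sup>+\<omega>. ennreal ((norm (Z \<omega> - elementary_integral N (ps k) \<omega>))\<^sup>2) \<partial>P)
        + 2 * (\<integral>\<^sup>+\<omega>. ennreal ((norm (W \<omega> - elementary_integral N (qs k) \<omega>))\<^sup>2) \<partial>P)"
        by (simp add: nn_integral_add nn_integral_cmult)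
    qed
  qed simp
  ultimately show ?thesis
    unfolding has_stoch_integral_def energy_def[symmetric]
    using spd[OF \<Phi> \<Psi>] elr by (intro conjI exI[of _ rs]) (auto simp: energy_def)
qed

end

section \<open>Right-continuous paths with left limits\<close>

lemma cadlag_on_right:
  fixes f :: "real \<Rightarrow> 'a::metric_space"
  assumes "cadlag_on I f" "c \<in> I" "0 < e"
  obtains d where "0 < d" "\<And>r. r \<in> I \<Longrightarrow> c \<le> r \<Longrightarrow> r < c + d \<Longrightarrow> dist (f r) (f c) < e"
proof -
  have "(f \<longlongrightarrow> f c) (at c within I \<inter> {c<..})" using assms unfolding cadlag_on_def by auto
  then have "\<forall>\<^sub>F r in at c within I \<inter> {c<..}. dist (f r) (f c) < e" using assms(3) by (rule tendstoD)
  then obtain d where d: "0 < d" "\<forall>r\<in>I \<inter> {c<..}. r \<noteq> c \<and> dist r c < d \<longrightarrow> dist (f r) (f c) < e"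
    unfolding eventually_at by auto
  have "dist (f r) (f c) < e" if "r \<in> I" "c \<le> r" "r < c + d" for r
  proof (cases "r = c")
    case True then show ?thesis using assms(3) by simp
  next
    case False
    then have "r \<in> I \<inter> {c<..}" "dist r c < d" using that by (auto simp: dist_real_def)
    then show ?thesis using d(2) False by blast
  qed
  with d(1) show ?thesis by (rule that)
qed

lemma cadlag_on_left:
  fixes f :: "real \<Rightarrow> 'a::metric_space"
  assumes "cadlag_on I f" "c \<in> I"
  obtains l where "\<And>e. 0 < e \<Longrightarrow> \<exists>d>0. \<forall>r\<in>I. r < c \<and> c - d < r \<longrightarrow> dist (f r) l < e"
    "(f \<longlongrightarrow> l) (at c within I \<inter> {..<c})"
proof -
  obtain l where l: "(f \<longlongrightarrow> l) (at c within I \<inter> {..<c})" using assms unfolding cadlag_on_def by auto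
  have "\<exists>d>0. \<forall>r\<in>I. r < c \<and> c - d < r \<longrightarrow> dist (f r) l < e" if "0 < e" for e
  proof -
    have "\<forall>\<^sub>F r in at c within I \<inter> {..<c}. dist (f r) l < e" using l that by (rule tendstoD)
    then obtain d where d: "0 < d" "\<forall>r\<in>I \<inter> {..<c}. r \<noteq> c \<and> dist r c < d \<longrightarrow> dist (f r) l < e"
      unfolding eventually_at by auto
    show ?thesis
    proof (intro exI[of _ d] conjI ballI impI d(1))
      fix r assume "r \<in> I" "r < c \<and> c - d < r"
      then have "r \<in> I \<inter> {..<c}" "r \<noteq> c" "dist r c < d" by (auto simp: dist_real_def)
      then show "dist (f r) l < e" using d(2) by blast
    qed
  qed
  with l show ?thesis using that by blast
qed

text \<open>Near each point the path is bounded, to the right through its value and to the left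
  through its left limit; compactness patches these bounds together.\<close>

lemma cadlag_on_bounded:
  fixes f :: "real \<Rightarrow> 'a::real_normed_vector"
  assumes cad: "cadlag_on {t..T} f"
  shows "\<exists>m. \<forall>s\<in>{t..T}. norm (f s) \<le> m"
proof -
  have "\<exists>d m. 0 < d \<and> (\<forall>r\<in>{t..T}. dist r c < d \<longrightarrow> norm (f r) \<le> m)" if c: "c \<in> {t..T}" for c
  proof -
    obtain d1 where d1: "0 < d1" "\<And>r. r \<in> {t..T} \<Longrightarrow> c \<le> r \<Longrightarrow> r < c + d1 \<Longrightarrow> dist (f r) (f c) < 1"
      using cadlag_on_right[OF cad c, of 1] by auto
    obtain l where "\<And>e. 0 < e \<Longrightarrow> \<exists>d>0. \<forall>r\<in>{t..T}. r < c \<and> c - d < r \<longrightarrow> dist (f r) l < e"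
      using cadlag_on_left[OF cad c] by blast
    from this[of 1] obtain d2 where d2: "0 < d2" "\<forall>r\<in>{t..T}. r < c \<and> c - d2 < r \<longrightarrow> dist (f r) l < 1" by auto
    show ?thesis
    proof (intro exI conjI ballI impI)
      show "0 < min d1 d2" using d1 d2 by simp
      fix r assume r: "r \<in> {t..T}" "dist r c < min d1 d2"
      show "norm (f r) \<le> max (norm (f c) + 1) (norm l + 1)"
      proof (cases "c \<le> r")
        case True
        then have "dist (f r) (f c) < 1" using r by (intro d1(2)) (auto simp: dist_real_def)
        then show ?thesis using norm_triangle_ineq2[of "f r" "f c"] by (simp add: dist_norm max_def)
      next
        case False
        then have "dist (f r) l < 1" using d2(2) r by (auto simp: dist_real_def)
        then show ?thesis using norm_triangle_ineq2[of "f r" l] by (simp add: dist_norm max_def)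
      qed
    qed
  qed
  then obtain d m where dm: "\<And>c. c \<in> {t..T} \<Longrightarrow> 0 < d c"
    "\<And>c r. c \<in> {t..T} \<Longrightarrow> r \<in> {t..T} \<Longrightarrow> dist r c < d c \<Longrightarrow> norm (f r) \<le> m c" by metis
  have cover: "{t..T} \<subseteq> (\<Union>c\<in>{t..T}. ball c (d c))" using dm(1) by force
  obtain C where C: "C \<subseteq> {t..T}" "finite C" "{t..T} \<subseteq> (\<Union>c\<in>C. ball c (d c))"
    by (rule compactE_image[OF compact_Icc _ cover]) auto
  have "norm (f r) \<le> (\<Sum>c\<in>C. \<bar>m c\<bar>)" if r: "r \<in> {t..T}" for r
  proof -
    obtain c where c: "c \<in> C" "r \<in> ball c (d c)" using C(3) r by blast
    then have "norm (f r) \<le> m c" using dm(2)[of c r] C(1) r by (auto simp: dist_commute)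
    also have "\<dots> \<le> (\<Sum>c\<in>C. \<bar>m c\<bar>)" using member_le_sum[of c C "\<lambda>c. \<bar>m c\<bar>"] c C(2) by auto
    finally show ?thesis .
  qed
  then show ?thesis by blast
qed

text \<open>The path is controlled on [t,T] only, whereas \<open>left_lim\<close> uses the full left
  neighbourhood; for c > t the two filters coincide. The statement is sequential so that grid points
  can be inserted.\<close>

lemma left_lim_eq:
  fixes X :: "real \<Rightarrow> 'w \<Rightarrow> 'a::metric_space"
  assumes cad: "cadlag_on {t..T} (\<lambda>s. X s \<omega>)" and c: "t < c" "c \<le> T"
    and r: "\<And>k. r k \<in> {t..T}" "\<And>k. r k < c" "r \<longlonglongrightarrow> c"
  shows "(\<lambda>k. X (r k) \<omega>) \<longlonglongrightarrow> left_lim X c \<omega>"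
proof -
  have cI: "c \<in> {t..T}" using c by auto
  obtain l where l: "\<And>e. 0 < e \<Longrightarrow> \<exists>d>0. \<forall>r\<in>{t..T}. r < c \<and> c - d < r \<longrightarrow> dist (X r \<omega>) l < e"
    "((\<lambda>s. X s \<omega>) \<longlongrightarrow> l) (at c within {t..T} \<inter> {..<c})"
    using cadlag_on_left[OF cad cI] by blast
  have "at c within {t..T} \<inter> {..<c} = at_left c"
    by (rule at_within_nhd[of _ "{t<..}"]) (use c in auto)
  then have "left_lim X c \<omega> = l" unfolding left_lim_def using l(2) by (intro tendsto_Lim) auto
  moreover have "(\<lambda>k. X (r k) \<omega>) \<longlonglongrightarrow> l"
  proof (rule metric_LIMSEQ_I)
    fix e :: real assume "0 < e"
    then obtain d where d: "0 < d" "\<forall>r\<in>{t..T}. r < c \<and> c - d < r \<longrightarrow> dist (X r \<omega>) l < e" using l(1) by blast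
    obtain K where K: "\<And>k. k \<ge> K \<Longrightarrow> dist (r k) c < d" using metric_LIMSEQ_D[OF r(3) d(1)] by blast
    have "dist (X (r k) \<omega>) l < e" if "k \<ge> K" for k
      using d(2) r(1,2)[of k] K[OF that] by (auto simp: dist_real_def)
    then show "\<exists>no. \<forall>k\<ge>no. dist (X (r k) \<omega>) l < e" by blast
  qed
  ultimately show ?thesis by simp
qed

text \<open>Projection of time onto [t,T]. Composed with it, a process becomes total in time
  although nothing is known about it outside [t,T].\<close>

definition clamp_time :: "real \<Rightarrow> real \<Rightarrow> real \<Rightarrow> real" where
  "clamp_time t T \<tau> = max t (min T \<tau>)"

lemma clamp_time_simps: "t \<le> T \<Longrightarrow> clamp_time t T \<tau> \<in> {t..T}" "\<tau> \<in> {t..T} \<Longrightarrow> clamp_time t T \<tau> = \<tau>"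
  unfolding clamp_time_def by auto

text \<open>Grid points of mesh 1/(k+1) on either side of \<tau>. Floor plus one and ceiling minus
  one keep the inequalities strict even when \<tau> lies on the grid; on the left this is essential,
  as the value at \<tau> may differ from the left limit.\<close>

lemma grid_approx:
  fixes \<tau> :: real
  shows "(\<lambda>k. (of_int \<lfloor>real (Suc k) * \<tau>\<rfloor> + 1) / real (Suc k)) \<longlonglongrightarrow> \<tau>" (is "?r \<longlonglongrightarrow> _")
    and "\<tau> < (of_int \<lfloor>real (Suc k) * \<tau>\<rfloor> + 1) / real (Suc k)"
    and "(\<lambda>k. (of_int \<lceil>real (Suc k) * \<tau>\<rceil> - 1) / real (Suc k)) \<longlonglongrightarrow> \<tau>" (is "?l \<longlonglongrightarrow> _")
    and "(of_int \<lceil>real (Suc k) * \<tau>\<rceil> - 1) / real (Suc k) < \<tau>"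
proof -
  have r: "\<tau> < (of_int \<lfloor>real (Suc k) * \<tau>\<rfloor> + 1) / real (Suc k)"
    "(of_int \<lfloor>real (Suc k) * \<tau>\<rfloor> + 1) / real (Suc k) \<le> \<tau> + inverse (real (Suc k))" for k
  proof -
    have "real (Suc k) * \<tau> < of_int \<lfloor>real (Suc k) * \<tau>\<rfloor> + 1" by linarith
    then show "\<tau> < (of_int \<lfloor>real (Suc k) * \<tau>\<rfloor> + 1) / real (Suc k)"
      by (simp add: pos_less_divide_eq mult.commute del: of_nat_Suc)
    have "of_int \<lfloor>real (Suc k) * \<tau>\<rfloor> + 1 \<le> real (Suc k) * \<tau> + 1" by linarith
    then have "(of_int \<lfloor>real (Suc k) * \<tau>\<rfloor> + 1) / real (Suc k) \<le> (real (Suc k) * \<tau> + 1) / real (Suc k)"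
      by (intro divide_right_mono) auto
    then show "(of_int \<lfloor>real (Suc k) * \<tau>\<rfloor> + 1) / real (Suc k) \<le> \<tau> + inverse (real (Suc k))"
      by (simp add: add_divide_distrib inverse_eq_divide del: of_nat_Suc)
  qed
  have l: "(of_int \<lceil>real (Suc k) * \<tau>\<rceil> - 1) / real (Suc k) < \<tau>"
    "\<tau> - inverse (real (Suc k)) \<le> (of_int \<lceil>real (Suc k) * \<tau>\<rceil> - 1) / real (Suc k)" for k
  proof -
    have "of_int \<lceil>real (Suc k) * \<tau>\<rceil> - 1 < real (Suc k) * \<tau>" by linarith
    then show "(of_int \<lceil>real (Suc k) * \<tau>\<rceil> - 1) / real (Suc k) < \<tau>"
      by (simp add: pos_divide_less_eq mult.commute del: of_nat_Suc)
    have "real (Suc k) * \<tau> - 1 \<le> of_int \<lceil>real (Suc k) * \<tau>\<rceil> - 1" by linarith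
    then have "(real (Suc k) * \<tau> - 1) / real (Suc k) \<le> (of_int \<lceil>real (Suc k) * \<tau>\<rceil> - 1) / real (Suc k)"
      by (intro divide_right_mono) auto
    then show "\<tau> - inverse (real (Suc k)) \<le> (of_int \<lceil>real (Suc k) * \<tau>\<rceil> - 1) / real (Suc k)"
      by (simp add: diff_divide_distrib inverse_eq_divide del: of_nat_Suc)
  qed
  show "?r \<longlonglongrightarrow> \<tau>"
  proof (rule tendsto_sandwich[OF _ _ tendsto_const])
    show "(\<lambda>k. \<tau> + inverse (real (Suc k))) \<longlonglongrightarrow> \<tau>"
      using tendsto_add[OF tendsto_const LIMSEQ_inverse_real_of_nat, of \<tau>] by simp
  qed (use r in \<open>auto intro!: always_eventually less_imp_le simp del: of_nat_Suc\<close>)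
  show "?l \<longlonglongrightarrow> \<tau>"
  proof (rule tendsto_sandwich[OF _ _ _ tendsto_const])
    show "(\<lambda>k. \<tau> - inverse (real (Suc k))) \<longlonglongrightarrow> \<tau>"
      using tendsto_diff[OF tendsto_const LIMSEQ_inverse_real_of_nat, of \<tau>] by simp
  qed (use l in \<open>auto intro!: always_eventually less_imp_le simp del: of_nat_Suc\<close>)
  show "\<tau> < (of_int \<lfloor>real (Suc k) * \<tau>\<rfloor> + 1) / real (Suc k)" by (rule r)
  show "(of_int \<lceil>real (Suc k) * \<tau>\<rceil> - 1) / real (Suc k) < \<tau>" by (rule l)
qed

text \<open>Evaluated on a grid, the process depends on time through an integer and is a countable
  patchwork of measurable maps. Right continuity recovers X from grid points to the right, and left
  limits come from those to the left.\<close>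

lemma cadlag_jointly_measurable:
  fixes X :: "real \<Rightarrow> 'w \<Rightarrow> 'a::{real_normed_vector, second_countable_topology}"
  assumes tT: "t \<le> T" and X: "\<And>s. s \<in> {t..T} \<Longrightarrow> X s \<in> borel_measurable P"
    and cad: "\<And>\<omega>. \<omega> \<in> space P \<Longrightarrow> cadlag_on {t..T} (\<lambda>s. X s \<omega>)"
  shows "(\<lambda>(\<omega>, \<tau>). X (clamp_time t T \<tau>) \<omega>) \<in> borel_measurable (P \<Otimes>\<^sub>M lborel)"
    and "(\<lambda>(\<omega>, \<tau>). if t < \<tau> \<and> \<tau> \<le> T then left_lim X \<tau> \<omega> else 0) \<in> borel_measurable (P \<Otimes>\<^sub>M lborel)"
proof -
  let ?M = "P \<Otimes>\<^sub>M (lborel :: real measure)"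
  have meas: "(\<lambda>p. X (clamp_time t T (h (g (snd p)))) (fst p)) \<in> borel_measurable ?M"
    if g [measurable]: "g \<in> measurable borel (count_space (UNIV :: int set))" for g :: "real \<Rightarrow> int" and h
  proof (rule measurable_compose_countable[where f="\<lambda>i p. X (clamp_time t T (h i)) (fst p)"])
    fix i
    have [measurable]: "X (clamp_time t T (h i)) \<in> borel_measurable P" by (rule X[OF clamp_time_simps(1)[OF tT]])
    show "(\<lambda>p. X (clamp_time t T (h i)) (fst p)) \<in> borel_measurable ?M" by measurable
  qed measurable
  show "(\<lambda>(\<omega>, \<tau>). X (clamp_time t T \<tau>) \<omega>) \<in> borel_measurable ?M"
  proof (rule borel_measurable_LIMSEQ_metric)
    fix k
    show "(\<lambda>p. X (clamp_time t T ((of_int \<lfloor>real (Suc k) * snd p\<rfloor> + 1) / real (Suc k))) (fst p)) \<in> borel_measurable ?M"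
      by (rule meas[of "\<lambda>\<tau>. \<lfloor>real (Suc k) * \<tau>\<rfloor>" "\<lambda>i. (of_int i + 1) / real (Suc k)"]) measurable
  next
    fix p assume p: "p \<in> space ?M"
    obtain \<omega> \<tau> where pe: "p = (\<omega>, \<tau>)" by (cases p)
    let ?r = "\<lambda>k. (of_int \<lfloor>real (Suc k) * \<tau>\<rfloor> + 1) / real (Suc k)"
    have \<omega>: "\<omega> \<in> space P" using p pe by (simp add: space_pair_measure)
    have ge: "clamp_time t T \<tau> \<le> clamp_time t T (?r k)" for k
      using grid_approx(2)[of \<tau> k] unfolding clamp_time_def by (intro max.mono min.mono) auto
    have lim: "(\<lambda>k. clamp_time t T (?r k)) \<longlonglongrightarrow> clamp_time t T \<tau>"
      unfolding clamp_time_def by (intro tendsto_max tendsto_min tendsto_const grid_approx(1))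
    have "(\<lambda>k. X (clamp_time t T (?r k)) \<omega>) \<longlonglongrightarrow> X (clamp_time t T \<tau>) \<omega>"
    proof (rule metric_LIMSEQ_I)
      fix e :: real assume "0 < e"
      obtain d where d: "0 < d" "\<And>r. r \<in> {t..T} \<Longrightarrow> clamp_time t T \<tau> \<le> r \<Longrightarrow> r < clamp_time t T \<tau> + d \<Longrightarrow>
          dist (X r \<omega>) (X (clamp_time t T \<tau>) \<omega>) < e"
        using cadlag_on_right[OF cad[OF \<omega>] clamp_time_simps(1)[OF tT] \<open>0 < e\<close>, of \<tau>] by auto
      obtain K where K: "\<And>k. k \<ge> K \<Longrightarrow> dist (clamp_time t T (?r k)) (clamp_time t T \<tau>) < d"
        using metric_LIMSEQ_D[OF lim d(1)] by blast
      have "dist (X (clamp_time t T (?r k)) \<omega>) (X (clamp_time t T \<tau>) \<omega>) < e" if "k \<ge> K" for k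
        using K[OF that] ge[of k] by (intro d(2) clamp_time_simps(1)[OF tT]) (auto simp: dist_real_def)
      then show "\<exists>no. \<forall>k\<ge>no. dist (X (clamp_time t T (?r k)) \<omega>) (X (clamp_time t T \<tau>) \<omega>) < e" by blast
    qed
    then show "(\<lambda>k. X (clamp_time t T ((of_int \<lfloor>real (Suc k) * snd p\<rfloor> + 1) / real (Suc k))) (fst p))
        \<longlonglongrightarrow> (case p of (\<omega>, \<tau>) \<Rightarrow> X (clamp_time t T \<tau>) \<omega>)" by (simp add: pe)
  qed
  show "(\<lambda>(\<omega>, \<tau>). if t < \<tau> \<and> \<tau> \<le> T then left_lim X \<tau> \<omega> else 0) \<in> borel_measurable ?M"
  proof (rule borel_measurable_LIMSEQ_metric)
    fix k
    have [measurable]: "(\<lambda>p. X (clamp_time t T ((of_int \<lceil>real (Suc k) * snd p\<rceil> - 1) / real (Suc k))) (fst p)) \<in> borel_measurable ?M"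
      by (rule meas[of "\<lambda>\<tau>. \<lceil>real (Suc k) * \<tau>\<rceil>" "\<lambda>i. (of_int i - 1) / real (Suc k)"]) measurable
    show "(\<lambda>p. if t < snd p \<and> snd p \<le> T
        then X (clamp_time t T ((of_int \<lceil>real (Suc k) * snd p\<rceil> - 1) / real (Suc k))) (fst p) else 0) \<in> borel_measurable ?M"
      by measurable
  next
    fix p assume p: "p \<in> space ?M"
    obtain \<omega> \<tau> where pe: "p = (\<omega>, \<tau>)" by (cases p)
    have \<omega>: "\<omega> \<in> space P" using p pe by (simp add: space_pair_measure)
    let ?l = "\<lambda>k. (of_int \<lceil>real (Suc k) * \<tau>\<rceil> - 1) / real (Suc k)"
    have "(\<lambda>k. X (clamp_time t T (?l k)) \<omega>) \<longlonglongrightarrow> left_lim X \<tau> \<omega>" if \<tau>: "t < \<tau>" "\<tau> \<le> T"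
    proof (rule left_lim_eq[where X=X and \<omega>=\<omega>, OF cad[OF \<omega>] \<tau>])
      show "clamp_time t T (?l k) \<in> {t..T}" for k by (rule clamp_time_simps(1)[OF tT])
      show "clamp_time t T (?l k) < \<tau>" for k
        using grid_approx(4)[of k \<tau>] \<tau> unfolding clamp_time_def by (auto simp: min_def)
      have "(\<lambda>k. clamp_time t T (?l k)) \<longlonglongrightarrow> clamp_time t T \<tau>"
        unfolding clamp_time_def by (intro tendsto_max tendsto_min tendsto_const grid_approx(3))
      then show "(\<lambda>k. clamp_time t T (?l k)) \<longlonglongrightarrow> \<tau>" using \<tau> by (simp add: clamp_time_simps)
    qed
    then show "(\<lambda>k. if t < snd p \<and> snd p \<le> T
        then X (clamp_time t T ((of_int \<lceil>real (Suc k) * snd p\<rceil> - 1) / real (Suc k))) (fst p) else 0)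
        \<longlonglongrightarrow> (case p of (\<omega>, \<tau>) \<Rightarrow> if t < \<tau> \<and> \<tau> \<le> T then left_lim X \<tau> \<omega> else 0)" by (auto simp: pe)
  qed
qed

section \<open>A Gronwall inequality\<close>

lemma nn_integral_exp_le:
  fixes q c :: real
  assumes "0 \<le> q" "0 < c" "t \<le> s"
  shows "(\<integral>\<^sup>+\<tau>\<in>{t..s}. ennreal (q * exp (c * (\<tau> - t))) \<partial>lborel) \<le> ennreal (q * exp (c * (s - t)) / c)"
proof -
  have "(\<integral>\<^sup>+\<tau>\<in>{t..s}. ennreal (q * exp (c * (\<tau> - t))) \<partial>lborel)
      = ennreal (q * exp (c * (s - t)) / c - q * exp (c * (t - t)) / c)"
    by (rule nn_integral_FTC_Icc) (use assms in \<open>auto intro!: derivative_eq_intros\<close>)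
  also have "\<dots> \<le> ennreal (q * exp (c * (s - t)) / c)"
    using assms by (intro ennreal_leI) simp
  finally show ?thesis .
qed

text \<open>The hypothesis is the integral inequality tested against the weights \<open>q * exp (c * (s - t))\<close> only;
  since \<open>b / c \<le> 1 / 2\<close>, iterating it improves any initial bound \<open>K\<close> to \<open>2 * a\<close>.\<close>

lemma gronwall_weighted:
  fixes \<phi> :: "real \<Rightarrow> ennreal" and a b c K :: real
  assumes a: "0 \<le> a" and b: "0 \<le> b" and c: "0 < c" "2 * b \<le> c" and K: "0 \<le> K"
    and bd: "\<And>s. s \<in> {t..T} \<Longrightarrow> \<phi> s \<le> ennreal K"
    and step: "\<And>q s. 0 \<le> q \<Longrightarrow> (\<And>r. r \<in> {t..T} \<Longrightarrow> \<phi> r \<le> ennreal (q * exp (c * (r - t)))) \<Longrightarrow>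
        s \<in> {t..T} \<Longrightarrow> \<phi> s \<le> ennreal (a + b * (q * exp (c * (s - t)) / c))"
    and s: "s \<in> {t..T}"
  shows "\<phi> s \<le> ennreal (2 * a * exp (c * (s - t)))"
proof -
  have exp1: "1 \<le> exp (c * (r - t))" if "r \<in> {t..T}" for r using that c by simp
  have it: "\<forall>r\<in>{t..T}. \<phi> r \<le> ennreal ((2 * a + K / 2 ^ n) * exp (c * (r - t)))" for n
  proof (induction n)
    case 0
    show ?case
    proof
      fix r assume r: "r \<in> {t..T}"
      have "K * 1 \<le> (2 * a + K / 2 ^ 0) * exp (c * (r - t))"
        using exp1[OF r] a K by (intro mult_mono) auto
      then have "ennreal K \<le> ennreal ((2 * a + K / 2 ^ 0) * exp (c * (r - t)))"
        by (intro ennreal_leI) simp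
      with bd[OF r] show "\<phi> r \<le> ennreal ((2 * a + K / 2 ^ 0) * exp (c * (r - t)))" by (rule order_trans)
    qed
  next
    case (Suc n)
    \<comment> \<open>The value 2 a is the fixed point of the map taking q to a + q/2, and each
      round halves the distance to it.\<close>
    define q where "q = 2 * a + K / 2 ^ n"
    have q: "0 \<le> q" unfolding q_def using a K by simp
    show ?case
    proof
      fix r assume r: "r \<in> {t..T}"
      have "\<phi> r \<le> ennreal (a + b * (q * exp (c * (r - t)) / c))"
        by (rule step[OF q _ r]) (use Suc in \<open>auto simp: q_def\<close>)
      also have "\<dots> \<le> ennreal ((2 * a + K / 2 ^ Suc n) * exp (c * (r - t)))"
      proof (rule ennreal_leI)
        have "a * 1 \<le> a * exp (c * (r - t))" using exp1[OF r] a by (intro mult_left_mono) auto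
        moreover have "b * (q * exp (c * (r - t)) / c) = (b / c) * (q * exp (c * (r - t)))" by simp
        moreover have "(b / c) * (q * exp (c * (r - t))) \<le> (1 / 2) * (q * exp (c * (r - t)))"
          using c b q by (intro mult_right_mono) (auto simp: field_simps)
        ultimately have "a + b * (q * exp (c * (r - t)) / c) \<le> a * exp (c * (r - t)) + (1 / 2) * (q * exp (c * (r - t)))"
          by linarith
        also have "\<dots> = (2 * a + K / 2 ^ Suc n) * exp (c * (r - t))"
          unfolding q_def by (simp add: algebra_simps)
        finally show "a + b * (q * exp (c * (r - t)) / c) \<le> (2 * a + K / 2 ^ Suc n) * exp (c * (r - t))" .
      qed
      finally show "\<phi> r \<le> ennreal ((2 * a + K / 2 ^ Suc n) * exp (c * (r - t)))" .
    qed
  qed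
  have "(\<lambda>n. K * (1 / 2) ^ n) \<longlonglongrightarrow> K * 0" by (intro tendsto_mult tendsto_const LIMSEQ_realpow_zero) auto
  then have "(\<lambda>n. K / 2 ^ n) \<longlonglongrightarrow> 0" by (simp add: power_one_over)
  from tendsto_mult[OF tendsto_add[OF tendsto_const this] tendsto_const]
  have "(\<lambda>n. (2 * a + K / 2 ^ n) * exp (c * (s - t))) \<longlonglongrightarrow> (2 * a + 0) * exp (c * (s - t))" .
  then have "(\<lambda>n. ennreal ((2 * a + K / 2 ^ n) * exp (c * (s - t)))) \<longlonglongrightarrow> ennreal ((2 * a + 0) * exp (c * (s - t)))"
    by (rule tendsto_ennrealI)
  then have "\<phi> s \<le> ennreal ((2 * a + 0) * exp (c * (s - t)))"
    by (rule LIMSEQ_le_const) (use it s in auto)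
  then show ?thesis by simp
qed

section \<open>Estimates for mild solutions\<close>

lemma sq_norm_add3_le_ennreal:
  "ennreal ((norm (u + v + w))\<^sup>2)
    \<le> 3 * ennreal ((norm u)\<^sup>2) + 3 * ennreal ((norm v)\<^sup>2) + 3 * ennreal ((norm (w::'a::real_normed_vector))\<^sup>2)"
  using ennreal_leI[OF sq_norm_add3_le[of u v w]] by (simp add: ennreal_mult)

lemma norm_blinfun_sq_ennreal:
  "ennreal ((norm (blinfun_apply R v))\<^sup>2) \<le> ennreal ((norm R)\<^sup>2) * ennreal ((norm v)\<^sup>2)"
  using ennreal_leI[OF norm_blinfun_sq[of R v]] by (simp add: ennreal_mult)

text \<open>Cauchy-Schwarz against the indicator of [t,s]. When h is not integrable, the left side
  is 0 by the default value of the Bochner integral, so the bound covers this case as well.\<close>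

lemma set_integral_norm_sq_le:
  fixes h :: "real \<Rightarrow> 'a::{banach, second_countable_topology}"
  assumes ts: "t \<le> s" and m [measurable]: "(\<lambda>\<tau>. indicat_real {t..s} \<tau> *\<^sub>R h \<tau>) \<in> borel_measurable lborel"
  shows "ennreal ((norm (LINT \<tau>:{t..s}|lborel. h \<tau>))\<^sup>2)
      \<le> ennreal (s - t) * (\<integral>\<^sup>+\<tau>\<in>{t..s}. ennreal ((norm (h \<tau>))\<^sup>2) \<partial>lborel)"
proof -
  let ?h = "\<lambda>\<tau>. indicat_real {t..s} \<tau> *\<^sub>R h \<tau>"
  have "ennreal (norm (LINT \<tau>:{t..s}|lborel. h \<tau>)) \<le> (\<integral>\<^sup>+\<tau>. ennreal (norm (?h \<tau>)) \<partial>lborel)"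
  proof (cases "integrable lborel ?h")
    case True
    then show ?thesis unfolding set_lebesgue_integral_def by (rule integral_norm_bound_ennreal)
  next
    case False
    then show ?thesis unfolding set_lebesgue_integral_def by (simp add: not_integrable_integral_eq)
  qed
  also have "\<dots> = (\<integral>\<^sup>+\<tau>. indicator {t..s} \<tau> * ennreal (norm (?h \<tau>)) \<partial>lborel)"
    by (intro nn_integral_cong) (auto simp: indicator_def)
  finally have "(ennreal (norm (LINT \<tau>:{t..s}|lborel. h \<tau>)))\<^sup>2
      \<le> (\<integral>\<^sup>+\<tau>. indicator {t..s} \<tau> * ennreal (norm (?h \<tau>)) \<partial>lborel)\<^sup>2"
    by (rule power_mono) simp
  also have "\<dots> \<le> (\<integral>\<^sup>+\<tau>. (indicator {t..s} \<tau>)\<^sup>2 \<partial>lborel) * (\<integral>\<^sup>+\<tau>. (ennreal (norm (?h \<tau>)))\<^sup>2 \<partial>lborel)"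
    by (rule Cauchy_Schwarz_nn_integral) measurable
  also have "(\<integral>\<^sup>+\<tau>. (indicator {t..s} \<tau>)\<^sup>2 \<partial>lborel) = (\<integral>\<^sup>+\<tau>. indicator {t..s} (\<tau>::real) \<partial>lborel)"
    by (intro nn_integral_cong) (auto simp: indicator_def)
  also have "\<dots> = ennreal (s - t)" using ts by simp
  also have "(\<integral>\<^sup>+\<tau>. (ennreal (norm (?h \<tau>)))\<^sup>2 \<partial>lborel) = (\<integral>\<^sup>+\<tau>\<in>{t..s}. ennreal ((norm (h \<tau>))\<^sup>2) \<partial>lborel)"
    by (intro nn_integral_cong) (auto simp: indicator_def ennreal_power)
  finally show ?thesis by (simp add: ennreal_power)
qed

text \<open>The driver enters the constants only through the bound \<kappa> of its second moment,
  and the semigroup through \<gamma>. All constants below are expressions in these, in M, T, the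
  norm of the root of B and the norm of the datum, which makes uniformity in n visible.\<close>

locale mild_setting = levy_driver P \<F> \<mu> N
  for P :: "'w measure" and \<F> and \<mu> :: "'a::{real_inner, banach, second_countable_topology} measure" and N +
  fixes S :: "real \<Rightarrow> 'a \<Rightarrow>\<^sub>L 'a" and F :: "'a \<Rightarrow> 'a" and G :: "'a \<Rightarrow> 'a \<Rightarrow>\<^sub>L 'a"
    and B :: "'a \<Rightarrow>\<^sub>L 'a" and M \<gamma> \<kappa> T :: real
  assumes S: "contraction_C0_semigroup S"
    and \<gamma>: "0 \<le> \<gamma>" "\<And>r x. 0 \<le> r \<Longrightarrow> r \<le> T \<Longrightarrow> norm_m1 B (S r x) \<le> \<gamma> * norm_m1 B x"
    and T: "0 \<le> T" and M: "0 \<le> M"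
    and F0: "norm (F 0) \<le> M" and F_lip: "\<And>x y. norm (F x - F y) \<le> M * norm_m1 B (x - y)"
    and G_lip: "\<And>x y. norm (G x - G y) \<le> M * norm_m1 B (x - y)" and G_bound: "\<And>x. norm (G x) \<le> M"
    and \<kappa>: "0 \<le> \<kappa>" "(\<integral>\<^sup>+z. ennreal ((norm z)\<^sup>2) \<partial>\<mu>) \<le> ennreal \<kappa>"
begin

abbreviation "\<beta> \<equiv> norm (sqrt_op B)"
abbreviation "mild t x X \<equiv> mild_solution P \<F> \<mu> N S F G t T x X"

lemma norm_m1_le: "norm_m1 B v \<le> \<beta> * norm v"
  unfolding norm_m1_def by (rule norm_blinfun)

lemma F_continuous: "continuous_on UNIV F"
proof -
  have "(M * \<beta>)-lipschitz_on UNIV F"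
  proof (rule lipschitz_onI)
    fix x y
    have "norm (F x - F y) \<le> M * (\<beta> * norm (x - y))"
      by (rule order_trans[OF F_lip]) (intro mult_left_mono norm_m1_le M)
    then show "dist (F x) (F y) \<le> M * \<beta> * dist x y" by (simp add: dist_norm mult.assoc)
  qed (use M in simp)
  then show ?thesis by (rule lipschitz_on_continuous_on)
qed

lemma F_measurable [measurable]: "F \<in> borel_measurable borel"
  by (rule borel_measurable_continuous_onI[OF F_continuous])

lemma F_growth: "(norm (F v))\<^sup>2 \<le> 2 * M\<^sup>2 + 2 * M\<^sup>2 * \<beta>\<^sup>2 * (norm v)\<^sup>2"
proof -
  have a: "norm (F v - F 0) \<le> M * (\<beta> * norm v)"
    using order_trans[OF F_lip mult_left_mono[OF norm_m1_le M]] by (metis diff_zero)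
  have "(norm (F v))\<^sup>2 \<le> 2 * (norm (F v - F 0))\<^sup>2 + 2 * (norm (F 0))\<^sup>2"
    using sq_norm_add_le[of "F v - F 0" "F 0"] by simp
  also have "\<dots> \<le> 2 * (M * (\<beta> * norm v))\<^sup>2 + 2 * M\<^sup>2"
    by (intro add_mono mult_left_mono power_mono a F0) auto
  finally show ?thesis by (simp add: power_mult_distrib mult_ac add_ac)
qed

text \<open>The operator norm bounds the integrand at each z, so the energy is at most \<kappa>
  times an integral of squared operator norms. These are replaced by a measurable majorant g, since
  integrands are only strongly measurable.\<close>

lemma energy_le:
  fixes \<Phi> :: "real \<Rightarrow> 'w \<Rightarrow> 'a \<Rightarrow>\<^sub>L 'a"
  assumes le: "\<And>\<tau> \<omega>. \<tau> \<in> {t<..s} \<Longrightarrow> \<omega> \<in> space P \<Longrightarrow> ennreal ((norm (\<Phi> \<tau> \<omega>))\<^sup>2) \<le> g \<omega> \<tau>"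
    and g [measurable]: "(\<lambda>(\<omega>, \<tau>). g \<omega> \<tau>) \<in> borel_measurable (P \<Otimes>\<^sub>M lborel)"
  shows "energy t s \<Phi> \<le> ennreal \<kappa> * (\<integral>\<^sup>+\<omega>. (\<integral>\<^sup>+\<tau>\<in>{t<..s}. g \<omega> \<tau> \<partial>lborel) \<partial>P)"
proof -
  have "(\<integral>\<^sup>+z. ennreal ((norm (\<Phi> \<tau> \<omega> z))\<^sup>2) \<partial>\<mu>) \<le> ennreal \<kappa> * g \<omega> \<tau>" if "\<tau> \<in> {t<..s}" "\<omega> \<in> space P" for \<tau> \<omega>
  proof -
    have "(\<integral>\<^sup>+z. ennreal ((norm (\<Phi> \<tau> \<omega> z))\<^sup>2) \<partial>\<mu>) \<le> (\<integral>\<^sup>+z. ennreal ((norm (\<Phi> \<tau> \<omega>))\<^sup>2) * ennreal ((norm z)\<^sup>2) \<partial>\<mu>)"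
      by (intro nn_integral_mono norm_blinfun_sq_ennreal)
    also have "\<dots> = ennreal ((norm (\<Phi> \<tau> \<omega>))\<^sup>2) * (\<integral>\<^sup>+z. ennreal ((norm z)\<^sup>2) \<partial>\<mu>)"
      by (rule nn_integral_cmult) measurable
    also have "\<dots> \<le> g \<omega> \<tau> * ennreal \<kappa>" by (intro mult_mono le that \<kappa>(2)) auto
    finally show ?thesis by (simp add: mult.commute)
  qed
  then have "energy t s \<Phi> \<le> (\<integral>\<^sup>+\<omega>. (\<integral>\<^sup>+\<tau>. ennreal \<kappa> * (g \<omega> \<tau> * indicator {t<..s} \<tau>) \<partial>lborel) \<partial>P)"
    unfolding energy_def by (intro nn_integral_mono) (auto simp: indicator_def)
  also have "\<dots> = (\<integral>\<^sup>+\<omega>. ennreal \<kappa> * (\<integral>\<^sup>+\<tau>\<in>{t<..s}. g \<omega> \<tau> \<partial>lborel) \<partial>P)"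
    by (intro nn_integral_cong nn_integral_cmult) measurable
  also have "\<dots> = ennreal \<kappa> * (\<integral>\<^sup>+\<omega>. (\<integral>\<^sup>+\<tau>\<in>{t<..s}. g \<omega> \<tau> \<partial>lborel) \<partial>P)"
    by (rule nn_integral_cmult) measurable
  finally show ?thesis .
qed

text \<open>This is \<open>2 * a * exp (c * T)\<close> of the Gronwall lemma for the strong second
  moment. Here a = 3 \<rho>^2 + 6 M^2 T^2 + 12 \<kappa> M^2 T comes from the datum, the constant
  part of the growth of F and the noise, and c = 2 b + 1 with b = 6 T M^2 \<beta>^2 from the growing
  part of F.\<close>

definition apriori_const :: "real \<Rightarrow> real" where
  "apriori_const \<rho> = 2 * (3 * \<rho>\<^sup>2 + 6 * M\<^sup>2 * T\<^sup>2 + 12 * \<kappa> * M\<^sup>2 * T) * exp ((12 * T * M\<^sup>2 * \<beta>\<^sup>2 + 1) * T)"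

lemma apriori_const_nonneg: "0 \<le> apriori_const \<rho>"
  unfolding apriori_const_def using T \<kappa>(1) by (intro mult_nonneg_nonneg add_nonneg_nonneg) auto

text \<open>The factor of s - t contributed by drift and noise. The bracket after T bounds the
  second moment of F along the solution, and 4 \<kappa> M^2 is the noise.\<close>

definition increment_const :: "real \<Rightarrow> real" where
  "increment_const \<rho> = 3 * (T * (2 * M\<^sup>2 + 2 * M\<^sup>2 * \<beta>\<^sup>2 * apriori_const \<rho>) + 4 * \<kappa> * M\<^sup>2)"

lemma increment_const_nonneg: "0 \<le> increment_const \<rho>"
  unfolding increment_const_def using T \<kappa>(1) apriori_const_nonneg[of \<rho>] by simp

text \<open>Again \<open>2 * a * exp (c * T)\<close>, for the weak norm of a difference: 6
  \<gamma>^2 is 2 * 3 \<gamma>^2 from the data, and b = 3 \<beta>^2 M^2 T + 12 \<beta>^2 \<kappa>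
  M^2 collects Lipschitz drift and noise.\<close>

definition lipschitz_const :: real where
  "lipschitz_const = 6 * \<gamma>\<^sup>2 * exp ((2 * (3 * \<beta>\<^sup>2 * M\<^sup>2 * T + 12 * \<beta>\<^sup>2 * \<kappa> * M\<^sup>2) + 1) * T)"

section \<open>Moment, increment and Lipschitz estimates for a fixed initial time\<close>

context
  fixes t :: real
  assumes t: "0 \<le> t" "t \<le> T"
begin

lemma mild_measurable: "mild t x X \<Longrightarrow> s \<in> {t..T} \<Longrightarrow> X s \<in> borel_measurable P"
  using t filt_measurable[of "X s" s] unfolding mild_solution_def by simp

lemma mild_cadlag: "mild t x X \<Longrightarrow> \<omega> \<in> space P \<Longrightarrow> cadlag_on {t..T} (\<lambda>s. X s \<omega>)"
  unfolding mild_solution_def by auto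

lemma mild_joint:
  assumes "mild t x X"
  shows "(\<lambda>(\<omega>, \<tau>). X (clamp_time t T \<tau>) \<omega>) \<in> borel_measurable (P \<Otimes>\<^sub>M lborel)"
    and "(\<lambda>(\<omega>, \<tau>). if t < \<tau> \<and> \<tau> \<le> T then left_lim X \<tau> \<omega> else 0) \<in> borel_measurable (P \<Otimes>\<^sub>M lborel)"
  using cadlag_jointly_measurable[OF t(2) mild_measurable[OF assms] mild_cadlag[OF assms]] by auto

text \<open>A path with one-sided limits is bounded on [t,T], hence so is the integrand. The drift
  is thus a proper Bochner integral, and the drifts of two solutions may be subtracted.\<close>

lemma drift_integrable:
  assumes X: "mild t x X" and s: "s \<in> {t..T}" and \<omega>: "\<omega> \<in> space P"
  shows "set_integrable lborel {t..s} (\<lambda>\<tau>. S (s - \<tau>) (F (X \<tau> \<omega>)))"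
proof -
  note [measurable] = mild_joint(1)[OF X]
  have [measurable]: "(\<lambda>\<tau>. X (clamp_time t T \<tau>) \<omega>) \<in> borel_measurable lborel"
    using measurable_compose_Pair1[OF \<omega> mild_joint(1)[OF X]] by simp
  \<comment> \<open>Replacing s - \<tau> by its positive part makes the map continuous for all
    times; on [t,s] nothing changes.\<close>
  have cont: "continuous_on UNIV (\<lambda>p. S (max 0 (fst p)) (snd p))"
  proof -
    have "continuous_on UNIV (\<lambda>p. (\<lambda>(r, v). S r v) (max 0 (fst p), snd p :: 'a))"
      by (rule continuous_on_compose2[OF semigroup_joint_continuous[OF S]]) (auto intro!: continuous_intros)
    then show ?thesis by simp
  qed
  have "(\<lambda>p. S (max 0 (fst p)) (snd p)) \<in> borel_measurable (borel \<Otimes>\<^sub>M borel)"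
    unfolding borel_prod by (rule borel_measurable_continuous_onI[OF cont])
  then have "(\<lambda>\<tau>. S (max 0 (fst (s - \<tau>, F (X (clamp_time t T \<tau>) \<omega>)))) (snd (s - \<tau>, F (X (clamp_time t T \<tau>) \<omega>)))) \<in> borel_measurable lborel"
    by (rule measurable_compose[rotated]) measurable
  then have [measurable]: "(\<lambda>\<tau>. S (max 0 (s - \<tau>)) (F (X (clamp_time t T \<tau>) \<omega>))) \<in> borel_measurable lborel" by simp
  obtain m where m: "\<And>r. r \<in> {t..T} \<Longrightarrow> norm (X r \<omega>) \<le> m"
    using cadlag_on_bounded[OF mild_cadlag[OF X \<omega>]] by blast
  define c where "c = 2 * M\<^sup>2 + 2 * M\<^sup>2 * \<beta>\<^sup>2 * m\<^sup>2"
  have eq: "indicat_real {t..s} \<tau> *\<^sub>R S (s - \<tau>) (F (X \<tau> \<omega>))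
      = indicat_real {t..s} \<tau> *\<^sub>R S (max 0 (s - \<tau>)) (F (X (clamp_time t T \<tau>) \<omega>))" for \<tau>
    using s by (auto simp: indicator_def clamp_time_simps max_def)
  have "integrable lborel (\<lambda>\<tau>. indicat_real {t..s} \<tau> *\<^sub>R S (max 0 (s - \<tau>)) (F (X (clamp_time t T \<tau>) \<omega>)))"
  proof (rule Bochner_Integration.integrable_bound)
    show "integrable lborel (\<lambda>\<tau>. indicat_real {t..s} \<tau> * sqrt c)"
      using s by (intro integrable_mult_left integrable_real_indicator) auto
    show "AE \<tau> in lborel. norm (indicat_real {t..s} \<tau> *\<^sub>R S (max 0 (s - \<tau>)) (F (X (clamp_time t T \<tau>) \<omega>)))
        \<le> norm (indicat_real {t..s} \<tau> * sqrt c)"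
    proof (rule AE_I2)
      fix \<tau>
      let ?v = "X (clamp_time t T \<tau>) \<omega>"
      have "norm ?v \<le> m" by (rule m[OF clamp_time_simps(1)[OF t(2)]])
      then have "(norm (F ?v))\<^sup>2 \<le> c"
        unfolding c_def by (intro order_trans[OF F_growth] add_left_mono mult_left_mono power_mono) auto
      then have "norm (F ?v) \<le> sqrt c" by (rule real_le_rsqrt)
      moreover have "norm (S (max 0 (s - \<tau>)) (F ?v)) \<le> norm (F ?v)" by (rule semigroup_norm_le[OF S]) simp
      ultimately have "norm (S (max 0 (s - \<tau>)) (F ?v)) \<le> \<bar>sqrt c\<bar>" by linarith
      then show "norm (indicat_real {t..s} \<tau> *\<^sub>R S (max 0 (s - \<tau>)) (F ?v)) \<le> norm (indicat_real {t..s} \<tau> * sqrt c)"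
        by (auto simp: indicator_def)
    qed
  qed measurable
  then show ?thesis unfolding set_integrable_def eq .
qed

text \<open>Since G is bounded by M and S contracts, the integrand is bounded by M whatever X is.
  This breaks the circle: the noise has a finite second moment before any moment of X is known to be
  finite.\<close>

lemma stoch_convolution_norm_le:
  assumes Z: "has_stoch_integral P \<F> \<mu> N t s (\<lambda>\<tau> \<omega>. S (s - \<tau>) o\<^sub>L G (left_lim X \<tau> \<omega>)) Z" and s: "t \<le> s"
  shows "(\<integral>\<^sup>+\<omega>. ennreal ((norm (Z \<omega>))\<^sup>2) \<partial>P) \<le> ennreal (4 * \<kappa> * M\<^sup>2 * (s - t))"
proof -
  have bd: "ennreal ((norm (S (s - \<tau>) o\<^sub>L G (left_lim X \<tau> \<omega>)))\<^sup>2) \<le> ennreal (M\<^sup>2)" if "\<tau> \<in> {t<..s}" for \<tau> \<omega>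
  proof (intro ennreal_leI power_mono)
    have "norm (S (s - \<tau>)) \<le> 1" using S that unfolding contraction_C0_semigroup_def by auto
    then have "norm (S (s - \<tau>)) * norm (G (left_lim X \<tau> \<omega>)) \<le> 1 * M" by (intro mult_mono G_bound) auto
    then show "norm (S (s - \<tau>) o\<^sub>L G (left_lim X \<tau> \<omega>)) \<le> M"
      using norm_blinfun_compose[of "S (s - \<tau>)" "G (left_lim X \<tau> \<omega>)"] by linarith
  qed simp
  have "(\<integral>\<^sup>+\<omega>. ennreal ((norm (Z \<omega>))\<^sup>2) \<partial>P) \<le> 4 * energy t s (\<lambda>\<tau> \<omega>. S (s - \<tau>) o\<^sub>L G (left_lim X \<tau> \<omega>))"
    by (rule has_stoch_integral_norm_le[OF t(1) Z])
  also have "\<dots> \<le> 4 * (ennreal \<kappa> * (\<integral>\<^sup>+\<omega>. (\<integral>\<^sup>+\<tau>\<in>{t<..s}. ennreal (M\<^sup>2) \<partial>lborel) \<partial>P))"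
    by (intro mult_left_mono energy_le bd) auto
  also have "(\<integral>\<^sup>+\<omega>. (\<integral>\<^sup>+\<tau>\<in>{t<..s}. ennreal (M\<^sup>2) \<partial>lborel) \<partial>P) = ennreal (M\<^sup>2 * (s - t))"
    using s by (simp add: nn_integral_cmult_indicator emeasure_space_1 ennreal_mult)
  also have "4 * (ennreal \<kappa> * ennreal (M\<^sup>2 * (s - t))) = ennreal (4 * \<kappa> * M\<^sup>2 * (s - t))"
    using \<kappa>(1) s by (simp add: ennreal_mult[symmetric] mult.assoc flip: ennreal_numeral)
  finally show ?thesis .
qed

text \<open>Common source of the a priori bound and of both increment estimates: Q is the identity
  or the root of B, y is 0 or x, and A is a truncation event or the whole space. The indicator of A
  is kept in the pathwise drift and dropped in the noise.\<close>

lemma mild_estimate: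
  fixes Q :: "'a \<Rightarrow>\<^sub>L 'a"
  assumes X: "mild t x X" and s: "s \<in> {t..T}" and A [measurable]: "A \<in> sets P"
  shows "(\<integral>\<^sup>+\<omega>. ennreal ((norm (Q (X s \<omega> - y)))\<^sup>2) * indicator A \<omega> \<partial>P)
    \<le> 3 * ennreal ((norm (Q (S (s - t) x - y)))\<^sup>2) + 3 * (ennreal ((norm Q)\<^sup>2) *
        (ennreal (s - t) * (\<integral>\<^sup>+\<tau>\<in>{t..s}. (\<integral>\<^sup>+\<omega>. ennreal ((norm (F (X \<tau> \<omega>)))\<^sup>2) * indicator A \<omega> \<partial>P) \<partial>lborel)
          + ennreal (4 * \<kappa> * M\<^sup>2 * (s - t))))"
proof -
  interpret PL: pair_sigma_finite P "lborel :: real measure" by unfold_locales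
  have ts: "t \<le> s" using s by simp
  obtain Z where Z: "has_stoch_integral P \<F> \<mu> N t s (\<lambda>\<tau> \<omega>. S (s - \<tau>) o\<^sub>L G (left_lim X \<tau> \<omega>)) Z"
    and eq: "AE \<omega> in P. X s \<omega> = S (s - t) x + (LINT \<tau>:{t..s}|lborel. S (s - \<tau>) (F (X \<tau> \<omega>))) + Z \<omega>"
    using X s unfolding mild_solution_def by blast
  have [measurable]: "Z \<in> borel_measurable P" using Z unfolding has_stoch_integral_def by auto
  note [measurable] = mild_joint(1)[OF X]
  define D where "D \<omega> = (\<integral>\<^sup>+\<tau>. ennreal ((norm (F (X (clamp_time t T \<tau>) \<omega>)))\<^sup>2) * indicator {t..s} \<tau> \<partial>lborel)" for \<omega>
  have Dm [measurable]: "D \<in> borel_measurable P" unfolding D_def by measurable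
  let ?i = "\<lambda>\<omega>. indicator A \<omega> :: ennreal"
  let ?q = "ennreal ((norm Q)\<^sup>2)"
  let ?u = "ennreal ((norm (Q (S (s - t) x - y)))\<^sup>2)"
  have drift: "ennreal ((norm (LINT \<tau>:{t..s}|lborel. S (s - \<tau>) (F (X \<tau> \<omega>))))\<^sup>2) \<le> ennreal (s - t) * D \<omega>"
    if "\<omega> \<in> space P" for \<omega>
  proof -
    have "ennreal ((norm (LINT \<tau>:{t..s}|lborel. S (s - \<tau>) (F (X \<tau> \<omega>))))\<^sup>2)
        \<le> ennreal (s - t) * (\<integral>\<^sup>+\<tau>\<in>{t..s}. ennreal ((norm (S (s - \<tau>) (F (X \<tau> \<omega>))))\<^sup>2) \<partial>lborel)"
      using drift_integrable[OF X s that] unfolding set_integrable_def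
      by (intro set_integral_norm_sq_le[OF ts]) auto
    also have "\<dots> \<le> ennreal (s - t) * D \<omega>"
      unfolding D_def
    proof (intro mult_left_mono nn_integral_mono)
      fix \<tau>
      show "ennreal ((norm (S (s - \<tau>) (F (X \<tau> \<omega>))))\<^sup>2) * indicator {t..s} \<tau>
          \<le> ennreal ((norm (F (X (clamp_time t T \<tau>) \<omega>)))\<^sup>2) * indicator {t..s} \<tau>"
        using s by (auto simp: indicator_def clamp_time_simps intro!: ennreal_leI power_mono semigroup_norm_le[OF S])
    qed simp
    finally show ?thesis .
  qed
  have "(\<integral>\<^sup>+\<omega>. ennreal ((norm (Q (X s \<omega> - y)))\<^sup>2) * ?i \<omega> \<partial>P)
      \<le> (\<integral>\<^sup>+\<omega>. 3 * ?u + 3 * (?q * (ennreal (s - t) * (D \<omega> * ?i \<omega>) + ennreal ((norm (Z \<omega>))\<^sup>2))) \<partial>P)"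
  proof (rule nn_integral_mono_AE)
    show "AE \<omega> in P. ennreal ((norm (Q (X s \<omega> - y)))\<^sup>2) * ?i \<omega>
        \<le> 3 * ?u + 3 * (?q * (ennreal (s - t) * (D \<omega> * ?i \<omega>) + ennreal ((norm (Z \<omega>))\<^sup>2)))"
      using eq AE_space
    proof eventually_elim
      case (elim \<omega>)
      let ?d = "LINT \<tau>:{t..s}|lborel. S (s - \<tau>) (F (X \<tau> \<omega>))"
      have e: "Q (X s \<omega> - y) = Q (S (s - t) x - y) + Q ?d + Q (Z \<omega>)"
        unfolding elim(1) by (simp add: blinfun.add_right blinfun.diff_right)
      have "ennreal ((norm (Q (X s \<omega> - y)))\<^sup>2) \<le> 3 * ?u + 3 * ennreal ((norm (Q ?d))\<^sup>2) + 3 * ennreal ((norm (Q (Z \<omega>)))\<^sup>2)"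
        unfolding e by (rule sq_norm_add3_le_ennreal)
      also have "\<dots> \<le> 3 * ?u + 3 * (?q * (ennreal (s - t) * D \<omega>)) + 3 * (?q * ennreal ((norm (Z \<omega>))\<^sup>2))"
        by (intro add_mono order_refl mult_left_mono order_trans[OF norm_blinfun_sq_ennreal] drift elim) auto
      finally have "ennreal ((norm (Q (X s \<omega> - y)))\<^sup>2)
          \<le> 3 * ?u + 3 * (?q * (ennreal (s - t) * D \<omega> + ennreal ((norm (Z \<omega>))\<^sup>2)))"
        by (simp add: distrib_left add.assoc)
      then show ?case by (auto simp: indicator_def)
    qed
  qed
  also have "\<dots> = 3 * ?u + 3 * (?q * (ennreal (s - t) * (\<integral>\<^sup>+\<omega>. D \<omega> * ?i \<omega> \<partial>P) + (\<integral>\<^sup>+\<omega>. ennreal ((norm (Z \<omega>))\<^sup>2) \<partial>P)))"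
    by (simp add: nn_integral_add nn_integral_cmult emeasure_space_1)
  \<comment> \<open>Tonelli brings out a moment at a fixed time, which Gronwall's inequality can
    iterate. Clamped times provide joint measurability and disappear again on [t,s].\<close>
  also have "(\<integral>\<^sup>+\<omega>. D \<omega> * ?i \<omega> \<partial>P)
      = (\<integral>\<^sup>+\<tau>\<in>{t..s}. (\<integral>\<^sup>+\<omega>. ennreal ((norm (F (X \<tau> \<omega>)))\<^sup>2) * ?i \<omega> \<partial>P) \<partial>lborel)"
  proof -
    have "(\<integral>\<^sup>+\<omega>. D \<omega> * ?i \<omega> \<partial>P) = (\<integral>\<^sup>+\<omega>. (\<integral>\<^sup>+\<tau>. ennreal ((norm (F (X (clamp_time t T \<tau>) \<omega>)))\<^sup>2) * indicator {t..s} \<tau> * ?i \<omega> \<partial>lborel) \<partial>P)"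
      unfolding D_def by (intro nn_integral_cong nn_integral_multc[symmetric]) measurable
    also have "\<dots> = (\<integral>\<^sup>+\<tau>. (\<integral>\<^sup>+\<omega>. ennreal ((norm (F (X (clamp_time t T \<tau>) \<omega>)))\<^sup>2) * indicator {t..s} \<tau> * ?i \<omega> \<partial>P) \<partial>lborel)"
      by (rule PL.Fubini'[symmetric]) measurable
    also have "\<dots> = (\<integral>\<^sup>+\<tau>\<in>{t..s}. (\<integral>\<^sup>+\<omega>. ennreal ((norm (F (X \<tau> \<omega>)))\<^sup>2) * ?i \<omega> \<partial>P) \<partial>lborel)"
      using s by (intro nn_integral_cong) (auto simp: indicator_def clamp_time_simps)
    finally show ?thesis .
  qed
  also have "3 * ?u + 3 * (?q * (ennreal (s - t) * (\<integral>\<^sup>+\<tau>\<in>{t..s}. (\<integral>\<^sup>+\<omega>. ennreal ((norm (F (X \<tau> \<omega>)))\<^sup>2) * ?i \<omega> \<partial>P) \<partial>lborel)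
        + (\<integral>\<^sup>+\<omega>. ennreal ((norm (Z \<omega>))\<^sup>2) \<partial>P)))
    \<le> 3 * ?u + 3 * (?q * (ennreal (s - t) * (\<integral>\<^sup>+\<tau>\<in>{t..s}. (\<integral>\<^sup>+\<omega>. ennreal ((norm (F (X \<tau> \<omega>)))\<^sup>2) * ?i \<omega> \<partial>P) \<partial>lborel)
        + ennreal (4 * \<kappa> * M\<^sup>2 * (s - t))))"
    by (intro add_left_mono mult_left_mono stoch_convolution_norm_le[OF Z ts]) auto
  finally show ?thesis .
qed

text \<open>Restricting the expectation to paths bounded by \<open>m\<close> makes it finite a priori. The restriction is not
  adapted, but it enters only the pathwise drift term; the stochastic integral is bounded unconditionally
  because \<open>G\<close> is bounded.\<close>

lemma mild_second_moment:
  assumes X: "mild t x X" and s: "s \<in> {t..T}"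
  shows "(\<integral>\<^sup>+\<omega>. ennreal ((norm (X s \<omega>))\<^sup>2) \<partial>P) \<le> ennreal (apriori_const (norm x))"
proof -
  \<comment> \<open>A countable set suffices for measurability of the truncation event. Right
    continuity then reaches every time from rationals to its right, except T itself, which is
    therefore added.\<close>
  define D where "D = (\<rat> \<inter> {t..T}) \<union> {T}"
  define \<Omega> where "\<Omega> m = {\<omega> \<in> space P. \<forall>r\<in>D. norm (X r \<omega>) \<le> real m}" for m :: nat
  have DT: "D \<subseteq> {t..T}" "countable D" unfolding D_def using t countable_rat by (auto intro: countable_Int1)
  have \<Omega>m [measurable]: "\<Omega> m \<in> sets P" for m
  proof -
    have "{\<omega> \<in> space P. norm (X r \<omega>) \<le> real m} \<in> sets P" if "r \<in> D" for r
    proof -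
      have [measurable]: "X r \<in> borel_measurable P" using DT mild_measurable[OF X] that by auto
      show ?thesis by measurable
    qed
    then have "(\<Inter>r\<in>D. {\<omega> \<in> space P. norm (X r \<omega>) \<le> real m}) \<in> sets P"
      using DT(2) by (intro sets.countable_INT') (auto simp: D_def)
    moreover have "(\<Inter>r\<in>D. {\<omega> \<in> space P. norm (X r \<omega>) \<le> real m}) = \<Omega> m"
      unfolding \<Omega>_def D_def by auto
    ultimately show ?thesis by simp
  qed
  have bd: "norm (X r \<omega>) \<le> real m" if \<omega>: "\<omega> \<in> \<Omega> m" and r: "r \<in> {t..T}" for m r \<omega>
  proof (rule field_le_epsilon)
    fix e :: real assume e: "0 < e"
    have \<omega>P: "\<omega> \<in> space P" using \<omega> unfolding \<Omega>_def by simp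
    obtain d where d: "0 < d" "\<And>q. q \<in> {t..T} \<Longrightarrow> r \<le> q \<Longrightarrow> q < r + d \<Longrightarrow> dist (X q \<omega>) (X r \<omega>) < e"
      using cadlag_on_right[OF mild_cadlag[OF X \<omega>P] r e] by auto
    have "\<exists>q\<in>D. r \<le> q \<and> q < r + d"
    proof (cases "r = T")
      case True then show ?thesis using d(1) unfolding D_def by auto
    next
      case False
      then have "r < min T (r + d)" using r d(1) by auto
      then obtain q where "q \<in> \<rat>" "r < q" "q < min T (r + d)" using Rats_dense_in_real by blast
      then show ?thesis using r unfolding D_def by (intro bexI[of _ q]) auto
    qed
    then obtain q where q: "q \<in> D" "r \<le> q" "q < r + d" by blast
    have "norm (X r \<omega>) \<le> norm (X q \<omega>) + dist (X q \<omega>) (X r \<omega>)"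
      using norm_triangle_ineq2[of "X r \<omega>" "X q \<omega>"] by (simp add: dist_norm norm_minus_commute)
    moreover have "norm (X q \<omega>) \<le> real m" using \<omega> q(1) unfolding \<Omega>_def by simp
    moreover have "dist (X q \<omega>) (X r \<omega>) < e" using d(2) q DT by auto
    ultimately show "norm (X r \<omega>) \<le> real m + e" by linarith
  qed
  define a where "a = 3 * (norm x)\<^sup>2 + 6 * M\<^sup>2 * T\<^sup>2 + 12 * \<kappa> * M\<^sup>2 * T"
  define b where "b = 6 * T * M\<^sup>2 * \<beta>\<^sup>2"
  have a0: "0 \<le> a" and b0: "0 \<le> b" unfolding a_def b_def using T \<kappa>(1) by auto
  define c where "c = 2 * b + 1"
  have fin: "(\<integral>\<^sup>+\<omega>. ennreal ((norm (X r \<omega>))\<^sup>2) * indicator (\<Omega> m) \<omega> \<partial>P) \<le> ennreal (2 * a * exp (c * (r - t)))"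
    if r: "r \<in> {t..T}" for r m
  proof (rule gronwall_weighted[where \<phi>="\<lambda>r. \<integral>\<^sup>+\<omega>. ennreal ((norm (X r \<omega>))\<^sup>2) * indicator (\<Omega> m) \<omega> \<partial>P"
        and K="(real m)\<^sup>2" and b=b, OF a0 b0 _ _ _ _ _ r])
    show "0 < c" "2 * b \<le> c" "0 \<le> (real m)\<^sup>2" unfolding c_def using b0 by auto
    show "(\<integral>\<^sup>+\<omega>. ennreal ((norm (X r \<omega>))\<^sup>2) * indicator (\<Omega> m) \<omega> \<partial>P) \<le> ennreal ((real m)\<^sup>2)" if r: "r \<in> {t..T}" for r
    proof -
      have "(\<integral>\<^sup>+\<omega>. ennreal ((norm (X r \<omega>))\<^sup>2) * indicator (\<Omega> m) \<omega> \<partial>P) \<le> (\<integral>\<^sup>+\<omega>. ennreal ((real m)\<^sup>2) \<partial>P)"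
        using bd[OF _ r] by (intro nn_integral_mono) (auto simp: indicator_def intro!: ennreal_leI power_mono)
      then show ?thesis by (simp add: emeasure_space_1)
    qed
    fix q s assume q: "0 \<le> q" and s: "s \<in> {t..T}"
      and h: "\<And>r. r \<in> {t..T} \<Longrightarrow> (\<integral>\<^sup>+\<omega>. ennreal ((norm (X r \<omega>))\<^sup>2) * indicator (\<Omega> m) \<omega> \<partial>P) \<le> ennreal (q * exp (c * (r - t)))"
    have c0: "0 < c" unfolding c_def using b0 by simp
    define e where "e = q * exp (c * (s - t)) / c"
    have e0: "0 \<le> e" unfolding e_def using q c0 by simp
    have sT: "s - t \<le> T" "0 \<le> s - t" using s t by auto
    have FX: "(\<integral>\<^sup>+\<omega>. ennreal ((norm (F (X \<tau> \<omega>)))\<^sup>2) * indicator (\<Omega> m) \<omega> \<partial>P)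
        \<le> ennreal (2 * M\<^sup>2) + ennreal (2 * M\<^sup>2 * \<beta>\<^sup>2) * ennreal (q * exp (c * (\<tau> - t)))" if \<tau>: "\<tau> \<in> {t..T}" for \<tau>
    proof -
      have [measurable]: "X \<tau> \<in> borel_measurable P" by (rule mild_measurable[OF X \<tau>])
      have "(\<integral>\<^sup>+\<omega>. ennreal ((norm (F (X \<tau> \<omega>)))\<^sup>2) * indicator (\<Omega> m) \<omega> \<partial>P)
          \<le> (\<integral>\<^sup>+\<omega>. ennreal (2 * M\<^sup>2) + ennreal (2 * M\<^sup>2 * \<beta>\<^sup>2) * (ennreal ((norm (X \<tau> \<omega>))\<^sup>2) * indicator (\<Omega> m) \<omega>) \<partial>P)"
      proof (rule nn_integral_mono)
        fix \<omega>
        have "ennreal ((norm (F (X \<tau> \<omega>)))\<^sup>2) \<le> ennreal (2 * M\<^sup>2) + ennreal (2 * M\<^sup>2 * \<beta>\<^sup>2) * ennreal ((norm (X \<tau> \<omega>))\<^sup>2)"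
          using ennreal_leI[OF F_growth[of "X \<tau> \<omega>"]] by (simp add: ennreal_mult[symmetric] del: ennreal_plus flip: ennreal_plus)
        then show "ennreal ((norm (F (X \<tau> \<omega>)))\<^sup>2) * indicator (\<Omega> m) \<omega>
            \<le> ennreal (2 * M\<^sup>2) + ennreal (2 * M\<^sup>2 * \<beta>\<^sup>2) * (ennreal ((norm (X \<tau> \<omega>))\<^sup>2) * indicator (\<Omega> m) \<omega>)"
          by (auto simp: indicator_def)
      qed
      also have "\<dots> = ennreal (2 * M\<^sup>2) + ennreal (2 * M\<^sup>2 * \<beta>\<^sup>2) * (\<integral>\<^sup>+\<omega>. ennreal ((norm (X \<tau> \<omega>))\<^sup>2) * indicator (\<Omega> m) \<omega> \<partial>P)"
        by (simp add: nn_integral_add nn_integral_cmult emeasure_space_1)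
      also have "\<dots> \<le> ennreal (2 * M\<^sup>2) + ennreal (2 * M\<^sup>2 * \<beta>\<^sup>2) * ennreal (q * exp (c * (\<tau> - t)))"
        by (intro add_left_mono mult_left_mono h \<tau>) auto
      finally show ?thesis .
    qed
    have int: "(\<integral>\<^sup>+\<tau>\<in>{t..s}. (\<integral>\<^sup>+\<omega>. ennreal ((norm (F (X \<tau> \<omega>)))\<^sup>2) * indicator (\<Omega> m) \<omega> \<partial>P) \<partial>lborel)
        \<le> ennreal (2 * M\<^sup>2 * (s - t) + 2 * M\<^sup>2 * \<beta>\<^sup>2 * e)"
    proof -
      have "(\<integral>\<^sup>+\<tau>\<in>{t..s}. (\<integral>\<^sup>+\<omega>. ennreal ((norm (F (X \<tau> \<omega>)))\<^sup>2) * indicator (\<Omega> m) \<omega> \<partial>P) \<partial>lborel)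
        \<le> (\<integral>\<^sup>+\<tau>. ennreal (2 * M\<^sup>2) * indicator {t..s} \<tau>
            + ennreal (2 * M\<^sup>2 * \<beta>\<^sup>2) * (ennreal (q * exp (c * (\<tau> - t))) * indicator {t..s} \<tau>) \<partial>lborel)"
        using FX s by (intro nn_integral_mono) (auto simp: indicator_def)
      also have "\<dots> = ennreal (2 * M\<^sup>2) * ennreal (s - t)
          + ennreal (2 * M\<^sup>2 * \<beta>\<^sup>2) * (\<integral>\<^sup>+\<tau>\<in>{t..s}. ennreal (q * exp (c * (\<tau> - t))) \<partial>lborel)"
        using s by (simp add: nn_integral_add nn_integral_cmult)
      also have "\<dots> \<le> ennreal (2 * M\<^sup>2) * ennreal (s - t) + ennreal (2 * M\<^sup>2 * \<beta>\<^sup>2) * ennreal e"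
        unfolding e_def by (intro add_left_mono mult_left_mono nn_integral_exp_le q c0) (use s in auto)
      also have "\<dots> = ennreal (2 * M\<^sup>2 * (s - t) + 2 * M\<^sup>2 * \<beta>\<^sup>2 * e)"
        using s e0 by (subst ennreal_plus) (auto simp: ennreal_mult[symmetric])
      finally show ?thesis .
    qed
    have "(\<integral>\<^sup>+\<omega>. ennreal ((norm (id_blinfun (X s \<omega> - 0)))\<^sup>2) * indicator (\<Omega> m) \<omega> \<partial>P)
      \<le> 3 * ennreal ((norm (id_blinfun (S (s - t) x - 0)))\<^sup>2) + 3 * (ennreal ((norm (id_blinfun :: 'a \<Rightarrow>\<^sub>L 'a))\<^sup>2) *
          (ennreal (s - t) * (\<integral>\<^sup>+\<tau>\<in>{t..s}. (\<integral>\<^sup>+\<omega>. ennreal ((norm (F (X \<tau> \<omega>)))\<^sup>2) * indicator (\<Omega> m) \<omega> \<partial>P) \<partial>lborel)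
          + ennreal (4 * \<kappa> * M\<^sup>2 * (s - t))))"
      by (rule mild_estimate[OF X s \<Omega>m])
    also have "\<dots> \<le> 3 * ennreal ((norm x)\<^sup>2) + 3 * (1 *
          (ennreal T * ennreal (2 * M\<^sup>2 * T + 2 * M\<^sup>2 * \<beta>\<^sup>2 * e) + ennreal (4 * \<kappa> * M\<^sup>2 * T)))"
    proof -
      have f1: "ennreal ((norm (id_blinfun (S (s - t) x - 0)))\<^sup>2) \<le> ennreal ((norm x)\<^sup>2)"
        using semigroup_norm_le[OF S sT(2), of x] by (intro ennreal_leI) (simp add: power_mono)
      \<comment> \<open>Only an inequality: in the zero space the identity has norm 0.\<close>
      have f2: "ennreal ((norm (id_blinfun :: 'a \<Rightarrow>\<^sub>L 'a))\<^sup>2) \<le> 1"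
        using norm_blinfun_id_le[where 'a='a] by (simp add: power_le_one)
      have "2 * M\<^sup>2 * (s - t) + 2 * M\<^sup>2 * \<beta>\<^sup>2 * e \<le> 2 * M\<^sup>2 * T + 2 * M\<^sup>2 * \<beta>\<^sup>2 * e"
        using sT by (intro add_right_mono mult_left_mono) auto
      note f3 = order_trans[OF int ennreal_leI[OF this]]
      have f4: "ennreal (4 * \<kappa> * M\<^sup>2 * (s - t)) \<le> ennreal (4 * \<kappa> * M\<^sup>2 * T)"
        using sT \<kappa>(1) by (intro ennreal_leI mult_left_mono) auto
      have f5: "ennreal (s - t) \<le> ennreal T" using sT by (intro ennreal_leI)
      show ?thesis by (intro add_mono mult_mono f1 f2 f3 f4 f5) auto
    qed
    also have "\<dots> = ennreal (3 * (norm x)\<^sup>2 + 3 * (T * (2 * M\<^sup>2 * T + 2 * M\<^sup>2 * \<beta>\<^sup>2 * e) + 4 * \<kappa> * M\<^sup>2 * T))"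
      using T \<kappa>(1) e0 by (simp add: ennreal_mult[symmetric] del: ennreal_plus flip: ennreal_plus ennreal_numeral)
    also have "3 * (norm x)\<^sup>2 + 3 * (T * (2 * M\<^sup>2 * T + 2 * M\<^sup>2 * \<beta>\<^sup>2 * e) + 4 * \<kappa> * M\<^sup>2 * T) = a + b * e"
      unfolding a_def b_def by (simp add: power2_eq_square algebra_simps)
    finally show "(\<integral>\<^sup>+\<omega>. ennreal ((norm (X s \<omega>))\<^sup>2) * indicator (\<Omega> m) \<omega> \<partial>P) \<le> ennreal (a + b * (q * exp (c * (s - t)) / c))"
      unfolding e_def by simp
  qed
  have [measurable]: "X s \<in> borel_measurable P" by (rule mild_measurable[OF X s])
  \<comment> \<open>Each path is bounded and so belongs to some \<open>\<Omega> m\<close>. The bound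
    obtained on \<open>\<Omega> m\<close> does not depend on m and passes to the limit by monotone
    convergence.\<close>
  have "(\<integral>\<^sup>+\<omega>. ennreal ((norm (X s \<omega>))\<^sup>2) \<partial>P) = (\<integral>\<^sup>+\<omega>. (SUP m. ennreal ((norm (X s \<omega>))\<^sup>2) * indicator (\<Omega> m) \<omega>) \<partial>P)"
  proof (rule nn_integral_cong)
    fix \<omega> assume \<omega>: "\<omega> \<in> space P"
    obtain b where b: "\<And>r. r \<in> {t..T} \<Longrightarrow> norm (X r \<omega>) \<le> b"
      using cadlag_on_bounded[OF mild_cadlag[OF X \<omega>]] by blast
    obtain m :: nat where "b \<le> real m" using real_arch_simple by blast
    then have "\<omega> \<in> \<Omega> m" unfolding \<Omega>_def using \<omega> b DT order_trans by blast
    then have "ennreal ((norm (X s \<omega>))\<^sup>2) \<le> ennreal ((norm (X s \<omega>))\<^sup>2) * indicator (\<Omega> m) \<omega>" by simp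
    then show "ennreal ((norm (X s \<omega>))\<^sup>2) = (SUP m. ennreal ((norm (X s \<omega>))\<^sup>2) * indicator (\<Omega> m) \<omega>)"
      by (intro antisym SUP_upper2[of m] SUP_least) (auto simp: indicator_def)
  qed
  also have "\<dots> = (SUP m. \<integral>\<^sup>+\<omega>. ennreal ((norm (X s \<omega>))\<^sup>2) * indicator (\<Omega> m) \<omega> \<partial>P)"
  proof (rule nn_integral_monotone_convergence_SUP)
    show "incseq (\<lambda>m \<omega>. ennreal ((norm (X s \<omega>))\<^sup>2) * indicator (\<Omega> m) \<omega>)"
    proof (rule incseq_SucI, rule le_funI)
      fix m \<omega>
      have "\<Omega> m \<subseteq> \<Omega> (Suc m)" unfolding \<Omega>_def by force
      then show "ennreal ((norm (X s \<omega>))\<^sup>2) * indicator (\<Omega> m) \<omega> \<le> ennreal ((norm (X s \<omega>))\<^sup>2) * indicator (\<Omega> (Suc m)) \<omega>"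
        by (auto simp: indicator_def)
    qed
  qed measurable
  also have "\<dots> \<le> ennreal (2 * a * exp (c * (s - t)))" by (rule SUP_least) (rule fin[OF s])
  also have "\<dots> \<le> ennreal (apriori_const (norm x))"
  proof (rule ennreal_leI)
    have "exp (c * (s - t)) \<le> exp (c * T)" using s t b0 by (simp add: c_def mult_left_mono)
    then have "2 * a * exp (c * (s - t)) \<le> 2 * a * exp (c * T)" using a0 by (intro mult_left_mono) auto
    then show "2 * a * exp (c * (s - t)) \<le> apriori_const (norm x)"
      unfolding apriori_const_def a_def c_def b_def by (simp add: mult_ac)
  qed
  finally show ?thesis .
qed

text \<open>The semigroup term is kept as it stands, since it is later estimated with a rate in the
  weak norm and with a modulus in the strong one.\<close>

lemma mild_increment:
  fixes Q :: "'a \<Rightarrow>\<^sub>L 'a"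
  assumes X: "mild t x X" and s: "s \<in> {t..T}"
  shows "(\<integral>\<^sup>+\<omega>. ennreal ((norm (Q (X s \<omega> - x)))\<^sup>2) \<partial>P)
    \<le> ennreal (3 * (norm (Q (S (s - t) x - x)))\<^sup>2 + (norm Q)\<^sup>2 * increment_const (norm x) * (s - t))"
proof -
  define C where "C = 2 * M\<^sup>2 + 2 * M\<^sup>2 * \<beta>\<^sup>2 * apriori_const (norm x)"
  have C0: "0 \<le> C" unfolding C_def using apriori_const_nonneg[of "norm x"] by simp
  have st: "0 \<le> s - t" "s - t \<le> T" using s t by auto
  have FX: "(\<integral>\<^sup>+\<omega>. ennreal ((norm (F (X \<tau> \<omega>)))\<^sup>2) * indicator (space P) \<omega> \<partial>P) \<le> ennreal C" if \<tau>: "\<tau> \<in> {t..T}" for \<tau>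
  proof -
    have [measurable]: "X \<tau> \<in> borel_measurable P" by (rule mild_measurable[OF X \<tau>])
    have "(\<integral>\<^sup>+\<omega>. ennreal ((norm (F (X \<tau> \<omega>)))\<^sup>2) * indicator (space P) \<omega> \<partial>P)
        \<le> (\<integral>\<^sup>+\<omega>. ennreal (2 * M\<^sup>2) + ennreal (2 * M\<^sup>2 * \<beta>\<^sup>2) * ennreal ((norm (X \<tau> \<omega>))\<^sup>2) \<partial>P)"
    proof (rule nn_integral_mono)
      fix \<omega>
      have "ennreal ((norm (F (X \<tau> \<omega>)))\<^sup>2) \<le> ennreal (2 * M\<^sup>2) + ennreal (2 * M\<^sup>2 * \<beta>\<^sup>2) * ennreal ((norm (X \<tau> \<omega>))\<^sup>2)"
        using ennreal_leI[OF F_growth[of "X \<tau> \<omega>"]] by (simp add: ennreal_mult[symmetric] del: ennreal_plus flip: ennreal_plus)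
      then show "ennreal ((norm (F (X \<tau> \<omega>)))\<^sup>2) * indicator (space P) \<omega>
          \<le> ennreal (2 * M\<^sup>2) + ennreal (2 * M\<^sup>2 * \<beta>\<^sup>2) * ennreal ((norm (X \<tau> \<omega>))\<^sup>2)"
        by (auto simp: indicator_def)
    qed
    also have "\<dots> = ennreal (2 * M\<^sup>2) + ennreal (2 * M\<^sup>2 * \<beta>\<^sup>2) * (\<integral>\<^sup>+\<omega>. ennreal ((norm (X \<tau> \<omega>))\<^sup>2) \<partial>P)"
      by (simp add: nn_integral_add nn_integral_cmult emeasure_space_1)
    also have "\<dots> \<le> ennreal (2 * M\<^sup>2) + ennreal (2 * M\<^sup>2 * \<beta>\<^sup>2) * ennreal (apriori_const (norm x))"
      by (intro add_left_mono mult_left_mono mild_second_moment[OF X \<tau>]) auto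
    also have "\<dots> = ennreal C" unfolding C_def using apriori_const_nonneg[of "norm x"]
      by (simp add: ennreal_mult[symmetric] del: ennreal_plus flip: ennreal_plus)
    finally show ?thesis .
  qed
  have int: "(\<integral>\<^sup>+\<tau>\<in>{t..s}. (\<integral>\<^sup>+\<omega>. ennreal ((norm (F (X \<tau> \<omega>)))\<^sup>2) * indicator (space P) \<omega> \<partial>P) \<partial>lborel) \<le> ennreal (C * T)"
  proof -
    have "(\<integral>\<^sup>+\<tau>\<in>{t..s}. (\<integral>\<^sup>+\<omega>. ennreal ((norm (F (X \<tau> \<omega>)))\<^sup>2) * indicator (space P) \<omega> \<partial>P) \<partial>lborel)
        \<le> (\<integral>\<^sup>+\<tau>. ennreal C * indicator {t..s} \<tau> \<partial>lborel)"
      using FX s by (intro nn_integral_mono) (auto simp: indicator_def)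
    also have "\<dots> = ennreal (C * (s - t))" using C0 st by (simp add: nn_integral_cmult_indicator ennreal_mult)
    \<comment> \<open>Cauchy-Schwarz gives the drift the factor (s - t)^2; one factor is bounded by
      T here, the other is the rate.\<close>
    also have "\<dots> \<le> ennreal (C * T)" using C0 st by (intro ennreal_leI mult_left_mono) auto
    finally show ?thesis .
  qed
  have "(\<integral>\<^sup>+\<omega>. ennreal ((norm (Q (X s \<omega> - x)))\<^sup>2) \<partial>P) = (\<integral>\<^sup>+\<omega>. ennreal ((norm (Q (X s \<omega> - x)))\<^sup>2) * indicator (space P) \<omega> \<partial>P)"
    by (intro nn_integral_cong) simp
  also have "\<dots> \<le> 3 * ennreal ((norm (Q (S (s - t) x - x)))\<^sup>2) + 3 * (ennreal ((norm Q)\<^sup>2) *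
        (ennreal (s - t) * (\<integral>\<^sup>+\<tau>\<in>{t..s}. (\<integral>\<^sup>+\<omega>. ennreal ((norm (F (X \<tau> \<omega>)))\<^sup>2) * indicator (space P) \<omega> \<partial>P) \<partial>lborel)
          + ennreal (4 * \<kappa> * M\<^sup>2 * (s - t))))"
    by (rule mild_estimate[OF X s]) simp
  also have "\<dots> \<le> 3 * ennreal ((norm (Q (S (s - t) x - x)))\<^sup>2) + 3 * (ennreal ((norm Q)\<^sup>2) *
        (ennreal (s - t) * ennreal (C * T) + ennreal (4 * \<kappa> * M\<^sup>2 * (s - t))))"
    by (intro add_mono mult_left_mono int order_refl) auto
  also have "\<dots> = ennreal (3 * (norm (Q (S (s - t) x - x)))\<^sup>2 + 3 * ((norm Q)\<^sup>2 * ((s - t) * (C * T) + 4 * \<kappa> * M\<^sup>2 * (s - t))))"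
    using T \<kappa>(1) C0 st by (simp add: ennreal_mult[symmetric] del: ennreal_plus flip: ennreal_plus ennreal_numeral)
  also have "3 * ((norm Q)\<^sup>2 * ((s - t) * (C * T) + 4 * \<kappa> * M\<^sup>2 * (s - t))) = (norm Q)\<^sup>2 * increment_const (norm x) * (s - t)"
    unfolding increment_const_def C_def by (simp add: algebra_simps)
  finally show ?thesis .
qed

text \<open>The noise integrand sees X(\<tau>-), whereas the Gronwall hypothesis controls X at fixed
  times. Fatou's lemma along grid points to the left of \<tau> bridges the two.\<close>

lemma mild_left_limit_moment:
  assumes X: "mild t x X" and Y: "mild t y Y" and \<tau>: "t < \<tau>" "\<tau> \<le> T"
    and h: "\<And>r. r \<in> {t..T} \<Longrightarrow> r \<le> \<tau> \<Longrightarrow> (\<integral>\<^sup>+\<omega>. ennreal ((norm_m1 B (X r \<omega> - Y r \<omega>))\<^sup>2) \<partial>P) \<le> C"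
  shows "(\<integral>\<^sup>+\<omega>. ennreal ((norm_m1 B (left_lim X \<tau> \<omega> - left_lim Y \<tau> \<omega>))\<^sup>2) \<partial>P) \<le> C"
proof -
  define r where "r k = clamp_time t T ((of_int \<lceil>real (Suc k) * \<tau>\<rceil> - 1) / real (Suc k))" for k
  have r1: "r k \<in> {t..T}" for k unfolding r_def by (rule clamp_time_simps(1)[OF t(2)])
  have r2: "r k < \<tau>" for k
    using grid_approx(4)[of k \<tau>] \<tau> unfolding r_def clamp_time_def by (auto simp: min_def)
  have "r \<longlonglongrightarrow> clamp_time t T \<tau>"
    unfolding r_def clamp_time_def by (intro tendsto_max tendsto_min tendsto_const grid_approx(3))
  then have r3: "r \<longlonglongrightarrow> \<tau>" using \<tau> by (simp add: clamp_time_simps)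
  have [measurable]: "X (r k) \<in> borel_measurable P" "Y (r k) \<in> borel_measurable P" for k
    using mild_measurable[OF X r1] mild_measurable[OF Y r1] by auto
  have "(\<integral>\<^sup>+\<omega>. ennreal ((norm_m1 B (left_lim X \<tau> \<omega> - left_lim Y \<tau> \<omega>))\<^sup>2) \<partial>P)
      = (\<integral>\<^sup>+\<omega>. liminf (\<lambda>k. ennreal ((norm_m1 B (X (r k) \<omega> - Y (r k) \<omega>))\<^sup>2)) \<partial>P)"
  proof (rule nn_integral_cong)
    fix \<omega> assume \<omega>: "\<omega> \<in> space P"
    have "(\<lambda>k. ennreal ((norm_m1 B (X (r k) \<omega> - Y (r k) \<omega>))\<^sup>2))
        \<longlonglongrightarrow> ennreal ((norm_m1 B (left_lim X \<tau> \<omega> - left_lim Y \<tau> \<omega>))\<^sup>2)"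
      unfolding norm_m1_def
      by (intro tendsto_ennrealI tendsto_intros
          left_lim_eq[where X=X and \<omega>=\<omega>, OF mild_cadlag[OF X \<omega>] \<tau> r1 r2 r3]
          left_lim_eq[where X=Y and \<omega>=\<omega>, OF mild_cadlag[OF Y \<omega>] \<tau> r1 r2 r3])
    from lim_imp_Liminf[OF _ this]
    show "ennreal ((norm_m1 B (left_lim X \<tau> \<omega> - left_lim Y \<tau> \<omega>))\<^sup>2)
        = liminf (\<lambda>k. ennreal ((norm_m1 B (X (r k) \<omega> - Y (r k) \<omega>))\<^sup>2))" by simp
  qed
  also have "\<dots> \<le> liminf (\<lambda>k. \<integral>\<^sup>+\<omega>. ennreal ((norm_m1 B (X (r k) \<omega> - Y (r k) \<omega>))\<^sup>2) \<partial>P)"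
    unfolding norm_m1_def by (rule nn_integral_liminf) measurable
  also have "\<dots> \<le> C"
    by (rule order_trans[OF Liminf_le_Limsup]) (auto intro!: Limsup_bounded always_eventually h r1 less_imp_le[OF r2])
  finally show ?thesis .
qed

text \<open>The Lipschitz bounds turn differences of F and G into weak norms of the difference of
  solutions, S contracts in the strong norm, and applying the root of B costs \<beta>^2. Only S(s -
  t)(x - y) is estimated by \<gamma>, which produces the weak norm of x - y on the right.\<close>

lemma mild_lipschitz:
  assumes X: "mild t x X" and Y: "mild t y Y" and s: "s \<in> {t..T}"
  shows "(\<integral>\<^sup>+\<omega>. ennreal ((norm_m1 B (X s \<omega> - Y s \<omega>))\<^sup>2) \<partial>P) \<le> ennreal (lipschitz_const * (norm_m1 B (x - y))\<^sup>2)"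
proof -
  interpret PL: pair_sigma_finite P "lborel :: real measure" by unfold_locales
  define \<phi> where "\<phi> r = (\<integral>\<^sup>+\<omega>. ennreal ((norm_m1 B (X r \<omega> - Y r \<omega>))\<^sup>2) \<partial>P)" for r
  define a where "a = 3 * (\<gamma> * norm_m1 B (x - y))\<^sup>2"
  define b where "b = 3 * \<beta>\<^sup>2 * M\<^sup>2 * T + 12 * \<beta>\<^sup>2 * \<kappa> * M\<^sup>2"
  define c where "c = 2 * b + 1"
  have a0: "0 \<le> a" and b0: "0 \<le> b" unfolding a_def b_def using T \<kappa>(1) by auto
  have c0: "0 < c" "2 * b \<le> c" unfolding c_def using b0 by auto
  note [measurable] = mild_joint[OF X] mild_joint[OF Y]
  have m1 [measurable]: "norm_m1 B \<in> borel_measurable borel" unfolding norm_m1_def[abs_def] by measurable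
  \<comment> \<open>A crude starting value for the iteration, finite by the a priori bound; it does
    not appear in the result.\<close>
  define K where "K = \<beta>\<^sup>2 * (2 * apriori_const (norm x) + 2 * apriori_const (norm y))"
  have K0: "0 \<le> K" unfolding K_def using apriori_const_nonneg by simp
  have "\<phi> s \<le> ennreal (2 * a * exp (c * (s - t)))"
  proof (rule gronwall_weighted[where \<phi>=\<phi> and K=K and b=b, OF a0 b0 c0 K0 _ _ s])
    show "\<phi> r \<le> ennreal K" if r: "r \<in> {t..T}" for r
    proof -
      have [measurable]: "X r \<in> borel_measurable P" "Y r \<in> borel_measurable P"
        using mild_measurable[OF X r] mild_measurable[OF Y r] by auto
      have "\<phi> r \<le> (\<integral>\<^sup>+\<omega>. ennreal (\<beta>\<^sup>2) * (2 * ennreal ((norm (X r \<omega>))\<^sup>2) + 2 * ennreal ((norm (Y r \<omega>))\<^sup>2)) \<partial>P)"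
        unfolding \<phi>_def norm_m1_def
      proof (intro nn_integral_mono order_trans[OF norm_blinfun_sq_ennreal] mult_left_mono)
        fix \<omega>
        show "ennreal ((norm (X r \<omega> - Y r \<omega>))\<^sup>2) \<le> 2 * ennreal ((norm (X r \<omega>))\<^sup>2) + 2 * ennreal ((norm (Y r \<omega>))\<^sup>2)"
          using sq_norm_add_le_ennreal[of "X r \<omega>" "- Y r \<omega>"] by simp
      qed simp
      also have "\<dots> = ennreal (\<beta>\<^sup>2) * (2 * (\<integral>\<^sup>+\<omega>. ennreal ((norm (X r \<omega>))\<^sup>2) \<partial>P) + 2 * (\<integral>\<^sup>+\<omega>. ennreal ((norm (Y r \<omega>))\<^sup>2) \<partial>P))"
        by (simp add: nn_integral_add nn_integral_cmult)
      also have "\<dots> \<le> ennreal (\<beta>\<^sup>2) * (2 * ennreal (apriori_const (norm x)) + 2 * ennreal (apriori_const (norm y)))"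
        by (intro mult_left_mono add_mono mild_second_moment[OF X r] mild_second_moment[OF Y r]) auto
      also have "\<dots> = ennreal K"
        unfolding K_def using apriori_const_nonneg
        by (simp add: ennreal_mult[symmetric] del: ennreal_plus flip: ennreal_plus ennreal_numeral)
      finally show ?thesis .
    qed
    fix q s assume q: "0 \<le> q" and s: "s \<in> {t..T}"
      and h: "\<And>r. r \<in> {t..T} \<Longrightarrow> \<phi> r \<le> ennreal (q * exp (c * (r - t)))"
    have ts: "t \<le> s" and sT: "0 \<le> s - t" "s - t \<le> T" using s t by auto
    define e where "e = q * exp (c * (s - t)) / c"
    have e0: "0 \<le> e" unfolding e_def using q c0 by simp
    obtain Z where Z: "has_stoch_integral P \<F> \<mu> N t s (\<lambda>\<tau> \<omega>. S (s - \<tau>) o\<^sub>L G (left_lim X \<tau> \<omega>)) Z"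
      and eqX: "AE \<omega> in P. X s \<omega> = S (s - t) x + (LINT \<tau>:{t..s}|lborel. S (s - \<tau>) (F (X \<tau> \<omega>))) + Z \<omega>"
      using X s unfolding mild_solution_def by blast
    obtain W where W: "has_stoch_integral P \<F> \<mu> N t s (\<lambda>\<tau> \<omega>. S (s - \<tau>) o\<^sub>L G (left_lim Y \<tau> \<omega>)) W"
      and eqY: "AE \<omega> in P. Y s \<omega> = S (s - t) y + (LINT \<tau>:{t..s}|lborel. S (s - \<tau>) (F (Y \<tau> \<omega>))) + W \<omega>"
      using Y s unfolding mild_solution_def by blast
    have [measurable]: "Z \<in> borel_measurable P" "W \<in> borel_measurable P"
      using Z W unfolding has_stoch_integral_def by auto
    have ZW: "(\<integral>\<^sup>+\<omega>. ennreal ((norm (Z \<omega> - W \<omega>))\<^sup>2) \<partial>P) \<le> ennreal (4 * \<kappa> * M\<^sup>2 * e)"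
    proof -
      let ?XL = "\<lambda>\<omega> \<tau>. if t < \<tau> \<and> \<tau> \<le> T then left_lim X \<tau> \<omega> else 0"
      let ?YL = "\<lambda>\<omega> \<tau>. if t < \<tau> \<and> \<tau> \<le> T then left_lim Y \<tau> \<omega> else 0"
      \<comment> \<open>A measurable majorant of the squared operator norm, built from left limits
        set to 0 outside (t,T]; the Lipschitz bound of G replaces operators by weak norms.\<close>
      define g where "g \<omega> \<tau> = ennreal (M\<^sup>2) * ennreal ((norm_m1 B (?XL \<omega> \<tau> - ?YL \<omega> \<tau>))\<^sup>2)" for \<omega> \<tau>
      have gm [measurable]: "(\<lambda>(\<omega>, \<tau>). g \<omega> \<tau>) \<in> borel_measurable (P \<Otimes>\<^sub>M lborel)" unfolding g_def by measurable
      have bd: "ennreal ((norm ((S (s - \<tau>) o\<^sub>L G (left_lim X \<tau> \<omega>)) - (S (s - \<tau>) o\<^sub>L G (left_lim Y \<tau> \<omega>))))\<^sup>2) \<le> g \<omega> \<tau>"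
        if \<tau>: "\<tau> \<in> {t<..s}" for \<tau> \<omega>
      proof -
        let ?d = "norm_m1 B (left_lim X \<tau> \<omega> - left_lim Y \<tau> \<omega>)"
        have n1: "norm (S (s - \<tau>)) \<le> 1" using S \<tau> unfolding contraction_C0_semigroup_def by auto
        have "(S (s - \<tau>) o\<^sub>L G (left_lim X \<tau> \<omega>)) - (S (s - \<tau>) o\<^sub>L G (left_lim Y \<tau> \<omega>))
            = S (s - \<tau>) o\<^sub>L (G (left_lim X \<tau> \<omega>) - G (left_lim Y \<tau> \<omega>))"
          by (rule blinfun_eqI) (simp add: blinfun.diff_left blinfun.diff_right)
        also have "norm \<dots> \<le> norm (S (s - \<tau>)) * norm (G (left_lim X \<tau> \<omega>) - G (left_lim Y \<tau> \<omega>))"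
          by (rule norm_blinfun_compose)
        also have "\<dots> \<le> 1 * (M * ?d)" by (intro mult_mono n1 G_lip) auto
        finally have "(norm ((S (s - \<tau>) o\<^sub>L G (left_lim X \<tau> \<omega>)) - (S (s - \<tau>) o\<^sub>L G (left_lim Y \<tau> \<omega>))))\<^sup>2 \<le> (M * ?d)\<^sup>2"
          by (intro power_mono) auto
        moreover have "g \<omega> \<tau> = ennreal ((M * ?d)\<^sup>2)"
          using \<tau> s unfolding g_def by (simp add: power_mult_distrib ennreal_mult)
        ultimately show ?thesis by (simp add: ennreal_leI)
      qed
      have "(\<integral>\<^sup>+\<omega>. ennreal ((norm (Z \<omega> - W \<omega>))\<^sup>2) \<partial>P)
          \<le> 4 * energy t s (\<lambda>\<tau> \<omega>. (S (s - \<tau>) o\<^sub>L G (left_lim X \<tau> \<omega>)) - (S (s - \<tau>) o\<^sub>L G (left_lim Y \<tau> \<omega>)))"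
        by (rule has_stoch_integral_norm_le[OF t(1) has_stoch_integral_diff[OF t(1) Z W]])
      also have "\<dots> \<le> 4 * (ennreal \<kappa> * (\<integral>\<^sup>+\<omega>. (\<integral>\<^sup>+\<tau>\<in>{t<..s}. g \<omega> \<tau> \<partial>lborel) \<partial>P))"
        by (intro mult_left_mono energy_le bd gm) auto
      also have "(\<integral>\<^sup>+\<omega>. (\<integral>\<^sup>+\<tau>\<in>{t<..s}. g \<omega> \<tau> \<partial>lborel) \<partial>P) = (\<integral>\<^sup>+\<tau>. (\<integral>\<^sup>+\<omega>. g \<omega> \<tau> * indicator {t<..s} \<tau> \<partial>P) \<partial>lborel)"
        by (rule PL.Fubini'[symmetric]) measurable
      also have "\<dots> \<le> (\<integral>\<^sup>+\<tau>. ennreal (M\<^sup>2) * (ennreal (q * exp (c * (\<tau> - t))) * indicator {t..s} \<tau>) \<partial>lborel)"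
      proof (rule nn_integral_mono)
        fix \<tau>
        show "(\<integral>\<^sup>+\<omega>. g \<omega> \<tau> * indicator {t<..s} \<tau> \<partial>P) \<le> ennreal (M\<^sup>2) * (ennreal (q * exp (c * (\<tau> - t))) * indicator {t..s} \<tau>)"
        proof (cases "\<tau> \<in> {t<..s}")
          case True
          then have \<tau>: "t < \<tau>" "\<tau> \<le> T" "\<tau> \<le> s" using s by auto
          have "(\<lambda>\<omega>. ?XL \<omega> \<tau>) \<in> borel_measurable P" "(\<lambda>\<omega>. ?YL \<omega> \<tau>) \<in> borel_measurable P"
            using measurable_compose[OF measurable_Pair2'[of \<tau> lborel P] mild_joint(2)[OF X]]
              measurable_compose[OF measurable_Pair2'[of \<tau> lborel P] mild_joint(2)[OF Y]] by auto
          then have [measurable]: "left_lim X \<tau> \<in> borel_measurable P" "left_lim Y \<tau> \<in> borel_measurable P"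
            using \<tau> by auto
          have "(\<integral>\<^sup>+\<omega>. g \<omega> \<tau> * indicator {t<..s} \<tau> \<partial>P)
              = (\<integral>\<^sup>+\<omega>. ennreal (M\<^sup>2) * ennreal ((norm_m1 B (left_lim X \<tau> \<omega> - left_lim Y \<tau> \<omega>))\<^sup>2) \<partial>P)"
            unfolding g_def using True \<tau> by simp
          also have "\<dots> = ennreal (M\<^sup>2) * (\<integral>\<^sup>+\<omega>. ennreal ((norm_m1 B (left_lim X \<tau> \<omega> - left_lim Y \<tau> \<omega>))\<^sup>2) \<partial>P)"
            by (rule nn_integral_cmult) measurable
          also have "\<dots> \<le> ennreal (M\<^sup>2) * ennreal (q * exp (c * (\<tau> - t)))"
          proof (intro mult_left_mono mild_left_limit_moment[OF X Y \<tau>(1,2)])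
            fix r assume r: "r \<in> {t..T}" "r \<le> \<tau>"
            \<comment> \<open>The exponential weight increases with time, so its value at \<tau>
              covers all earlier times that enter the left limit.\<close>
            have "ennreal (q * exp (c * (r - t))) \<le> ennreal (q * exp (c * (\<tau> - t)))"
              using r q c0 by (intro ennreal_leI mult_left_mono) auto
            with h[OF r(1)] show "(\<integral>\<^sup>+\<omega>. ennreal ((norm_m1 B (X r \<omega> - Y r \<omega>))\<^sup>2) \<partial>P) \<le> ennreal (q * exp (c * (\<tau> - t)))"
              unfolding \<phi>_def by (rule order_trans)
          qed simp
          finally show ?thesis using True by simp
        next
          case False
          then show ?thesis by simp
        qed
      qed
      also have "\<dots> = ennreal (M\<^sup>2) * (\<integral>\<^sup>+\<tau>\<in>{t..s}. ennreal (q * exp (c * (\<tau> - t))) \<partial>lborel)"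
        by (rule nn_integral_cmult) measurable
      also have "\<dots> \<le> ennreal (M\<^sup>2) * ennreal e"
        unfolding e_def by (intro mult_left_mono nn_integral_exp_le q c0 ts) auto
      finally have "(\<integral>\<^sup>+\<omega>. ennreal ((norm (Z \<omega> - W \<omega>))\<^sup>2) \<partial>P) \<le> 4 * (ennreal \<kappa> * (ennreal (M\<^sup>2) * ennreal e))"
        by (simp add: mult_left_mono)
      also have "\<dots> = ennreal (4 * \<kappa> * M\<^sup>2 * e)"
        using \<kappa>(1) e0 by (simp add: ennreal_mult[symmetric] mult.assoc flip: ennreal_numeral)
      finally show ?thesis .
    qed
    define D where "D \<omega> = (\<integral>\<^sup>+\<tau>. ennreal (M\<^sup>2) * (ennreal ((norm_m1 B (X (clamp_time t T \<tau>) \<omega> - Y (clamp_time t T \<tau>) \<omega>))\<^sup>2)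
        * indicator {t..s} \<tau>) \<partial>lborel)" for \<omega>
    have Dm [measurable]: "D \<in> borel_measurable P" unfolding D_def by measurable
    have drift: "ennreal ((norm ((LINT \<tau>:{t..s}|lborel. S (s - \<tau>) (F (X \<tau> \<omega>))) - (LINT \<tau>:{t..s}|lborel. S (s - \<tau>) (F (Y \<tau> \<omega>)))))\<^sup>2)
        \<le> ennreal (s - t) * D \<omega>" if \<omega>: "\<omega> \<in> space P" for \<omega>
    proof -
      note iX = drift_integrable[OF X s \<omega>] and iY = drift_integrable[OF Y s \<omega>]
      have i: "set_integrable lborel {t..s} (\<lambda>\<tau>. S (s - \<tau>) (F (X \<tau> \<omega>)) - S (s - \<tau>) (F (Y \<tau> \<omega>)))"
        by (rule set_integral_diff(1)[OF iX iY])
      have "ennreal ((norm (LINT \<tau>:{t..s}|lborel. S (s - \<tau>) (F (X \<tau> \<omega>)) - S (s - \<tau>) (F (Y \<tau> \<omega>))))\<^sup>2)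
          \<le> ennreal (s - t) * (\<integral>\<^sup>+\<tau>\<in>{t..s}. ennreal ((norm (S (s - \<tau>) (F (X \<tau> \<omega>)) - S (s - \<tau>) (F (Y \<tau> \<omega>))))\<^sup>2) \<partial>lborel)"
        using i unfolding set_integrable_def by (intro set_integral_norm_sq_le[OF ts]) auto
      also have "\<dots> \<le> ennreal (s - t) * D \<omega>"
        unfolding D_def
      proof (intro mult_left_mono nn_integral_mono)
        fix \<tau>
        show "ennreal ((norm (S (s - \<tau>) (F (X \<tau> \<omega>)) - S (s - \<tau>) (F (Y \<tau> \<omega>))))\<^sup>2) * indicator {t..s} \<tau>
            \<le> ennreal (M\<^sup>2) * (ennreal ((norm_m1 B (X (clamp_time t T \<tau>) \<omega> - Y (clamp_time t T \<tau>) \<omega>))\<^sup>2) * indicator {t..s} \<tau>)"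
        proof (cases "\<tau> \<in> {t..s}")
          case True
          then have cl: "clamp_time t T \<tau> = \<tau>" using s by (intro clamp_time_simps) auto
          have "norm (S (s - \<tau>) (F (X \<tau> \<omega>)) - S (s - \<tau>) (F (Y \<tau> \<omega>))) \<le> norm (F (X \<tau> \<omega>) - F (Y \<tau> \<omega>))"
            using semigroup_norm_le[OF S, of "s - \<tau>" "F (X \<tau> \<omega>) - F (Y \<tau> \<omega>)"] True by (simp add: blinfun.diff_right)
          also have "\<dots> \<le> M * norm_m1 B (X \<tau> \<omega> - Y \<tau> \<omega>)" by (rule F_lip)
          finally have "(norm (S (s - \<tau>) (F (X \<tau> \<omega>)) - S (s - \<tau>) (F (Y \<tau> \<omega>))))\<^sup>2 \<le> M\<^sup>2 * (norm_m1 B (X \<tau> \<omega> - Y \<tau> \<omega>))\<^sup>2"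
            unfolding power_mult_distrib[symmetric] by (intro power_mono) auto
          then show ?thesis using True by (simp add: cl ennreal_mult[symmetric] ennreal_leI)
        next
          case False
          then show ?thesis by simp
        qed
      qed simp
      finally show ?thesis unfolding set_integral_diff(2)[OF iX iY] .
    qed
    have ED: "(\<integral>\<^sup>+\<omega>. D \<omega> \<partial>P) \<le> ennreal (M\<^sup>2 * e)"
    proof -
      have "(\<integral>\<^sup>+\<omega>. D \<omega> \<partial>P) = (\<integral>\<^sup>+\<tau>. (\<integral>\<^sup>+\<omega>. ennreal (M\<^sup>2) * (ennreal ((norm_m1 B (X (clamp_time t T \<tau>) \<omega> - Y (clamp_time t T \<tau>) \<omega>))\<^sup>2)
          * indicator {t..s} \<tau>) \<partial>P) \<partial>lborel)"
        unfolding D_def by (rule PL.Fubini'[symmetric]) measurable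
      also have "\<dots> \<le> (\<integral>\<^sup>+\<tau>. ennreal (M\<^sup>2) * (ennreal (q * exp (c * (\<tau> - t))) * indicator {t..s} \<tau>) \<partial>lborel)"
      proof (rule nn_integral_mono)
        fix \<tau>
        show "(\<integral>\<^sup>+\<omega>. ennreal (M\<^sup>2) * (ennreal ((norm_m1 B (X (clamp_time t T \<tau>) \<omega> - Y (clamp_time t T \<tau>) \<omega>))\<^sup>2)
          * indicator {t..s} \<tau>) \<partial>P) \<le> ennreal (M\<^sup>2) * (ennreal (q * exp (c * (\<tau> - t))) * indicator {t..s} \<tau>)"
        proof (cases "\<tau> \<in> {t..s}")
          case True
          then have \<tau>: "\<tau> \<in> {t..T}" using s by auto
          have [measurable]: "X \<tau> \<in> borel_measurable P" "Y \<tau> \<in> borel_measurable P"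
            using mild_measurable[OF X \<tau>] mild_measurable[OF Y \<tau>] by auto
          have "(\<integral>\<^sup>+\<omega>. ennreal (M\<^sup>2) * (ennreal ((norm_m1 B (X (clamp_time t T \<tau>) \<omega> - Y (clamp_time t T \<tau>) \<omega>))\<^sup>2)
            * indicator {t..s} \<tau>) \<partial>P) = ennreal (M\<^sup>2) * \<phi> \<tau>"
            unfolding \<phi>_def using True \<tau> by (simp add: clamp_time_simps nn_integral_cmult)
          also have "\<dots> \<le> ennreal (M\<^sup>2) * ennreal (q * exp (c * (\<tau> - t)))" by (intro mult_left_mono h \<tau>) simp
          finally show ?thesis using True by simp
        next
          case False
          then show ?thesis by simp
        qed
      qed
      also have "\<dots> = ennreal (M\<^sup>2) * (\<integral>\<^sup>+\<tau>\<in>{t..s}. ennreal (q * exp (c * (\<tau> - t))) \<partial>lborel)"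
        by (rule nn_integral_cmult) measurable
      also have "\<dots> \<le> ennreal (M\<^sup>2) * ennreal e"
        unfolding e_def by (intro mult_left_mono nn_integral_exp_le q c0 ts) auto
      also have "\<dots> = ennreal (M\<^sup>2 * e)" using e0 by (simp add: ennreal_mult)
      finally show ?thesis .
    qed
    let ?u = "ennreal ((\<gamma> * norm_m1 B (x - y))\<^sup>2)"
    let ?q = "ennreal (\<beta>\<^sup>2)"
    have "\<phi> s \<le> (\<integral>\<^sup>+\<omega>. 3 * ?u + 3 * (?q * (ennreal T * D \<omega> + ennreal ((norm (Z \<omega> - W \<omega>))\<^sup>2))) \<partial>P)"
      unfolding \<phi>_def
    proof (rule nn_integral_mono_AE)
      show "AE \<omega> in P. ennreal ((norm_m1 B (X s \<omega> - Y s \<omega>))\<^sup>2)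
          \<le> 3 * ?u + 3 * (?q * (ennreal T * D \<omega> + ennreal ((norm (Z \<omega> - W \<omega>))\<^sup>2)))"
        using eqX eqY AE_space
      proof eventually_elim
        case (elim \<omega>)
        let ?d = "(LINT \<tau>:{t..s}|lborel. S (s - \<tau>) (F (X \<tau> \<omega>))) - (LINT \<tau>:{t..s}|lborel. S (s - \<tau>) (F (Y \<tau> \<omega>)))"
        let ?R = "sqrt_op B"
        have e': "?R (X s \<omega> - Y s \<omega>) = ?R (S (s - t) (x - y)) + ?R ?d + ?R (Z \<omega> - W \<omega>)"
          unfolding elim(1,2) by (simp add: blinfun.add_right blinfun.diff_right)
        have "ennreal ((norm (?R (S (s - t) (x - y))))\<^sup>2) \<le> ?u"
          using \<gamma>(2)[OF sT, of "x - y"] unfolding norm_m1_def by (intro ennreal_leI power_mono) auto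
        moreover have "ennreal ((norm (?R ?d))\<^sup>2) \<le> ?q * (ennreal T * D \<omega>)"
          by (intro order_trans[OF norm_blinfun_sq_ennreal] mult_left_mono order_trans[OF drift[OF elim(3)]] mult_right_mono ennreal_leI sT) auto
        moreover have "ennreal ((norm (?R (Z \<omega> - W \<omega>)))\<^sup>2) \<le> ?q * ennreal ((norm (Z \<omega> - W \<omega>))\<^sup>2)"
          by (rule norm_blinfun_sq_ennreal)
        ultimately have "3 * ennreal ((norm (?R (S (s - t) (x - y))))\<^sup>2) + 3 * ennreal ((norm (?R ?d))\<^sup>2) + 3 * ennreal ((norm (?R (Z \<omega> - W \<omega>)))\<^sup>2)
            \<le> 3 * ?u + 3 * (?q * (ennreal T * D \<omega>)) + 3 * (?q * ennreal ((norm (Z \<omega> - W \<omega>))\<^sup>2))"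
          by (intro add_mono mult_left_mono) auto
        with sq_norm_add3_le_ennreal[of "?R (S (s - t) (x - y))" "?R ?d" "?R (Z \<omega> - W \<omega>)"]
        show ?case unfolding norm_m1_def e' by (simp add: distrib_left add.assoc)
      qed
    qed
    also have "\<dots> = 3 * ?u + 3 * (?q * (ennreal T * (\<integral>\<^sup>+\<omega>. D \<omega> \<partial>P) + (\<integral>\<^sup>+\<omega>. ennreal ((norm (Z \<omega> - W \<omega>))\<^sup>2) \<partial>P)))"
      by (simp add: nn_integral_add nn_integral_cmult emeasure_space_1)
    also have "\<dots> \<le> 3 * ?u + 3 * (?q * (ennreal T * ennreal (M\<^sup>2 * e) + ennreal (4 * \<kappa> * M\<^sup>2 * e)))"
      by (intro add_mono mult_left_mono ED ZW order_refl) auto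
    also have "\<dots> = ennreal (3 * (\<gamma> * norm_m1 B (x - y))\<^sup>2 + 3 * (\<beta>\<^sup>2 * (T * (M\<^sup>2 * e) + 4 * \<kappa> * M\<^sup>2 * e)))"
      using T \<kappa>(1) e0 by (simp add: ennreal_mult[symmetric] del: ennreal_plus flip: ennreal_plus ennreal_numeral)
    also have "3 * (\<gamma> * norm_m1 B (x - y))\<^sup>2 + 3 * (\<beta>\<^sup>2 * (T * (M\<^sup>2 * e) + 4 * \<kappa> * M\<^sup>2 * e)) = a + b * e"
      unfolding a_def b_def by (simp add: algebra_simps)
    finally show "\<phi> s \<le> ennreal (a + b * (q * exp (c * (s - t)) / c))" unfolding e_def .
  qed
  also have "\<dots> \<le> ennreal (lipschitz_const * (norm_m1 B (x - y))\<^sup>2)"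
  proof (rule ennreal_leI)
    have "exp (c * (s - t)) \<le> exp (c * T)" using s t c0 by (simp add: mult_left_mono)
    then have "2 * a * exp (c * (s - t)) \<le> 2 * a * exp (c * T)" using a0 by (intro mult_left_mono) auto
    then show "2 * a * exp (c * (s - t)) \<le> lipschitz_const * (norm_m1 B (x - y))\<^sup>2"
      unfolding lipschitz_const_def a_def c_def b_def by (simp add: mult_ac power_mult_distrib)
  qed
  finally show ?thesis unfolding \<phi>_def .
qed

end
end

section \<open>Moduli of continuity\<close>

text \<open>The squared increment of an orbit is continuous and vanishes at 0 but need not be
  monotone; the running supremum is the smallest monotone majorant and inherits the other two
  properties.\<close>

lemma running_sup:
  fixes h :: "real \<Rightarrow> real"
  assumes cont: "continuous_on {0..} h" and h0: "h 0 = 0" and pos: "\<And>r. 0 \<le> r \<Longrightarrow> 0 \<le> h r"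
  shows "modulus (\<lambda>r. Sup (h ` {0..r}))" and "\<And>r. 0 \<le> r \<Longrightarrow> h r \<le> Sup (h ` {0..r})"
proof -
  define m where "m r = Sup (h ` {0..r})" for r
  have bdd: "bdd_above (h ` {0..r})" for r
    using compact_continuous_image[OF continuous_on_subset[OF cont, of "{0..r}"]]
    by (intro bounded_imp_bdd_above compact_imp_bounded) auto
  have up: "h q \<le> m r" if "0 \<le> q" "q \<le> r" for q r
    unfolding m_def using that by (intro cSup_upper[OF _ bdd]) auto
  have least: "m r \<le> z" if "0 \<le> r" "\<And>q. 0 \<le> q \<Longrightarrow> q \<le> r \<Longrightarrow> h q \<le> z" for r z
    unfolding m_def using that by (intro cSup_least) auto
  have mono: "m u \<le> m v" if "0 \<le> u" "u \<le> v" for u v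
    using that by (intro least up) auto
  have "continuous_on {0..} m"
    unfolding continuous_on_iff
  proof (intro ballI allI impI)
    fix p e :: real assume p: "p \<in> {0..}" and e: "0 < e"
    have "0 < e / 3" using e by simp
    then obtain d where d: "0 < d" "\<And>q. q \<in> {0..} \<Longrightarrow> dist q p < d \<Longrightarrow> dist (h q) (h p) < e / 3"
      using cont p unfolding continuous_on_iff by meson
    \<comment> \<open>Beyond u the supremum can only grow through values of h near p. These are
      within 2 e / 3 of \<open>h u\<close>, which is at most \<open>m u\<close>.\<close>
    have step: "m v \<le> m u + 2 * (e / 3)" if "0 \<le> u" "u \<le> v" "dist u p < d" "dist v p < d" for u v
    proof (rule least)
      fix q assume q: "0 \<le> q" "q \<le> v"
      show "h q \<le> m u + 2 * (e / 3)"
      proof (cases "q \<le> u")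
        case True
        then show ?thesis using up[OF q(1) True] e by simp
      next
        case False
        then have "dist q p < d" using q that by (auto simp: dist_real_def)
        then have "dist (h q) (h p) < e / 3" "dist (h u) (h p) < e / 3" using d(2) q that by auto
        then show ?thesis using up[OF that(1) order_refl] unfolding dist_real_def by linarith
      qed
    qed (use that in auto)
    show "\<exists>d>0. \<forall>q\<in>{0..}. dist q p < d \<longrightarrow> dist (m q) (m p) < e"
    proof (intro exI[of _ d] conjI ballI impI d(1))
      fix q assume q: "q \<in> {0..}" "dist q p < d"
      have "dist p p < d" using d(1) by simp
      then have "m q \<le> m p + 2 * (e / 3) \<and> m p \<le> m q + 2 * (e / 3)"
        using step[of p q] step[of q p] mono[of p q] mono[of q p] q p e by (cases "p \<le> q") auto
      then show "dist (m q) (m p) < e" using e by (auto simp: dist_real_def)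
    qed
  qed
  moreover have "mono_on {0..} m" by (rule mono_onI) (use mono in auto)
  moreover have "0 \<le> m r" if "0 \<le> r" for r using up[of 0 r] that h0 by simp
  moreover have "m 0 = 0" unfolding m_def by (simp add: h0)
  ultimately show "modulus (\<lambda>r. Sup (h ` {0..r}))" unfolding modulus_def m_def by auto
  show "h r \<le> Sup (h ` {0..r})" if "0 \<le> r" for r using up[of r r] that unfolding m_def by simp
qed

lemma modulus_affine:
  assumes m: "modulus m" and a: "0 \<le> a" and b: "0 \<le> b"
  shows "modulus (\<lambda>r. a * m r + b * r)"
proof -
  have cont: "continuous_on {0..} m" and mono: "mono_on {0..} m" and pos: "\<And>r. 0 \<le> r \<Longrightarrow> 0 \<le> m r" and m0: "m 0 = 0"
    using m unfolding modulus_def by auto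
  have "continuous_on {0..} (\<lambda>r. a * m r + b * r)" by (intro continuous_intros cont)
  moreover have "mono_on {0..} (\<lambda>r. a * m r + b * r)"
  proof (rule mono_onI)
    fix u v :: real assume "u \<in> {0..}" "v \<in> {0..}" "u \<le> v"
    then show "a * m u + b * u \<le> a * m v + b * v"
      using a b mono_onD[OF mono] by (intro add_mono mult_left_mono) auto
  qed
  moreover have "0 \<le> a * m r + b * r" if "0 \<le> r" for r using a b pos[OF that] that by simp
  ultimately show ?thesis unfolding modulus_def using m0 by simp
qed

section \<open>Choice of the constants and of the modulus\<close>

theorem proposition3p5:
  fixes D :: "'a::{real_inner, banach, second_countable_topology} set"
    and A :: "'a \<Rightarrow> 'a"
    and S :: "real \<Rightarrow> 'a \<Rightarrow>\<^sub>L 'a"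
    and B :: "'a \<Rightarrow>\<^sub>L 'a"
    and F :: "'a \<Rightarrow> 'a"
    and G :: "'a \<Rightarrow> 'a \<Rightarrow>\<^sub>L 'a"
    and \<nu> :: "'a measure"
    and c0 M T :: real
  assumes "densely_defined_linear D A"
    and "maximal_monotone_graph (op_graph D A)"
    and "contraction_C0_semigroup S"
    and "generated_by_minus S D A"
    and "selfadjoint_op B"
    and "strictly_positive_op B"
    and "\<And>x. B x \<in> adj_dom D A"
    and "bounded_linear (\<lambda>x. adj_op D A (B x))"
    and "0 \<le> c0"
    and "\<And>x. 0 \<le> (adj_op D A (B x) + c0 *\<^sub>R B x) \<bullet> x"
    and "levy_measure2 \<nu>"
    and "0 < T"
    and "0 \<le> M"
    and "norm (F 0) \<le> M"
    and "\<And>x y. norm (F x - F y) \<le> M * norm_m1 B (x - y)"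
    and "\<And>x y. norm (G x - G y) \<le> M * norm_m1 B (x - y)"
    and "\<And>x. norm (G x) \<le> M"
    and "\<And>K::real. 0 < K \<Longrightarrow> (\<integral>\<^sup>+z. ennreal ((norm z)\<^sup>2 * exp (K * norm z)) \<partial>\<nu>) < \<infinity>"
  shows "\<exists>(C1::real) (C2 :: real \<Rightarrow> real) (w :: 'a \<Rightarrow> real \<Rightarrow> real).
    0 \<le> C1 \<and> (\<forall>r\<ge>0. 0 \<le> C2 r) \<and> (\<forall>x. modulus (w x)) \<and>
    (\<forall>(P :: 'w measure) \<F> L (n::nat) t x y X Y.
       prob_space P \<and> complete_measure P \<and> normal_filtration P \<F> \<and> levy_martingale P \<F> \<nu> L \<and>
       1 \<le> n \<and> 0 \<le> t \<and> t \<le> T \<and>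
       mild_solution P (scaled_filtration n \<F>) (scaled_levy_measure n \<nu>) (scaled_process n L)
         S F G t T x X \<and>
       mild_solution P (scaled_filtration n \<F>) (scaled_levy_measure n \<nu>) (scaled_process n L)
         S F G t T y Y \<longrightarrow>
       (\<forall>s\<in>{t..T}.
          (\<integral>\<^sup>+\<omega>. ennreal ((norm_m1 B (X s \<omega> - Y s \<omega>))\<^sup>2) \<partial>P) \<le> ennreal (C1 * (norm_m1 B (x - y))\<^sup>2) \<and>
          (\<integral>\<^sup>+\<omega>. ennreal ((norm_m1 B (X s \<omega> - x))\<^sup>2) \<partial>P) \<le> ennreal (C2 (norm x) * (s - t)) \<and>
          (\<integral>\<^sup>+\<omega>. ennreal ((norm (X s \<omega> - x))\<^sup>2) \<partial>P) \<le> ennreal (w x (s - t))))"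
proof -
  note dd = assms(1) and S = assms(3) and gen = assms(4) and sa = assms(5) and dom = assms(7) and lm = assms(11)
  have pos: "0 \<le> B x \<bullet> x" for x
    using assms(6) unfolding strictly_positive_op_def by (cases "x = 0") (auto intro: less_imp_le)
  obtain K where K: "0 \<le> K" "\<And>x. norm (adj_op D A (B x)) \<le> K * norm x"
    using bounded_linear.nonneg_bounded[OF assms(8)] by (auto simp: mult.commute)
  \<comment> \<open>From exp (2 c0 r) <= exp (c0 T)^2 for r at most T.\<close>
  define \<gamma> where "\<gamma> = exp (c0 * T)"
  have \<gamma>: "norm_m1 B (S r x) \<le> \<gamma> * norm_m1 B x" if "0 \<le> r" "r \<le> T" for r x
  proof (rule power2_le_imp_le)
    have "(norm_m1 B (S r x))\<^sup>2 \<le> exp (2 * c0 * r) * (norm_m1 B x)\<^sup>2"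
      unfolding norm_m1_sq[OF sa pos] by (rule semigroup_weak_norm_growth[OF dd S gen sa dom assms(10) that(1)])
    also have "\<dots> \<le> \<gamma>\<^sup>2 * (norm_m1 B x)\<^sup>2"
    proof (rule mult_right_mono)
      have "2 * c0 * r \<le> 2 * (c0 * T)" using that assms(9) by (simp add: mult_left_mono)
      then show "exp (2 * c0 * r) \<le> \<gamma>\<^sup>2" unfolding \<gamma>_def by (simp add: exp_double[symmetric])
    qed simp
    finally show "(norm_m1 B (S r x))\<^sup>2 \<le> (\<gamma> * norm_m1 B x)\<^sup>2" by (simp add: power_mult_distrib)
  qed (simp add: \<gamma>_def norm_m1_def)
  have inc: "(norm_m1 B (S r x - x))\<^sup>2 \<le> 4 * K * (norm x)\<^sup>2 * r" if "0 \<le> r" for r x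
    unfolding norm_m1_sq[OF sa pos] by (rule semigroup_weak_norm_increment[OF dd S gen sa dom K(2,1) that])
  \<comment> \<open>The second moment of \<nu>. The rescaled moment is 1/n times this, so one value
    serves every n at least 1.\<close>
  define \<kappa> where "\<kappa> = enn2real (\<integral>\<^sup>+z. ennreal ((norm z)\<^sup>2) \<partial>\<nu>)"
  have \<kappa>0: "0 \<le> \<kappa>" unfolding \<kappa>_def by simp
  have sets: "sets \<nu> = sets borel" and fin: "(\<integral>\<^sup>+z. ennreal ((norm z)\<^sup>2) \<partial>\<nu>) < \<infinity>"
    using lm unfolding levy_measure2_def by auto
  have \<kappa>: "(\<integral>\<^sup>+z. ennreal ((norm z)\<^sup>2) \<partial>scaled_levy_measure n \<nu>) \<le> ennreal \<kappa>" if n: "1 \<le> n" for n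
  proof -
    have "(\<integral>\<^sup>+z. ennreal ((norm z)\<^sup>2) \<partial>scaled_levy_measure n \<nu>) = ennreal (1 / real n) * (\<integral>\<^sup>+z. ennreal ((norm z)\<^sup>2) \<partial>\<nu>)"
      using nn_integral_square_scaled[OF sets n, of id_blinfun] by simp
    also have "\<dots> \<le> 1 * (\<integral>\<^sup>+z. ennreal ((norm z)\<^sup>2) \<partial>\<nu>)" using n by (intro mult_right_mono) auto
    also have "\<dots> = ennreal \<kappa>" unfolding \<kappa>_def using fin by simp
    finally show ?thesis .
  qed
  have setting: "mild_setting P (scaled_filtration n \<F>) (scaled_levy_measure n \<nu>) (scaled_process n L) S F G B M \<gamma> \<kappa> T"
    if "prob_space P" "normal_filtration P \<F>" "levy_martingale P \<F> \<nu> L" "1 \<le> n"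
    for P :: "'w measure" and \<F> L n
  proof -
    interpret levy_driver P "scaled_filtration n \<F>" "scaled_levy_measure n \<nu>" "scaled_process n L"
      by (rule scaled_levy_driver[OF that(1) lm that(2-4)])
    show ?thesis
      by unfold_locales (use S \<gamma> assms(12-17) \<kappa>0 \<kappa>[OF that(4)] in \<open>auto simp: \<gamma>_def\<close>)
  qed
  \<comment> \<open>Nonnegativity of \<open>increment_const\<close> is proved for an instance of the
    locale, which requires a driver, whereas the constants must be fixed before any driver is given.
    The absolute value settles the sign unconditionally; the same is done with
    \<open>C1\<close>.\<close>
  define ic where "ic \<rho> = \<bar>mild_setting.increment_const B M \<kappa> T \<rho>\<bar>" for \<rho>
  \<comment> \<open>The factor 3 is that of the semigroup term in \<open>mild_increment\<close> and
    the linear part bounds drift and noise.\<close>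
  define w where "w x r = 3 * Sup ((\<lambda>q. (norm (S q x - x))\<^sup>2) ` {0..r}) + ic (norm x) * r" for x r
  have S0: "S 0 x = x" for x using S unfolding contraction_C0_semigroup_def by simp
  note sup = running_sup[where h="\<lambda>q. (norm (blinfun_apply (S q) x - x))\<^sup>2" for x]
  have cont: "continuous_on {0..} (\<lambda>q. (norm (S q x - x))\<^sup>2)" for x
    by (intro continuous_intros semigroup_continuous[OF S])
  have modw: "modulus (w x)" for x
  proof -
    have m: "modulus (\<lambda>r. Sup ((\<lambda>q. (norm (S q x - x))\<^sup>2) ` {0..r}))"
      by (rule sup(1)[OF cont]) (auto simp: S0)
    have "0 \<le> ic (norm x)" unfolding ic_def by simp
    then show ?thesis unfolding w_def[abs_def] by (intro modulus_affine m) simp_all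
  qed
  define C1 where "C1 = mild_setting.lipschitz_const B M \<gamma> \<kappa> T"
  \<comment> \<open>The number 12 K is three times the constant 4 K of the semigroup increment in
    the weak norm.\<close>
  define C2 where "C2 \<rho> = 12 * K * \<rho>\<^sup>2 + (norm (sqrt_op B))\<^sup>2 * ic \<rho>" for \<rho>
  show ?thesis
  proof (intro exI[of _ "\<bar>C1\<bar>"] exI[of _ C2] exI[of _ w] conjI allI impI ballI)
    show "0 \<le> \<bar>C1\<bar>" by simp
    show "0 \<le> C2 r" for r unfolding C2_def ic_def using K by simp
    show "modulus (w x)" for x by (rule modw)
    fix P :: "'w measure" and \<F> L n t x y X Y s
    assume H: "prob_space P \<and> complete_measure P \<and> normal_filtration P \<F> \<and> levy_martingale P \<F> \<nu> L \<and>
       1 \<le> n \<and> 0 \<le> t \<and> t \<le> T \<and>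
       mild_solution P (scaled_filtration n \<F>) (scaled_levy_measure n \<nu>) (scaled_process n L) S F G t T x X \<and>
       mild_solution P (scaled_filtration n \<F>) (scaled_levy_measure n \<nu>) (scaled_process n L) S F G t T y Y"
      and s: "s \<in> {t..T}"
    interpret mild_setting P "scaled_filtration n \<F>" "scaled_levy_measure n \<nu>" "scaled_process n L" S F G B M \<gamma> \<kappa> T
      using H by (intro setting) auto
    have t: "0 \<le> t" "t \<le> T" and X: "mild t x X" and Y: "mild t y Y" using H by auto
    have st: "0 \<le> s - t" using s by simp
    have ic: "increment_const \<rho> \<le> ic \<rho>" for \<rho> unfolding ic_def by simp
    have "(\<integral>\<^sup>+\<omega>. ennreal ((norm_m1 B (X s \<omega> - Y s \<omega>))\<^sup>2) \<partial>P) \<le> ennreal (C1 * (norm_m1 B (x - y))\<^sup>2)"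
      unfolding C1_def by (rule mild_lipschitz[OF t X Y s])
    also have "\<dots> \<le> ennreal (\<bar>C1\<bar> * (norm_m1 B (x - y))\<^sup>2)" by (intro ennreal_leI mult_right_mono) auto
    finally show "(\<integral>\<^sup>+\<omega>. ennreal ((norm_m1 B (X s \<omega> - Y s \<omega>))\<^sup>2) \<partial>P) \<le> ennreal (\<bar>C1\<bar> * (norm_m1 B (x - y))\<^sup>2)" .
    have "(\<integral>\<^sup>+\<omega>. ennreal ((norm_m1 B (X s \<omega> - x))\<^sup>2) \<partial>P)
        \<le> ennreal (3 * (norm_m1 B (S (s - t) x - x))\<^sup>2 + (norm (sqrt_op B))\<^sup>2 * increment_const (norm x) * (s - t))"
      unfolding norm_m1_def by (rule mild_increment[OF t X s])
    also have "\<dots> \<le> ennreal (C2 (norm x) * (s - t))"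
    proof (rule ennreal_leI)
      have "(norm (sqrt_op B))\<^sup>2 * increment_const (norm x) * (s - t) \<le> (norm (sqrt_op B))\<^sup>2 * ic (norm x) * (s - t)"
        by (intro mult_right_mono mult_left_mono ic st) auto
      then show "3 * (norm_m1 B (S (s - t) x - x))\<^sup>2 + (norm (sqrt_op B))\<^sup>2 * increment_const (norm x) * (s - t) \<le> C2 (norm x) * (s - t)"
        unfolding C2_def distrib_right using inc[OF st, of x] by linarith
    qed
    finally show "(\<integral>\<^sup>+\<omega>. ennreal ((norm_m1 B (X s \<omega> - x))\<^sup>2) \<partial>P) \<le> ennreal (C2 (norm x) * (s - t))" .
    have "(\<integral>\<^sup>+\<omega>. ennreal ((norm (X s \<omega> - x))\<^sup>2) \<partial>P)
        \<le> ennreal (3 * (norm (S (s - t) x - x))\<^sup>2 + (norm (id_blinfun :: 'a \<Rightarrow>\<^sub>L 'a))\<^sup>2 * increment_const (norm x) * (s - t))"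
      using mild_increment[OF t X s, of id_blinfun] by simp
    also have "\<dots> \<le> ennreal (w x (s - t))"
      unfolding w_def
    proof (intro ennreal_leI add_mono mult_left_mono)
      show "(norm (S (s - t) x - x))\<^sup>2 \<le> Sup ((\<lambda>q. (norm (S q x - x))\<^sup>2) ` {0..s - t})"
        by (rule sup(2)[OF cont _ _ st]) (auto simp: S0)
      have "(norm (id_blinfun :: 'a \<Rightarrow>\<^sub>L 'a))\<^sup>2 \<le> 1" using norm_blinfun_id_le[where 'a='a] by (simp add: power_le_one)
      then have "(norm (id_blinfun :: 'a \<Rightarrow>\<^sub>L 'a))\<^sup>2 * increment_const (norm x) \<le> 1 * ic (norm x)"
        using increment_const_nonneg by (intro mult_mono ic) auto
      then show "(norm (id_blinfun :: 'a \<Rightarrow>\<^sub>L 'a))\<^sup>2 * increment_const (norm x) * (s - t) \<le> ic (norm x) * (s - t)"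
        using st by (intro mult_right_mono) auto
    qed simp
    finally show "(\<integral>\<^sup>+\<omega>. ennreal ((norm (X s \<omega> - x))\<^sup>2) \<partial>P) \<le> ennreal (w x (s - t))" .
  qed
qed

end
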